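(* Let $Z$ be a finite set of points in complex projective space $\mathbb{P}^3$ and let $I\subset\mathbb{C}[x_0,x_1,x_2,x_3]$ be the radical ideal defining $Z$. Suppose that $$d:=\alpha(I^{(3)})=\alpha(I)+2.$$ Then either (a) $\alpha(I)=1$, i.e., $Z$ is contained in a single plane in $\mathbb{P}^3$; or (b) $Z$ is a star configuration: there is a general configuration of $d$ planes in $\mathbb{P}^3$ such that $Z$ consists of all points of $\mathbb{P}^3$ in which three planes of the configuration meet; moreover, for any nonzero homogeneous polynomial of degree $d$ in $I^{(3)}$, the corresponding surface decomposes into $d$ such planes (i.e., it is the union of the $d$ planes of such a configuration).
   Context: We work over $\mathbb{C}$. For a nonzero homogeneous ideal $J$ in a polynomial ring, $\alpha(J)$ denotes its initial degree, i.e., the least degree $k$ such that the degree-$k$ part $(J)_k$ is nonzero. For a homogeneous ideal $I$ in the polynomial ring $R=\mathbb{C}[x_0,\dots,x_n]$ and a positive integer $k$, the $k$-th symbolic power of $I$ is $I^{(k)}=R\cap\left(\bigcap_{\mathfrak{p}\in\mathrm{Ass}(I)}I^kR_{\mathfrak{p}}\right)$, the intersection being taken in the field of fractions of $R$. The radical ideal defining a finite set $Z\subset\mathbb{P}^n$ is the ideal generated by all homogeneous polynomials vanishing at every point of $Z$. A configuration of $d$ (distinct) planes in $\mathbb{P}^3$ is called general if no more than $3$ of the planes meet in one point; equivalently, the corresponding points of the dual projective space are in general linear position. The two alternatives (a) and (b) are not required to be mutually exclusive. *)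

theory Defs
  imports
    "HOL-Analysis.Analysis"
    "HOL-Library.Poly_Mapping"
    "HOL-Library.Numeral_Type"
    "HOL-Computational_Algebra.Fraction_Field"
begin

section \<open>Polynomials\<close>

text \<open>
  The polynomial ring over the complex numbers in variables indexed by the finite type \<open>'n\<close>:
  finitely supported maps from exponent vectors to coefficients, with the convolution product.
  The linear order on \<open>'n\<close> has no mathematical content; it only gives access to the library's
  \<^class>\<open>idom\<close> instance, which \<open>fract\<close> needs.
\<close>

type_synonym 'n cpoly = "('n \<Rightarrow>\<^sub>0 nat) \<Rightarrow>\<^sub>0 complex"

definition poly_eval :: "'n cpoly \<Rightarrow> complex ^ 'n::{finite,linorder} \<Rightarrow> complex" where
  "poly_eval f v =
     (\<Sum>m \<in> Poly_Mapping.keys f.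
        Poly_Mapping.lookup f m * (\<Prod>i\<in>UNIV. (v $ i) ^ Poly_Mapping.lookup m i))"

text \<open>The zero polynomial is homogeneous of every degree.\<close>

definition homogeneous :: "nat \<Rightarrow> 'n::{finite,linorder} cpoly \<Rightarrow> bool" where
  "homogeneous k f \<longleftrightarrow>
     (\<forall>m \<in> Poly_Mapping.keys f. (\<Sum>i\<in>UNIV. Poly_Mapping.lookup m i) = k)"

text \<open>Only meaningful for ideals containing a nonzero homogeneous polynomial.\<close>

definition initial_degree :: "'n::{finite,linorder} cpoly set \<Rightarrow> nat" where
  "initial_degree J = (LEAST k. \<exists>f\<in>J. f \<noteq> 0 \<and> homogeneous k f)"


section \<open>Ideals and symbolic powers\<close>

text \<open>
  A commutative ring as a module over itself: \<open>ideal.subspace\<close> is being an ideal, and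
  \<open>ideal.span\<close> is the ideal generated by a set.
\<close>

interpretation ideal: module "(*) :: 'a::comm_ring_1 \<Rightarrow> 'a \<Rightarrow> 'a"
  by unfold_locales (simp_all add: algebra_simps)

definition ideal_power :: "'a::comm_ring_1 set \<Rightarrow> nat \<Rightarrow> 'a set" where
  "ideal_power I k = ideal.span {\<Prod>i<k. f i | f. \<forall>i<k. f i \<in> I}"

definition prime_ideal :: "'a::comm_ring_1 set \<Rightarrow> bool" where
  "prime_ideal P \<longleftrightarrow>
     ideal.subspace P \<and> P \<noteq> UNIV \<and> (\<forall>a b. a * b \<in> P \<longrightarrow> a \<in> P \<or> b \<in> P)"

text \<open>
  As usual, the associated primes of the ideal \<open>I\<close> are those of the quotient module \<open>R / I\<close>, that
  is, the prime ideals that are the annihilator \<open>(I : f)\<close> of some residue class.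
\<close>

definition associated_primes :: "'a::comm_ring_1 set \<Rightarrow> 'a set set" where
  "associated_primes I = {P. prime_ideal P \<and> (\<exists>f. P = {g. g * f \<in> I})}"

text \<open>The extension of the ideal \<open>J\<close> to the local ring at \<open>P\<close>, inside the field of fractions.\<close>

definition localized_ideal :: "'a::idom set \<Rightarrow> 'a set \<Rightarrow> 'a fract set" where
  "localized_ideal J P = {Fraction_Field.Fract a s | a s. a \<in> J \<and> s \<notin> P}"

definition symbolic_power :: "'a::idom set \<Rightarrow> nat \<Rightarrow> 'a set" where
  "symbolic_power I k =
     {f. Fraction_Field.Fract f 1 \<in>
           (\<Inter>P\<in>associated_primes I. localized_ideal (ideal_power I k) P)}"


section \<open>Projective space\<close>

text \<open>
  The points of the projective space are the lines through the origin in \<open>complex ^ 'n\<close>, and a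
  plane is given by its three-dimensional affine cone; thus a point \<open>p\<close> lies on a plane \<open>H\<close> iff
  \<open>p \<subseteq> H\<close>. Dimensions are over the complex numbers. Projective three-space is the case
  \<open>'n = 4\<close>.
\<close>

definition proj_points :: "(complex ^ 'n) set set" where
  "proj_points = {p. vec.subspace p \<and> vec.dim p = 1}"

definition proj_planes :: "(complex ^ 'n) set set" where
  "proj_planes = {H. vec.subspace H \<and> vec.dim H = 3}"

text \<open>Intended for homogeneous polynomials, where any single representative decides.\<close>

definition vanishes_at :: "'n cpoly \<Rightarrow> (complex ^ 'n::{finite,linorder}) set \<Rightarrow> bool" where
  "vanishes_at f p \<longleftrightarrow> (\<forall>v \<in> p - {0}. poly_eval f v = 0)"

definition surface :: "'n cpoly \<Rightarrow> (complex ^ 'n::{finite,linorder}) set set" where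
  "surface f = {p \<in> proj_points. vanishes_at f p}"

definition radical_ideal ::
    "(complex ^ 'n::{finite,linorder}) set set \<Rightarrow> 'n cpoly set" where
  "radical_ideal Z = ideal.span {f. (\<exists>k. homogeneous k f) \<and> (\<forall>p\<in>Z. vanishes_at f p)}"


section \<open>Star configurations\<close>

definition general_planes :: "(complex ^ 4) set set \<Rightarrow> bool" where
  "general_planes \<H> \<longleftrightarrow>
     finite \<H> \<and> \<H> \<subseteq> proj_planes \<and> (\<forall>p\<in>proj_points. card {H\<in>\<H>. p \<subseteq> H} \<le> 3)"

definition triple_points :: "(complex ^ 4) set set \<Rightarrow> (complex ^ 4) set set" where
  "triple_points \<H> = {p \<in> proj_points. \<exists>T\<subseteq>\<H>. card T = 3 \<and> (\<forall>H\<in>T. p \<subseteq> H)}"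

definition star_configuration ::
    "(complex ^ 4) set set \<Rightarrow> nat \<Rightarrow> (complex ^ 4) set set \<Rightarrow> bool" where
  "star_configuration Z d \<H> \<longleftrightarrow> general_planes \<H> \<and> card \<H> = d \<and> Z = triple_points \<H>"

end

theory Submission
  imports Defs
    "HOL-Computational_Algebra.Polynomial_Factorial"
    "HOL-Computational_Algebra.Field_as_Ring"
    "HOL-Computational_Algebra.Fundamental_Theorem_Algebra"
begin

text \<open>
  Let \<open>F\<close> be a form of degree \<open>d\<close> with triple points along \<open>Z\<close>, where no nonzero form of degree
  \<open>d - 3\<close> vanishes on \<open>Z\<close>. If \<open>F = L * B\<close> with \<open>L\<close> linear, then \<open>B\<close> and the points of \<open>Z\<close> off the
  plane \<open>L = 0\<close> satisfy the same hypotheses, so it suffices to find a linear factor for \<open>d \<ge> 5\<close>.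
  Otherwise \<open>F\<close> is squarefree. Choose \<open>N = (d choose 3)\<close> points of \<open>Z\<close> that impose independent
  conditions on forms of degree \<open>d - 3\<close>. Each irreducible factor of \<open>F\<close> is a cone with respect to
  at most one vertex and \<open>F\<close> has fewer than \<open>N\<close> factors, so for some chosen point \<open>p\<close> the polar \<open>E\<close> of \<open>F\<close> with respect to \<open>p\<close> is coprime to \<open>F\<close>.
  Now \<open>E\<close> has degree \<open>d - 1\<close>, is singular at the chosen points, and is even triple at \<open>p\<close>.

  Since the points are separated by forms of degree \<open>d - 3\<close>, forms of degree \<open>s * (d - 2) - 1\<close>
  interpolate all jets of order less than \<open>s\<close> at the points. Comparing, for large \<open>s\<close>, the Hilbert function
  of the curve \<open>F = E = 0\<close> with its local contributions at the points gives the inequality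
  \<open>6 * N + 3 \<le> (d - 2) * d * (d - 1) = 6 * N\<close>, a contradiction.
\<close>

section \<open>Evaluation homomorphisms\<close>

text \<open>The identity \<open>6 * N = d * (d - 1) * (d - 2)\<close> leaves no slack: order 3 of
  \<open>F\<close> times order 2 of an arbitrary polar, summed over the \<open>N\<close> points,
  only meets the bound. The polar is therefore taken with respect to one of the points, where it
  loses no order; this is the extra 3. The factor \<open>d - 2\<close> has a geometric origin. The
  ideal of points separated by forms of degree \<open>d - 3\<close> is generated in degrees up to
  \<open>d - 2\<close>, so classically some surface of degree \<open>d - 2\<close> through the
  points would contain no component of the curve, and Bezout's theorem would apply to it. Counting
  dimensions of spaces of jets gives the same bound from rank-nullity and factoriality, without
  intersection multiplicities. Coprimality is the obstacle. A prime factor shared by the squarefree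
  \<open>F\<close> and its polar is itself a cone with vertex \<open>p\<close>, and a cone with two
  vertices contains a plane; so without linear factors different points would need different prime
  factors, too many for degree \<open>d\<close>. Splitting off a plane keeps the hypotheses because
  a form \<open>G\<close> vanishing on the points off the plane \<open>L = 0\<close> gives
  \<open>L * G\<close> vanishing on all of them.\<close>

text \<open>
  The interpretation \<open>ideal\<close> makes \<open>a * (b * x) = a * b * x\<close> a simplification rule, which loops
  with \<open>mult_ac\<close>.
\<close>

declare ideal.scale_scale [simp del]

definition mdeg :: "('n::finite \<Rightarrow>\<^sub>0 nat) \<Rightarrow> nat" where
  "mdeg m = (\<Sum>i\<in>UNIV. Poly_Mapping.lookup m i)"

lemma mdeg_0 [simp]: "mdeg 0 = 0"
  by (simp add: mdeg_def)

lemma mdeg_add [simp]: "mdeg (m + n) = mdeg m + mdeg n"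
  by (simp add: mdeg_def lookup_add sum.distrib)

lemma mdeg_single [simp]: "mdeg (Poly_Mapping.single i k) = k"
  by (simp add: mdeg_def lookup_single when_def)

lemma sum_monomials:
  "(\<Sum>m\<in>Poly_Mapping.keys f. Poly_Mapping.single m (Poly_Mapping.lookup f m)) = f"
  by (intro poly_mapping_eqI) (auto simp: lookup_sum lookup_single when_def in_keys_iff)

definition Cst :: "complex \<Rightarrow> 'n::{finite,linorder} cpoly" where
  "Cst c = Poly_Mapping.single 0 c"

definition Var :: "'n::{finite,linorder} \<Rightarrow> 'n cpoly" where
  "Var i = Poly_Mapping.single (Poly_Mapping.single i 1) 1"

text \<open>One scheme, coefficients through \<open>h\<close> and variables through
  \<open>x\<close>, covers point evaluation, substitution, the grading, the map behind
  differentiation, restriction to lines and the passage to iterated polynomials, so multiplicativity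
  is proved once.\<close>

definition peval :: "(complex \<Rightarrow> 'b) \<Rightarrow> ('n \<Rightarrow> 'b) \<Rightarrow> 'n::{finite,linorder} cpoly \<Rightarrow> 'b::comm_ring_1" where
  "peval h x f = (\<Sum>m\<in>Poly_Mapping.keys f.
     h (Poly_Mapping.lookup f m) * (\<Prod>i\<in>UNIV. x i ^ Poly_Mapping.lookup m i))"

locale coeff_hom =
  fixes h :: "complex \<Rightarrow> 'b::comm_ring_1"
  assumes h_add: "h (a + b) = h a + h b"
    and h_mult: "h (a * b) = h a * h b"
    and h_1: "h 1 = 1"
begin

lemma h_0: "h 0 = 0"
  using h_add[of 0 0] by simp

lemma h_uminus: "h (- a) = - h a"
  using h_add[of a "- a"] by (simp add: h_0 add_eq_0_iff)

lemma peval_superset: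
  assumes "finite S" "Poly_Mapping.keys f \<subseteq> S"
  shows "peval h x f = (\<Sum>m\<in>S. h (Poly_Mapping.lookup f m) * (\<Prod>i\<in>UNIV. x i ^ Poly_Mapping.lookup m i))"
  unfolding peval_def using assms
  by (intro sum.mono_neutral_left) (auto simp: in_keys_iff h_0)

lemma peval_0 [simp]: "peval h x 0 = 0"
  by (simp add: peval_def)

lemma peval_add [simp]: "peval h x (f + g) = peval h x f + peval h x g"
proof -
  let ?S = "Poly_Mapping.keys f \<union> Poly_Mapping.keys g"
  have "peval h x (f + g) = (\<Sum>m\<in>?S. h (Poly_Mapping.lookup (f + g) m) * (\<Prod>i\<in>UNIV. x i ^ Poly_Mapping.lookup m i))"
    by (rule peval_superset) (auto simp: keys_add)
  also have "\<dots> = peval h x f + peval h x g"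
    by (simp add: peval_superset[of ?S f] peval_superset[of ?S g] lookup_add sum.distrib distrib_right h_add)
  finally show ?thesis .
qed

lemma peval_single:
  "peval h x (Poly_Mapping.single m c) = h c * (\<Prod>i\<in>UNIV. x i ^ Poly_Mapping.lookup m i)"
  by (subst peval_superset[of "{m}"]) (auto split: if_splits simp: h_0)

lemma peval_sum [simp]: "peval h x (sum f A) = (\<Sum>a\<in>A. peval h x (f a))"
  by (induction A rule: infinite_finite_induct) auto

lemma peval_mult [simp]: "peval h x (f * g) = peval h x f * peval h x g"
proof -
  have 1: "peval h x (Poly_Mapping.single m c * Poly_Mapping.single n d) =
        peval h x (Poly_Mapping.single m c) * peval h x (Poly_Mapping.single n d)" for m n c d
    by (simp only: mult_single peval_single lookup_add power_add prod.distrib h_mult mult_ac)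
  have "f * g = (\<Sum>m\<in>Poly_Mapping.keys f. Poly_Mapping.single m (Poly_Mapping.lookup f m)) *
     (\<Sum>n\<in>Poly_Mapping.keys g. Poly_Mapping.single n (Poly_Mapping.lookup g n))"
    by (simp only: sum_monomials)
  also have "peval h x \<dots> =
    peval h x (\<Sum>m\<in>Poly_Mapping.keys f. Poly_Mapping.single m (Poly_Mapping.lookup f m)) *
    peval h x (\<Sum>n\<in>Poly_Mapping.keys g. Poly_Mapping.single n (Poly_Mapping.lookup g n))"
    by (simp only: sum_product peval_sum 1)
  finally show ?thesis by (simp only: sum_monomials)
qed

lemma peval_Cst [simp]: "peval h x (Cst c) = h c"
  by (simp add: Cst_def peval_single h_1)

lemma peval_1 [simp]: "peval h x 1 = 1"
  using peval_Cst[of x 1] by (simp add: Cst_def h_1)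

lemma peval_Var [simp]: "peval h x (Var i) = x i"
proof -
  have "peval h x (Var i) = (\<Prod>j\<in>UNIV. x j ^ (if i = j then 1 else 0))"
    by (auto simp: Var_def peval_single lookup_single when_def h_1 intro!: prod.cong)
  also have "\<dots> = (\<Prod>j\<in>UNIV. if j = i then x i else 1)"
    by (rule prod.cong) auto
  finally show ?thesis by simp
qed

lemma peval_uminus [simp]: "peval h x (- f) = - peval h x f"
  using peval_add[of x f "- f"] by (simp add: add_eq_0_iff)

lemma peval_diff [simp]: "peval h x (f - g) = peval h x f - peval h x g"
  using peval_add[of x f "- g"] by simp

lemma peval_power [simp]: "peval h x (f ^ k) = peval h x f ^ k"
  by (induction k) auto

lemma peval_prod [simp]: "peval h x (prod f A) = (\<Prod>a\<in>A. peval h x (f a))"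
  by (induction A rule: infinite_finite_induct) auto

end

lemma Cst_0 [simp]: "Cst 0 = 0" by (simp add: Cst_def)
lemma Cst_1 [simp]: "Cst 1 = 1" by (simp add: Cst_def)
lemma Cst_add: "Cst (a + b) = Cst a + Cst b" by (simp add: Cst_def single_add)
lemma Cst_mult: "Cst (a * b) = Cst a * Cst b" by (simp add: Cst_def mult_single)

lemma lookup_Cst_mult [simp]: "Poly_Mapping.lookup (Cst c * f) m = c * Poly_Mapping.lookup f m"
  unfolding Cst_def mult_map_scale_conv_mult[symmetric] by (simp add: Poly_Mapping.map.rep_eq when_def)

lemma Cst_eq_0_iff [simp]: "Cst c = 0 \<longleftrightarrow> c = 0"
  by (metis Cst_def lookup_single_eq lookup_zero single_zero)

interpretation cpoly: vector_space "\<lambda>c (f :: 'n::{finite,linorder} cpoly). Cst c * f"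
  by unfold_locales (simp_all add: distrib_left distrib_right Cst_add Cst_mult mult.assoc)

declare cpoly.scale_scale [simp del]

lemma keys_Cst_mult: "c \<noteq> 0 \<Longrightarrow> Poly_Mapping.keys (Cst c * f) = Poly_Mapping.keys f"
  by (auto simp: in_keys_iff)

lemma single_conv_Var:
  fixes m :: "'n::{finite,linorder} \<Rightarrow>\<^sub>0 nat"
  shows "Poly_Mapping.single m c = Cst c * (\<Prod>i\<in>UNIV. Var i ^ Poly_Mapping.lookup m i)"
proof -
  have p: "Var i ^ k = Poly_Mapping.single (Poly_Mapping.single i k) 1" for i :: 'n and k
  proof (induction k)
    case (Suc k)
    have "Var i ^ Suc k = Poly_Mapping.single (Poly_Mapping.single i 1 + Poly_Mapping.single i k) 1"
      unfolding power_Suc Suc by (simp only: Var_def mult_single mult_1)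
    then show ?case by (simp only: single_add[symmetric] plus_1_eq_Suc)
  qed simp
  have q: "(\<Prod>i\<in>A. Poly_Mapping.single (g i) (1::complex)) = Poly_Mapping.single (\<Sum>i\<in>A. g i) 1"
    if "finite A" for A and g :: "'n \<Rightarrow> 'n \<Rightarrow>\<^sub>0 nat"
    using that
  proof (induction A)
    case (insert i A)
    show ?case
      unfolding prod.insert[OF insert.hyps(1,2)] sum.insert[OF insert.hyps(1,2)] insert.IH
      by (simp only: mult_single mult_1)
  qed simp
  have "(\<Sum>i\<in>UNIV. Poly_Mapping.single i (Poly_Mapping.lookup m i)) = m"
    by (intro poly_mapping_eqI) (simp add: lookup_sum lookup_single when_def)
  then show ?thesis
    by (simp add: p q Cst_def mult_single)
qed

text \<open>Constants and variables generate the ring, so identities between homomorphisms or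
  derivations need checking only there.\<close>

lemma cpoly_induct [case_names Cst Var add mult]:
  assumes "\<And>c. P (Cst c)" "\<And>i. P (Var i)"
    "\<And>f g. P f \<Longrightarrow> P g \<Longrightarrow> P (f + g)" "\<And>f g. P f \<Longrightarrow> P g \<Longrightarrow> P (f * g)"
  shows "P f"
proof -
  have pw: "P (Var i ^ k)" for i k
    by (induction k) (use assms(1)[of 1] assms in auto)
  have pr: "P (\<Prod>i\<in>A. Var i ^ m i)" if "finite A" for A m
    using that by (induction A) (use assms(1)[of 1] assms pw in auto)
  have sg: "P (Poly_Mapping.single m c)" for m c
    by (simp add: single_conv_Var assms pr)
  have "P (\<Sum>m\<in>A. Poly_Mapping.single m (Poly_Mapping.lookup f m))" if "finite A" for A
    using that by (induction A) (use assms(1)[of 0] assms sg in auto)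
  from this[of "Poly_Mapping.keys f"] show ?thesis by (simp add: sum_monomials)
qed

interpretation coeff_hom_id: coeff_hom "\<lambda>c. c" by unfold_locales auto
interpretation coeff_hom_Cst: coeff_hom Cst by unfold_locales (auto simp: Cst_add Cst_mult)
interpretation coeff_hom_poly: coeff_hom "\<lambda>c. [:c:]" by unfold_locales (auto simp: one_pCons)
interpretation coeff_hom_Cst_poly: coeff_hom "\<lambda>c. [:Cst c:]" 
  by unfold_locales (auto simp: one_pCons Cst_add Cst_mult)

lemma poly_eval_conv_peval: "poly_eval f v = peval (\<lambda>c. c) (\<lambda>i. v $ i) f"
  by (simp add: poly_eval_def peval_def)

section \<open>Degree and order of vanishing\<close>

text \<open>Order of vanishing at the origin, kept as a lower bound so that the zero polynomial
  satisfies every bound and sums cause no exceptions.\<close>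

definition ordge :: "nat \<Rightarrow> 'n::{finite,linorder} cpoly \<Rightarrow> bool" where
  "ordge r f \<longleftrightarrow> (\<forall>m\<in>Poly_Mapping.keys f. r \<le> mdeg m)"

text \<open>This is \<open>f\<close> with every variable multiplied by a new variable
  \<open>T\<close>; the coefficient of \<open>T ^ j\<close> is the component of degree
  \<open>j\<close>. As a homomorphism into univariate polynomials over a domain it reduces degrees
  and orders of products to \<open>degree\<close> and \<open>order 0\<close>.\<close>

definition grad :: "'n::{finite,linorder} cpoly \<Rightarrow> 'n cpoly poly" where
  "grad = peval (\<lambda>c. [:Cst c:]) (\<lambda>i. monom (Var i) 1)"

lemma homogeneous_iff_mdeg: "homogeneous k f \<longleftrightarrow> (\<forall>m\<in>Poly_Mapping.keys f. mdeg m = k)"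
  by (simp add: homogeneous_def mdeg_def)

lemma grad_0 [simp]: "grad 0 = 0"
  and grad_1 [simp]: "grad 1 = 1"
  and grad_add: "grad (f + g) = grad f + grad g"
  and grad_mult: "grad (f * g) = grad f * grad g"
  and grad_sum: "grad (sum F A) = (\<Sum>a\<in>A. grad (F a))"
  by (simp_all add: grad_def)

lemma prod_monom: "(\<Prod>i\<in>A. monom (f i) (k i)) = monom (\<Prod>i\<in>A. f i) (\<Sum>i\<in>A. k i)"
  by (induction A rule: infinite_finite_induct) (auto simp: mult_monom)

lemma grad_single: "grad (Poly_Mapping.single m c) = monom (Poly_Mapping.single m c) (mdeg m)"
  by (simp add: grad_def coeff_hom_Cst_poly.peval_single monom_power prod_monom mdeg_def single_conv_Var smult_monom)

lemma grad_conv_sum: "grad f = (\<Sum>m\<in>Poly_Mapping.keys f. monom (Poly_Mapping.single m (Poly_Mapping.lookup f m)) (mdeg m))"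
proof -
  have "grad f = grad (\<Sum>m\<in>Poly_Mapping.keys f. Poly_Mapping.single m (Poly_Mapping.lookup f m))"
    by (simp only: sum_monomials)
  then show ?thesis by (simp only: grad_sum grad_single)
qed

lemma lookup_coeff_grad:
  "Poly_Mapping.lookup (coeff (grad f) j) m = (if mdeg m = j then Poly_Mapping.lookup f m else 0)"
proof -
  have "Poly_Mapping.lookup (coeff (grad f) j) m =
     (\<Sum>n\<in>Poly_Mapping.keys f. if m = n then (if mdeg m = j then Poly_Mapping.lookup f m else 0) else 0)"
    unfolding grad_conv_sum coeff_sum lookup_sum
    by (intro sum.cong) (auto simp: lookup_single when_def)
  then show ?thesis by (auto simp: in_keys_iff)
qed

lemma grad_eq_0_iff [simp]: "grad f = 0 \<longleftrightarrow> f = 0"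
proof
  assume "grad f = 0"
  then have "Poly_Mapping.lookup f m = 0" for m
    using lookup_coeff_grad[of f "mdeg m" m] by simp
  then show "f = 0" by (intro poly_mapping_eqI) simp
qed simp

lemma homogeneous_iff_grad: "homogeneous k f \<longleftrightarrow> grad f = monom f k"
proof
  assume "homogeneous k f"
  then show "grad f = monom f k"
    by (intro poly_eqI poly_mapping_eqI)
       (auto simp: lookup_coeff_grad homogeneous_iff_mdeg in_keys_iff)
next
  assume *: "grad f = monom f k"
  show "homogeneous k f"
    unfolding homogeneous_iff_mdeg
  proof
    fix m assume "m \<in> Poly_Mapping.keys f"
    then show "mdeg m = k"
      using lookup_coeff_grad[of f "mdeg m" m] by (auto simp: * in_keys_iff split: if_splits)
  qed
qed

lemma homogeneous_0 [simp]: "homogeneous k 0" by (simp add: homogeneous_def)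
lemma homogeneous_Cst [simp]: "homogeneous 0 (Cst c)" by (auto simp: homogeneous_iff_mdeg Cst_def split: if_splits)
lemma homogeneous_1 [simp]: "homogeneous 0 1" using homogeneous_Cst[of 1] by simp
lemma homogeneous_Var [simp]: "homogeneous 1 (Var i)" by (simp add: homogeneous_iff_mdeg Var_def)
lemma homogeneous_single [simp]: "homogeneous (mdeg m) (Poly_Mapping.single m c)"
  by (auto simp: homogeneous_iff_mdeg)

lemma homogeneous_add: "homogeneous k f \<Longrightarrow> homogeneous k g \<Longrightarrow> homogeneous k (f + g)"
  by (simp add: homogeneous_iff_grad grad_add add_monom)

lemma homogeneous_sum: "(\<And>a. a \<in> A \<Longrightarrow> homogeneous k (f a)) \<Longrightarrow> homogeneous k (sum f A)"
  by (induction A rule: infinite_finite_induct) (auto simp: homogeneous_add)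

lemma homogeneous_mult: "homogeneous i f \<Longrightarrow> homogeneous j g \<Longrightarrow> homogeneous (i + j) (f * g)"
  by (simp add: homogeneous_iff_grad grad_mult mult_monom)

lemma homogeneous_Cst_mult: "homogeneous k f \<Longrightarrow> homogeneous k (Cst c * f)"
  using homogeneous_mult[of 0 "Cst c" k f] by simp

lemma homogeneous_diff: "homogeneous k f \<Longrightarrow> homogeneous k g \<Longrightarrow> homogeneous k (f - g)"
  using homogeneous_add[of k f "Cst (- 1) * g"] homogeneous_Cst_mult[of k g "- 1"]
  by (simp add: coeff_hom_Cst.h_uminus)

lemma homogeneous_power: "homogeneous i f \<Longrightarrow> homogeneous (i * n) (f ^ n)"
  by (induction n) (auto dest: homogeneous_mult)

lemma homogeneous_prod:
  "(\<And>a. a \<in> A \<Longrightarrow> homogeneous (k a) (f a)) \<Longrightarrow> homogeneous (\<Sum>a\<in>A. k a) (prod f A)"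
  by (induction A rule: infinite_finite_induct) (auto simp: homogeneous_mult)

lemma homogeneous_unique: "f \<noteq> 0 \<Longrightarrow> homogeneous i f \<Longrightarrow> homogeneous j f \<Longrightarrow> i = j"
  by (simp add: homogeneous_iff_grad monom_eq_iff')

lemma homogeneous_0D: "homogeneous 0 f \<Longrightarrow> \<exists>c. f = Cst c"
proof -
  assume h: "homogeneous 0 f"
  have "mdeg m = 0 \<Longrightarrow> m = 0" for m :: "'a \<Rightarrow>\<^sub>0 nat"
    by (intro poly_mapping_eqI) (simp add: mdeg_def)
  then have "f = Cst (Poly_Mapping.lookup f 0)"
    using h by (intro poly_mapping_eqI)
      (auto simp: Cst_def lookup_single when_def homogeneous_iff_mdeg, metis in_keys_iff)
  then show ?thesis by blast
qed

lemma poly_grad_1 [simp]: "poly (grad f) 1 = f"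
  by (induction f rule: cpoly_induct) (simp_all add: grad_def poly_monom)

lemma monom_if_order_eq_degree:
  fixes p :: "'a::idom poly"
  assumes "p \<noteq> 0" "order 0 p = degree p"
  shows "p = monom (lead_coeff p) (degree p)"
proof (rule poly_eqI)
  fix n
  have "monom 1 (degree p) dvd p" using assms by (simp add: monom_1_dvd_iff)
  then have "coeff p n = 0" if "n < degree p" using that by (simp add: monom_1_dvd_iff')
  then show "coeff p n = coeff (monom (lead_coeff p) (degree p)) n"
    by (cases n "degree p" rule: linorder_cases) (auto simp: coeff_eq_0)
qed

text \<open>For \<open>grad f\<close> and \<open>grad g\<close> the order at 0 is at most the
  degree. Both quantities are additive and both add up to \<open>k\<close>, so equality holds for
  each factor and makes it a monomial in \<open>T\<close>.\<close>

lemma homogeneous_factor: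
  fixes f g :: "'n::{finite,linorder} cpoly"
  assumes "homogeneous k (f * g)" "f * g \<noteq> 0"
  obtains i j where "homogeneous i f" "homogeneous j g" "i + j = k"
proof -
  have nz: "f \<noteq> 0" "g \<noteq> 0" using assms by auto
  have e: "grad f * grad g = monom (f * g) k"
    using assms by (simp add: homogeneous_iff_grad flip: grad_mult)
  have "order 0 (monom (f * g) k) = k" using assms
    by (intro order_0_monom) auto
  then have o: "order 0 (grad f) + order 0 (grad g) = k"
    using order_mult[of "grad f" "grad g" 0] e nz by auto
  have d: "degree (grad f) + degree (grad g) = k"
    using degree_mult_eq[of "grad f" "grad g"] e nz assms by (auto simp: degree_monom_eq)
  have le: "order 0 (grad f) \<le> degree (grad f)" "order 0 (grad g) \<le> degree (grad g)"
    using nz by (auto intro: order_degree)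
  have "homogeneous (degree (grad h)) h" if "h \<noteq> 0" "order 0 (grad h) = degree (grad h)" for h :: "'n cpoly"
  proof -
    have m: "grad h = monom (lead_coeff (grad h)) (degree (grad h))"
      using that by (intro monom_if_order_eq_degree) auto
    have "h = poly (grad h) 1" by simp
    also have "\<dots> = lead_coeff (grad h)" by (subst m) (simp add: poly_monom)
    finally show ?thesis using m by (simp add: homogeneous_iff_grad)
  qed
  from this[of f] this[of g] show ?thesis using that o d le nz by simp
qed

lemma ordge_iff_grad: "ordge r f \<longleftrightarrow> monom 1 r dvd grad f"
  unfolding monom_1_dvd_iff'
proof
  assume "ordge r f"
  then show "\<forall>k<r. coeff (grad f) k = 0"
    by (auto intro!: poly_mapping_eqI simp: lookup_coeff_grad ordge_def)
       (metis in_keys_iff linorder_not_le)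
next
  assume *: "\<forall>k<r. coeff (grad f) k = 0"
  show "ordge r f"
    unfolding ordge_def
  proof
    fix m assume "m \<in> Poly_Mapping.keys f"
    then show "r \<le> mdeg m"
      using * lookup_coeff_grad[of f "mdeg m" m] by (force simp: in_keys_iff not_le[symmetric])
  qed
qed

lemma ordge_0 [simp]: "ordge r 0" by (simp add: ordge_def)
lemma ordge_0' [simp]: "ordge 0 f" by (simp add: ordge_def)
lemma ordge_mono: "ordge s f \<Longrightarrow> r \<le> s \<Longrightarrow> ordge r f" by (auto simp: ordge_def)
lemma ordge_add: "ordge r f \<Longrightarrow> ordge r g \<Longrightarrow> ordge r (f + g)"
  by (simp add: ordge_iff_grad grad_add)
lemma ordge_sum: "(\<And>a. a \<in> A \<Longrightarrow> ordge r (f a)) \<Longrightarrow> ordge r (sum f A)"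
  by (induction A rule: infinite_finite_induct) (auto simp: ordge_add)
lemma ordge_mult: "ordge r f \<Longrightarrow> ordge s g \<Longrightarrow> ordge (r + s) (f * g)"
  using mult_dvd_mono[of "monom 1 r" "grad f" "monom 1 s" "grad g"]
  by (simp add: ordge_iff_grad grad_mult mult_monom)
lemma ordge_mult_left: "ordge r g \<Longrightarrow> ordge r (f * g)"
  using ordge_mult[of 0 f r g] by simp
lemma ordge_power: "ordge r f \<Longrightarrow> ordge (r * n) (f ^ n)"
  by (induction n) (auto dest: ordge_mult)
lemma ordge_Var [simp]: "ordge 1 (Var i)" by (simp add: ordge_def Var_def)
lemma ordge_prod: "(\<And>a. a \<in> A \<Longrightarrow> ordge (k a) (f a)) \<Longrightarrow> ordge (\<Sum>a\<in>A. k a) (prod f A)"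
  by (induction A rule: infinite_finite_induct) (auto simp: ordge_mult)

text \<open>The degree of the lowest component; meaningful only for nonzero
  \<open>f\<close>.\<close>

definition vord :: "'n::{finite,linorder} cpoly \<Rightarrow> nat" where
  "vord f = order 0 (grad f)"

lemma ordge_iff_vord: "f \<noteq> 0 \<Longrightarrow> ordge r f \<longleftrightarrow> r \<le> vord f"
  by (simp add: ordge_iff_grad vord_def monom_1_dvd_iff)

lemma vord_mult: "f \<noteq> 0 \<Longrightarrow> g \<noteq> 0 \<Longrightarrow> vord (f * g) = vord f + vord g"
  by (simp add: vord_def grad_mult order_mult)

abbreviation subst :: "('n \<Rightarrow> 'm cpoly) \<Rightarrow> 'n::{finite,linorder} cpoly \<Rightarrow> 'm::{finite,linorder} cpoly" where
  "subst \<equiv> peval Cst"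

lemma subst_conv_sum:
  "subst y f = (\<Sum>m\<in>Poly_Mapping.keys f. Cst (Poly_Mapping.lookup f m) * (\<Prod>i\<in>UNIV. y i ^ Poly_Mapping.lookup m i))"
  by (simp add: peval_def)

lemma ordge_subst:
  assumes "\<And>i. ordge 1 (y i)" "ordge r f" shows "ordge r (subst y f)"
  unfolding subst_conv_sum
proof (intro ordge_sum ordge_mult_left)
  fix m assume "m \<in> Poly_Mapping.keys f"
  then have "r \<le> mdeg m" using assms by (auto simp: ordge_def)
  moreover have "ordge (\<Sum>i\<in>UNIV. 1 * Poly_Mapping.lookup m i) (\<Prod>i\<in>UNIV. y i ^ Poly_Mapping.lookup m i)"
    by (intro ordge_prod ordge_power assms)
  ultimately show "ordge r (\<Prod>i\<in>UNIV. y i ^ Poly_Mapping.lookup m i)"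
    by (auto simp: mdeg_def intro: ordge_mono)
qed

lemma poly_eval_0 [simp]: "poly_eval 0 v = 0"
  and poly_eval_1 [simp]: "poly_eval 1 v = 1"
  and poly_eval_Cst [simp]: "poly_eval (Cst c) v = c"
  and poly_eval_Var [simp]: "poly_eval (Var i) v = v $ i"
  and poly_eval_add [simp]: "poly_eval (f + g) v = poly_eval f v + poly_eval g v"
  and poly_eval_diff [simp]: "poly_eval (f - g) v = poly_eval f v - poly_eval g v"
  and poly_eval_uminus [simp]: "poly_eval (- f) v = - poly_eval f v"
  and poly_eval_mult [simp]: "poly_eval (f * g) v = poly_eval f v * poly_eval g v"
  and poly_eval_power [simp]: "poly_eval (f ^ k) v = poly_eval f v ^ k"
  and poly_eval_sum [simp]: "poly_eval (sum F A) v = (\<Sum>a\<in>A. poly_eval (F a) v)"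
  and poly_eval_prod [simp]: "poly_eval (prod F A) v = (\<Prod>a\<in>A. poly_eval (F a) v)"
  by (simp_all add: poly_eval_conv_peval)

lemma poly_eval_subst [simp]: "poly_eval (subst y f) v = poly_eval f (\<chi> i. poly_eval (y i) v)"
  by (induction f rule: cpoly_induct) simp_all

lemma poly_eval_homogeneous:
  assumes "homogeneous k f" shows "poly_eval f (c *s v) = c ^ k * poly_eval f v"
proof -
  have "(\<Prod>i\<in>UNIV. c ^ Poly_Mapping.lookup m i) = c ^ k" if "m \<in> Poly_Mapping.keys f" for m
    using that assms by (simp add: homogeneous_iff_mdeg mdeg_def flip: power_sum)
  then show ?thesis
    unfolding poly_eval_def sum_distrib_left
    by (intro sum.cong) (auto simp: power_mult_distrib prod.distrib)
qed

lemma ordge_1_iff: "ordge 1 f \<longleftrightarrow> poly_eval f 0 = 0"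
proof -
  have *: "(\<Prod>i\<in>UNIV. (0::complex) ^ Poly_Mapping.lookup m i) = (if m = 0 then 1 else 0)" for m :: "'a \<Rightarrow>\<^sub>0 nat"
  proof (cases "m = 0")
    case False
    then obtain i where "Poly_Mapping.lookup m i \<noteq> 0" by (metis poly_mapping_eqI lookup_zero)
    then show ?thesis using False by (auto intro!: prod_zero bexI[of _ i])
  qed auto
  have m: "1 \<le> mdeg m \<longleftrightarrow> m \<noteq> 0" for m :: "'a \<Rightarrow>\<^sub>0 nat"
  proof
    assume "m \<noteq> 0"
    then obtain i where "Poly_Mapping.lookup m i \<noteq> 0" by (metis poly_mapping_eqI lookup_zero)
    then show "1 \<le> mdeg m" unfolding mdeg_def
      by (metis UNIV_I finite_class.finite_UNIV less_one linorder_not_less sum_eq_0_iff)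
  qed auto
  have "poly_eval f 0 = (\<Sum>m\<in>Poly_Mapping.keys f. if m = 0 then Poly_Mapping.lookup f 0 else 0)"
    unfolding poly_eval_def by (intro sum.cong) (auto simp: *)
  also have "\<dots> = Poly_Mapping.lookup f 0" by (auto simp: in_keys_iff)
  finally show ?thesis unfolding ordge_def m by (auto simp: in_keys_iff)
qed

section \<open>Derivatives and translations\<close>

lemma ordge_diff: "ordge r f \<Longrightarrow> ordge r g \<Longrightarrow> ordge r (f - g)"
  using ordge_add[of r f "- g"] ordge_mult_left[of r g "- 1"] by simp

text \<open>The coefficient of \<open>T\<close> after adding \<open>T\<close> to the
  \<open>i\<close>-th variable. The Leibniz rule is then the formula for the linear coefficient of a
  product.\<close>

definition partial_deriv :: "'n \<Rightarrow> 'n::{finite,linorder} cpoly \<Rightarrow> 'n cpoly" where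
  "partial_deriv i f = coeff (peval (\<lambda>c. [:Cst c:]) (\<lambda>j. [:Var j, if j = i then 1 else 0:]) f) 1"

lemma partial_deriv_0 [simp]: "partial_deriv i 0 = 0"
  and partial_deriv_Cst [simp]: "partial_deriv i (Cst c) = 0"
  and partial_deriv_Var: "partial_deriv i (Var j) = (if j = i then 1 else 0)"
  and partial_deriv_add [simp]: "partial_deriv i (f + g) = partial_deriv i f + partial_deriv i g"
  by (simp_all add: partial_deriv_def)

lemma partial_deriv_1 [simp]: "partial_deriv i 1 = 0"
  using partial_deriv_Cst[of i 1] by simp

lemma partial_deriv_sum [simp]: "partial_deriv i (sum F A) = (\<Sum>a\<in>A. partial_deriv i (F a))"
  by (induction A rule: infinite_finite_induct) auto

lemma partial_deriv_mult [simp]: "partial_deriv i (f * g) = f * partial_deriv i g + g * partial_deriv i f"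
proof -
  have 0: "coeff (peval (\<lambda>c. [:Cst c:]) (\<lambda>j. [:Var j, if j = i then 1 else 0:]) f) 0 = f" for f
    by (induction f rule: cpoly_induct) (simp_all add: coeff_mult_0)
  show ?thesis
    by (simp add: partial_deriv_def coeff_mult 0 mult.commute)
qed

text \<open>In degree 0 the subtraction \<open>mdeg m - 1\<close> is cut off at 0. The second
  conjunct records that the derivative vanishes there; without it the degrees of the two terms of
  the Leibniz rule would not match.\<close>

lemma homogeneous_partial_deriv_aux: "homogeneous (mdeg m - 1) (partial_deriv i (Poly_Mapping.single m c)) \<and>
  (mdeg m = 0 \<longrightarrow> partial_deriv i (Poly_Mapping.single m c) = 0)"
proof -
  define H where "H k f \<longleftrightarrow> homogeneous k f \<and> homogeneous (k - 1) (partial_deriv i f) \<and> (k = 0 \<longrightarrow> partial_deriv i f = 0)" for k f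
  have H_mult: "H (j + k) (f * g)" if "H j f" "H k g" for j k f g
  proof -
    have "homogeneous (j + k - 1) (f * partial_deriv i g)"
      using that homogeneous_mult[of j f "k - 1" "partial_deriv i g"] by (cases k) (auto simp: H_def)
    moreover have "homogeneous (j + k - 1) (g * partial_deriv i f)"
      using that homogeneous_mult[of k g "j - 1" "partial_deriv i f"] by (cases j) (auto simp: H_def add.commute)
    ultimately show ?thesis
      using that by (auto simp: H_def homogeneous_add homogeneous_mult)
  qed
  have H_Cst: "H 0 (Cst c)" for c by (simp add: H_def)
  have H_Var: "H 1 (Var j)" for j using homogeneous_Var by (auto simp: H_def partial_deriv_Var)
  have H_power: "H k (Var j ^ k)" for j k
  proof (induction k)
    case 0 then show ?case using H_Cst[of 1] by simp
  next
    case (Suc k) then show ?case using H_mult[OF H_Var Suc] by simp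
  qed
  have H_prod: "H (\<Sum>j\<in>A. k j) (\<Prod>j\<in>A. Var j ^ k j)" if "finite A" for A k
    using that
  proof (induction A)
    case empty then show ?case using H_Cst[of 1] by simp
  next
    case (insert x F) then show ?case using H_mult[OF H_power insert.IH] by simp
  qed
  have "H (mdeg m) (Poly_Mapping.single m c)"
    using H_mult[OF H_Cst H_prod[of UNIV "Poly_Mapping.lookup m"], of c]
    by (simp add: single_conv_Var mdeg_def)
  then show ?thesis by (simp add: H_def)
qed

lemma partial_deriv_conv_sum: "partial_deriv i f = (\<Sum>m\<in>Poly_Mapping.keys f. partial_deriv i (Poly_Mapping.single m (Poly_Mapping.lookup f m)))"
  by (simp only: sum_monomials flip: partial_deriv_sum)

lemma homogeneous_partial_deriv: "homogeneous k f \<Longrightarrow> homogeneous (k - 1) (partial_deriv i f)"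
  unfolding partial_deriv_conv_sum[of i f]
proof (intro homogeneous_sum)
  fix m assume "homogeneous k f" "m \<in> Poly_Mapping.keys f"
  then have "mdeg m = k" by (simp add: homogeneous_iff_mdeg)
  then show "homogeneous (k - 1) (partial_deriv i (Poly_Mapping.single m (Poly_Mapping.lookup f m)))"
    using homogeneous_partial_deriv_aux by blast
qed

lemma homogeneous_imp_ordge: "homogeneous k f \<Longrightarrow> ordge k f"
  by (simp add: homogeneous_iff_mdeg ordge_def)

lemma ordge_partial_deriv:
  assumes "ordge r f" shows "ordge (r - 1) (partial_deriv i f)"
  unfolding partial_deriv_conv_sum[of i f]
proof (rule ordge_sum)
  fix m assume "m \<in> Poly_Mapping.keys f"
  then have "r \<le> mdeg m" using assms by (simp add: ordge_def)
  moreover have "ordge (mdeg m - 1) (partial_deriv i (Poly_Mapping.single m (Poly_Mapping.lookup f m)))"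
    by (rule homogeneous_imp_ordge) (rule homogeneous_partial_deriv_aux[THEN conjunct1])
  ultimately show "ordge (r - 1) (partial_deriv i (Poly_Mapping.single m (Poly_Mapping.lookup f m)))"
    by (elim ordge_mono) simp
qed

text \<open>Both sides differentiate \<open>f\<close> at \<open>T\<close> times the variables with
  respect to \<open>T\<close>, at \<open>T = 1\<close>. In this form, for arbitrary polynomials,
  Euler's formula can be proved by induction over sums and products.\<close>

lemma euler_grad: "(\<Sum>i\<in>UNIV. Var i * partial_deriv i f) = poly (pderiv (grad f)) 1"
proof (induction f rule: cpoly_induct)
  case (Cst c)
  then show ?case by (simp add: grad_def pderiv_pCons)
next
  case (Var i)
  have "(\<Sum>j\<in>UNIV. Var j * partial_deriv j (Var i)) = (\<Sum>j\<in>UNIV. if j = i then Var j else 0)"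
    by (intro sum.cong) (auto simp: partial_deriv_Var)
  then show ?case by (simp add: grad_def pderiv_monom poly_monom)
next
  case (add f g)
  then show ?case by (simp add: grad_add pderiv_add distrib_left sum.distrib)
next
  case (mult f g)
  have "(\<Sum>i\<in>UNIV. Var i * partial_deriv i (f * g)) = f * (\<Sum>i\<in>UNIV. Var i * partial_deriv i g) + g * (\<Sum>i\<in>UNIV. Var i * partial_deriv i f)"
    by (simp add: sum_distrib_left distrib_left sum.distrib mult_ac)
  then show ?case by (simp add: mult grad_mult pderiv_mult)
qed

lemma of_nat_Cst: "of_nat k = Cst (of_nat k)"
  by (induction k) (auto simp: Cst_add)

lemma euler: "homogeneous k f \<Longrightarrow> (\<Sum>i\<in>UNIV. Var i * partial_deriv i f) = Cst (of_nat k) * f"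
  unfolding euler_grad by (simp add: homogeneous_iff_grad pderiv_monom poly_monom of_nat_Cst)

text \<open>For a form this is the first polar with respect to \<open>v\<close>.\<close>

definition dir_deriv :: "complex ^ 'n::{finite,linorder} \<Rightarrow> 'n cpoly \<Rightarrow> 'n cpoly" where
  "dir_deriv v f = (\<Sum>i\<in>UNIV. Cst (v $ i) * partial_deriv i f)"

lemma dir_deriv_mult: "dir_deriv v (f * g) = f * dir_deriv v g + g * dir_deriv v f"
  by (simp add: dir_deriv_def sum_distrib_left distrib_left sum.distrib mult.left_commute)

lemma homogeneous_dir_deriv: "homogeneous k f \<Longrightarrow> homogeneous (k - 1) (dir_deriv v f)"
  unfolding dir_deriv_def by (intro homogeneous_sum homogeneous_Cst_mult homogeneous_partial_deriv)

lemma partial_deriv_conv_dir_deriv: "partial_deriv i f = dir_deriv (axis i 1) f"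
proof -
  have "dir_deriv (axis i 1) f = (\<Sum>j\<in>UNIV. if j = i then partial_deriv j f else 0)"
    unfolding dir_deriv_def by (intro sum.cong) (auto simp: axis_def)
  then show ?thesis by simp
qed

lemma ex_dir_deriv_nonzero:
  assumes "homogeneous k f" "0 < k" "f \<noteq> 0"
  obtains v where "dir_deriv v f \<noteq> 0"
proof -
  have "Cst (of_nat k) * f \<noteq> 0" using assms by simp
  then have "(\<Sum>i\<in>UNIV. Var i * partial_deriv i f) \<noteq> 0" using euler[OF assms(1)] by simp
  then obtain i where "partial_deriv i f \<noteq> 0" by (metis (no_types, lifting) mult_zero_right sum.neutral)
  then show ?thesis using that by (simp add: partial_deriv_conv_dir_deriv)
qed

text \<open>The expansion at \<open>v\<close>: \<open>ordge r (translate v f)\<close> says that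
  \<open>f\<close> has multiplicity at least \<open>r\<close> at \<open>v\<close>.\<close>

definition translate :: "complex ^ 'n::{finite,linorder} \<Rightarrow> 'n cpoly \<Rightarrow> 'n cpoly" where
  "translate v = subst (\<lambda>i. Cst (v $ i) + Var i)"

lemma translate_0 [simp]: "translate v 0 = 0"
  and translate_1 [simp]: "translate v 1 = 1"
  and translate_Cst [simp]: "translate v (Cst c) = Cst c"
  and translate_Var [simp]: "translate v (Var i) = Cst (v $ i) + Var i"
  and translate_add [simp]: "translate v (f + g) = translate v f + translate v g"
  and translate_mult [simp]: "translate v (f * g) = translate v f * translate v g"
  and translate_power [simp]: "translate v (f ^ k) = translate v f ^ k"
  and translate_sum [simp]: "translate v (sum F A) = (\<Sum>a\<in>A. translate v (F a))"
  and translate_prod [simp]: "translate v (prod F A) = (\<Prod>a\<in>A. translate v (F a))"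
  by (simp_all add: translate_def)

lemma poly_eval_translate [simp]: "poly_eval (translate v f) w = poly_eval f (v + w)"
  by (simp add: translate_def plus_vec_def)

lemma translate_translate [simp]: "translate v (translate w f) = translate (v + w) f"
  by (induction f rule: cpoly_induct) (simp_all add: Cst_add algebra_simps)

lemma translate_0_left [simp]: "translate 0 f = f"
  by (induction f rule: cpoly_induct) simp_all

lemma translate_eq_0_iff [simp]: "translate v f = 0 \<longleftrightarrow> f = 0"
  using translate_translate[of "- v" v f] by (auto simp del: translate_translate)

lemma partial_deriv_translate: "partial_deriv i (translate v f) = translate v (partial_deriv i f)"
  by (induction f rule: cpoly_induct) (simp_all add: partial_deriv_Var)

lemma ordge_translate_dir_deriv: "ordge r (translate p f) \<Longrightarrow> ordge (r - 1) (translate p (dir_deriv v f))"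
  unfolding dir_deriv_def by (auto intro!: ordge_sum ordge_mult_left simp: ordge_partial_deriv[simplified] simp flip: partial_deriv_translate)

text \<open>
  Euler's formula at \<open>p + X\<close> shows that the polar with respect to \<open>p\<close> itself loses no order at \<open>p\<close>.
\<close>

lemma ordge_translate_dir_deriv_same:
  assumes "homogeneous k f" "ordge r (translate p f)"
  shows "ordge r (translate p (dir_deriv p f))"
proof (cases r)
  case (Suc s)
  have "translate p (dir_deriv p f) + (\<Sum>i\<in>UNIV. Var i * partial_deriv i (translate p f)) = translate p (\<Sum>i\<in>UNIV. Var i * partial_deriv i f)"
    by (simp add: dir_deriv_def partial_deriv_translate distrib_right flip: sum.distrib)
  then have "translate p (dir_deriv p f) = Cst (of_nat k) * translate p f + - (\<Sum>i\<in>UNIV. Var i * partial_deriv i (translate p f))"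
    by (simp add: euler[OF assms(1)] eq_diff_eq del: of_nat_eq_0_iff)
  moreover have "ordge (1 + s) (\<Sum>i\<in>UNIV. Var i * partial_deriv i (translate p f))"
    using ordge_partial_deriv[OF assms(2)] Suc by (intro ordge_sum ordge_mult ordge_Var) simp
  then have "ordge r (\<Sum>i\<in>UNIV. Var i * partial_deriv i (translate p f))" using Suc by simp
  ultimately show ?thesis
    using assms(2) by (auto intro!: ordge_diff ordge_mult_left)
qed simp

definition line_poly ::
    "complex ^ 'n::{finite,linorder} \<Rightarrow> complex ^ 'n::{finite,linorder} \<Rightarrow> 'n::{finite,linorder} cpoly \<Rightarrow> complex poly" where
  "line_poly x p = peval (\<lambda>c. [:c:]) (\<lambda>i. [:x $ i, p $ i:])"

lemma poly_line_poly: "poly (line_poly x p f) c = poly_eval f (x + c *s p)"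
  by (induction f rule: cpoly_induct) (simp_all add: line_poly_def mult.commute)

lemma pderiv_line_poly: "pderiv (line_poly x p f) = line_poly x p (dir_deriv p f)"
proof (induction f rule: cpoly_induct)
  case (Var i)
  have "dir_deriv p (Var i) = (\<Sum>j\<in>UNIV. if j = i then Cst (p $ j) else 0)"
    unfolding dir_deriv_def by (intro sum.cong) (auto simp: partial_deriv_Var)
  then show ?case by (simp add: line_poly_def pderiv_pCons)
next
  case (mult f g)
  have "line_poly x p (g * h) = line_poly x p g * line_poly x p h"
    "line_poly x p (g + h) = line_poly x p g + line_poly x p h" for g h
    by (simp_all add: line_poly_def)
  then show ?case using mult by (simp add: dir_deriv_mult pderiv_mult)
qed (simp_all add: line_poly_def dir_deriv_def pderiv_pCons pderiv_add distrib_left sum.distrib)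

text \<open>The restriction of \<open>f\<close> to a line in direction \<open>p\<close> has
  derivative 0, hence is constant: for a form, the surface is a cone with vertex
  \<open>p\<close>.\<close>

lemma poly_eval_shift_if_dir_deriv_eq_0:
  assumes "dir_deriv p f = 0"
  shows "poly_eval f (x + c *s p) = poly_eval f x"
proof -
  have "pderiv (line_poly x p f) = 0" using assms by (simp add: pderiv_line_poly) (simp add: line_poly_def)
  then obtain k where "line_poly x p f = [:k:]" by (metis degree_eq_zeroE pderiv_eq_0_iff)
  then show ?thesis using poly_line_poly[of x p f c] poly_line_poly[of x p f 0] by simp
qed

section \<open>Unique factorization\<close>

text \<open>Factoriality is inherited from the library's instance for iterated univariate polynomials.\<close>

type_synonym P4 = "complex poly poly poly poly"

definition nest_var :: "4 \<Rightarrow> P4" where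
  "nest_var i = (if i = 1 then [:0, 1:] else if i = 2 then [:[:0, 1:]:]
      else if i = 3 then [:[:[:0, 1:]:]:] else [:[:[:[:0, 1:]:]:]:])"

interpretation coeff_hom_P4: coeff_hom "\<lambda>c. [:[:[:[:c:]:]:]:]"
  by unfold_locales (auto simp: one_pCons)

definition nest :: "4 cpoly \<Rightarrow> P4" where
  "nest = peval (\<lambda>c. [:[:[:[:c:]:]:]:]) nest_var"

lemma nest_simps [simp]: "nest 0 = 0" "nest 1 = 1" "nest (f + g) = nest f + nest g"
  "nest (f * g) = nest f * nest g" "nest (Cst c) = [:[:[:[:c:]:]:]:]" "nest (Var i) = nest_var i"
  "nest (f - g) = nest f - nest g"
  by (simp_all add: nest_def)

lemma poly_nest:
  "poly (poly (poly (poly (nest f) [:[:[:v $ 1:]:]:]) [:[:v $ 2:]:]) [:v $ 3:]) (v $ 4) = poly_eval f v"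
proof (induction f rule: cpoly_induct)
  case (Var i)
  show ?case using exhaust_4[of i] by (auto simp: nest_var_def)
qed simp_all

lemma poly_eq_0_if_infinite_roots:
  fixes p :: "'a::idom poly"
  assumes "inj k" "infinite (UNIV :: 'b set)" "\<And>c :: 'b. poly p (k c) = 0"
  shows "p = 0"
proof (rule ccontr)
  assume "p \<noteq> 0"
  then have "finite (range k)" using assms(3) by (intro finite_subset[OF _ poly_roots_finite]) auto
  then show False using assms(1,2) finite_imageD by blast
qed

lemma monom4: "monom (monom (monom (monom c i) j) k) l =
    [:[:[:[:c:]:]:]:] * [:[:[:monom 1 i:]:]:] * [:[:monom 1 j:]:] * [:monom 1 k:] * monom (1 :: complex poly poly poly) l"
  by (simp add: smult_monom)

lemma nest_inject: "nest f = nest g \<longleftrightarrow> f = g"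
  and cpoly_identity: "(\<And>v. poly_eval f v = 0) \<Longrightarrow> f = 0"
proof -
  have inf: "infinite (UNIV :: complex set)" by (rule infinite_UNIV_char_0)
  \<comment> \<open>The layer evaluated last is removed first; the complex constants embedded in
    each coefficient ring supply infinitely many roots.\<close>
  have id: "nest f = 0" if "\<And>v. poly_eval f v = 0" for f
  proof -
    have "poly (poly (poly (poly (nest f) [:[:[:a:]:]:]) [:[:b:]:]) [:c:]) d = 0" for a b c d
      using poly_nest[of f "\<chi> i. if i = 1 then a else if i = 2 then b else if i = 3 then c else d"] that by simp
    then have "poly (poly (poly (nest f) [:[:[:a:]:]:]) [:[:b:]:]) [:c:] = 0" for a b c
      by (intro poly_eq_0_if_infinite_roots[where k = "\<lambda>x. x"]) (auto simp: inf inj_def)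
    then have "poly (poly (nest f) [:[:[:a:]:]:]) [:[:b:]:] = 0" for a b
      by (intro poly_eq_0_if_infinite_roots[where k = "\<lambda>x. [:x:]"]) (auto simp: inf inj_def)
    then have "poly (nest f) [:[:[:a:]:]:] = 0" for a
      by (intro poly_eq_0_if_infinite_roots[where k = "\<lambda>x. [:[:x:]:]"]) (auto simp: inf inj_def)
    then show ?thesis
      by (intro poly_eq_0_if_infinite_roots[where k = "\<lambda>x. [:[:[:x:]:]:]"]) (auto simp: inf inj_def)
  qed
  \<comment> \<open>The iterated coefficients of \<open>nest f\<close> are the coefficients of
    \<open>f\<close>, which gives injectivity.\<close>
  have lk: "coeff (coeff (coeff (coeff (nest f) (Poly_Mapping.lookup m 1)) (Poly_Mapping.lookup m 2))
        (Poly_Mapping.lookup m 3)) (Poly_Mapping.lookup m 4) = Poly_Mapping.lookup f m" for f m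
  proof -
    have s: "nest (Poly_Mapping.single n c) = monom (monom (monom (monom c (Poly_Mapping.lookup n 4))
       (Poly_Mapping.lookup n 3)) (Poly_Mapping.lookup n 2)) (Poly_Mapping.lookup n 1)" for n c
    proof -
      have e: "(\<Prod>i\<in>UNIV. nest_var i ^ Poly_Mapping.lookup n i) =
         nest_var 1 ^ Poly_Mapping.lookup n 1 * nest_var 2 ^ Poly_Mapping.lookup n 2 *
         nest_var 3 ^ Poly_Mapping.lookup n 3 * nest_var 4 ^ Poly_Mapping.lookup n 4"
        unfolding UNIV_4 by (simp add: ac_simps)
      have v: "nest_var 1 ^ k = monom 1 k" "nest_var 2 ^ k = [:monom 1 k:]"
        "nest_var 3 ^ k = [:[:monom 1 k:]:]" "nest_var 4 ^ k = [:[:[:monom 1 k:]:]:]" for k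
        by (simp_all add: nest_var_def poly_const_pow monom_altdef)
      show ?thesis
        unfolding nest_def coeff_hom_P4.peval_single e v monom4
        by (simp only: mult_ac)
    qed
    have mm: "Poly_Mapping.lookup n 1 = Poly_Mapping.lookup m 1 \<and> Poly_Mapping.lookup n 2 = Poly_Mapping.lookup m 2 \<and>
      Poly_Mapping.lookup n 3 = Poly_Mapping.lookup m 3 \<and> Poly_Mapping.lookup n 4 = Poly_Mapping.lookup m 4 \<longleftrightarrow> n = m" for n
      by (auto simp: poly_mapping_eq_iff fun_eq_iff forall_4)
    have "nest f = (\<Sum>n\<in>Poly_Mapping.keys f. nest (Poly_Mapping.single n (Poly_Mapping.lookup f n)))"
      unfolding nest_def coeff_hom_P4.peval_sum[symmetric] sum_monomials ..
    also have "coeff (coeff (coeff (coeff \<dots> (Poly_Mapping.lookup m 1)) (Poly_Mapping.lookup m 2))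
        (Poly_Mapping.lookup m 3)) (Poly_Mapping.lookup m 4) =
        (\<Sum>n\<in>Poly_Mapping.keys f. if n = m then Poly_Mapping.lookup f n else 0)"
      unfolding coeff_sum
      by (intro sum.cong refl) (subst mm[symmetric], auto simp: s)
    finally show ?thesis by (auto simp: in_keys_iff)
  qed
  have z: "f = 0" if "nest f = 0" for f
    by (intro poly_mapping_eqI) (simp add: lk[symmetric] that)
  show "nest f = nest g \<longleftrightarrow> f = g" using z[of "f - g"] by auto
  show "(\<And>v. poly_eval f v = 0) \<Longrightarrow> f = 0" using id z by blast
qed

lemma nest_surj: "\<exists>f. nest f = p"
proof -
  \<comment> \<open>\<open>e\<close> places one layer of polynomials into \<open>P4\<close> as
    constants of the outer layers. As its variable is in the image of \<open>nest\<close>, the claim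
    reduces to the coefficients, one layer further in.\<close>
  have step: "\<exists>f. nest f = e p"
    if const: "\<And>a. \<exists>f. nest f = e [:a:]" and hom: "\<And>p q. e (p + q) = e p + e q" "\<And>p q. e (p * q) = e p * e q"
      "e [:0, 1:] = nest_var i"
    for e :: "'a::comm_ring_1 poly \<Rightarrow> P4" and p i
  proof (induction p)
    case 0
    show ?case using const[of 0] by simp
  next
    case (pCons a p)
    then obtain f where f: "nest f = e p" by blast
    obtain g where g: "nest g = e [:a:]" using const by blast
    have "pCons a p = [:a:] + [:0, 1:] * p" by simp
    then have "e (pCons a p) = nest (g + Var i * f)" by (simp only: hom f g nest_simps)
    then show ?case by metis
  qed
  have 1: "\<exists>f. nest f = [:[:[:p:]:]:]" for p :: "complex poly"
    by (rule step[of "\<lambda>p. [:[:[:p:]:]:]" 4]) (auto simp: nest_var_def intro: nest_simps(5))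
  have 2: "\<exists>f. nest f = [:[:p:]:]" for p :: "complex poly poly"
    by (rule step[of "\<lambda>p. [:[:p:]:]" 3]) (auto simp: nest_var_def 1)
  have 3: "\<exists>f. nest f = [:p:]" for p :: "complex poly poly poly"
    by (rule step[of "\<lambda>p. [:p:]" 2]) (auto simp: nest_var_def 2)
  show ?thesis
    by (rule step[of "\<lambda>p. p" 1]) (auto simp: nest_var_def 3)
qed

lemma nest_dvd_iff: "nest f dvd nest g \<longleftrightarrow> f dvd g"
proof
  assume "nest f dvd nest g"
  then obtain k where k: "nest g = nest f * k" by (auto simp: dvd_def)
  obtain h where "nest h = k" using nest_surj by blast
  then have "nest g = nest (f * h)" using k by simp
  then show "f dvd g" using nest_inject by (metis dvdI)
next
  assume "f dvd g"
  then show "nest f dvd nest g" by (auto simp: dvd_def)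
qed

lemma nest_eq_0_iff [simp]: "nest f = 0 \<longleftrightarrow> f = 0"
  using nest_inject[of f 0] by simp

lemma prime_elem_nest: "prime_elem (nest f) \<longleftrightarrow> prime_elem f"
proof -
  have "(\<forall>a b. nest f dvd a * b \<longrightarrow> nest f dvd a \<or> nest f dvd b) \<longleftrightarrow>
     (\<forall>a b. nest f dvd nest a * nest b \<longrightarrow> nest f dvd nest a \<or> nest f dvd nest b)"
    using nest_surj by metis
  then show ?thesis
    unfolding prime_elem_def using nest_dvd_iff[of f 1]
    by (simp add: nest_dvd_iff flip: nest_simps(4))
qed

text \<open>Without a common prime divisor the gcd of the images in \<open>P4\<close> is a unit; the
  divisibility found there transfers back through \<open>nest\<close>.\<close>

lemma cpoly_coprime_dvd_mult:
  fixes f :: "4 cpoly"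
  assumes "f \<noteq> 0" "\<And>p. prime_elem p \<Longrightarrow> p dvd f \<Longrightarrow> p dvd g \<Longrightarrow> False" "f dvd h * g"
  shows "f dvd h"
proof -
  have "is_unit (gcd (nest f) (nest g))"
  proof (rule ccontr)
    assume "\<not> ?thesis"
    then obtain q where q: "q dvd gcd (nest f) (nest g)" "prime q"
      using prime_divisor_exists[of "gcd (nest f) (nest g)"] assms(1) by auto
    obtain p where "nest p = q" using nest_surj by blast
    then show False using q assms(2)[of p] by (auto simp: prime_elem_nest nest_dvd_iff prime_def)
  qed
  then have "coprime (nest f) (nest g)" by (simp add: is_unit_gcd_iff coprime_iff_gcd_eq_1)
  then have "nest f dvd nest h"
    using assms(3) nest_dvd_iff[of f "h * g"] by (simp add: coprime_dvd_mult_left_iff)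
  then show ?thesis by (simp add: nest_dvd_iff)
qed

section \<open>Dimension counts\<close>

text \<open>
  The library proves rank-nullity and the dimension formula for sums only when the whole type is
  finite-dimensional, which polynomial rings are not.
\<close>

locale vspace = vector_space scale for scale :: "'a::field \<Rightarrow> 'b::ab_group_add \<Rightarrow> 'b"
begin

text \<open>An infinite basis has cardinality 0 and so makes \<open>dim\<close> equal to 0; this
  condition guards the dimension counts against that default.\<close>

definition fin_spanned :: "'b set \<Rightarrow> bool" where
  "fin_spanned V \<longleftrightarrow> (\<exists>B. finite B \<and> V \<subseteq> local.span B)"

lemma fin_spanned_subset: "fin_spanned W \<Longrightarrow> V \<subseteq> W \<Longrightarrow> fin_spanned V"
  by (auto simp: fin_spanned_def)

lemma finite_if_independent_subset:
  assumes "fin_spanned V" "local.independent B" "B \<subseteq> V" shows "finite B"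
  using assms independent_span_bound by (meson fin_spanned_def order_trans)

lemma dim_mono_fin:
  assumes "V \<subseteq> W" "fin_spanned W" shows "local.dim V \<le> local.dim W"
proof -
  obtain C where C: "C \<subseteq> V" "local.independent C" "V \<subseteq> local.span C" "card C = local.dim V" by (rule basis_exists)
  obtain D where D: "D \<subseteq> W" "local.independent D" "W \<subseteq> local.span D" "card D = local.dim W" by (rule basis_exists)
  have "finite D" using finite_if_independent_subset[OF assms(2) D(2,1)] .
  moreover have "C \<subseteq> local.span D" using C(1) assms(1) D(3) by blast
  ultimately have "card C \<le> card D" using independent_span_bound[OF _ C(2)] by blast
  then show ?thesis using C(4) D(4) by simp
qed

lemma span_inter_disjoint:
  assumes "local.independent B" "A \<subseteq> B" "C \<subseteq> B" "A \<inter> C = {}" "x \<in> local.span A" "x \<in> local.span C"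
  shows "x = 0"
proof -
  have A: "local.representation B x = local.representation A x"
    using assms by (intro representation_extend) auto
  have C: "local.representation B x = local.representation C x"
    using assms by (intro representation_extend) auto
  have "local.representation B x b = 0" for b
    using representation_ne_zero[of A x b] representation_ne_zero[of C x b] A C assms(4) by auto
  moreover have "x \<in> local.span B" using assms span_mono by blast
  ultimately show ?thesis using sum_nonzero_representation_eq[OF assms(1), of x] by simp
qed

end

locale vspace_pair = vs1: vspace s1 + vs2: vspace s2
  for s1 :: "'a::field \<Rightarrow> 'b::ab_group_add \<Rightarrow> 'b"
  and s2 :: "'a::field \<Rightarrow> 'c::ab_group_add \<Rightarrow> 'c"
begin

sublocale vector_space_pair s1 s2 ..

lemma rank_nullity:
  assumes f: "Vector_Spaces.linear s1 s2 f" and V: "vs1.subspace V" "vs1.fin_spanned V"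
  shows "vs1.dim V = vs1.dim {x\<in>V. f x = 0} + vs2.dim (f ` V)"
proof -
  interpret lf: Vector_Spaces.linear s1 s2 f by fact
  let ?K = "{x\<in>V. f x = 0}"
  obtain A where A: "A \<subseteq> ?K" "vs1.independent A" "?K \<subseteq> vs1.span A" "card A = vs1.dim ?K"
    by (rule vs1.basis_exists)
  then obtain B where B: "A \<subseteq> B" "B \<subseteq> V" "vs1.independent B" "V \<subseteq> vs1.span B"
    using vs1.maximal_independent_subset_extend[of A V] by blast
  have finB: "finite B" using vs1.finite_if_independent_subset[OF V(2) B(3,2)] .
  define C where "C = B - A"
  have indC: "vs1.independent C" using B(3) vs1.independent_mono C_def by blast
  have spanC: "vs1.span C \<subseteq> V" using B(2) V(1) C_def by (intro vs1.span_minimal) auto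
  have inj: "inj_on f (vs1.span C)"
  proof (rule inj_onI)
    fix x y assume xy: "x \<in> vs1.span C" "y \<in> vs1.span C" "f x = f y"
    then have d: "x - y \<in> vs1.span C" by (intro vs1.span_diff)
    then have "x - y \<in> ?K" using xy spanC by (auto simp: lf.diff)
    then have "x - y \<in> vs1.span A" using A(3) by blast
    then have "x - y = 0"
      using d by (intro vs1.span_inter_disjoint[OF B(3), of A C]) (auto simp: C_def B)
    then show "x = y" by simp
  qed
  have ind: "vs2.independent (f ` C)"
    using indC inj by (rule lf.independent_injective_image)
  have "f ` V \<subseteq> vs2.span (f ` C)"
  proof
    fix y assume "y \<in> f ` V"
    then have "y \<in> f ` vs1.span B" using B(4) by blast
    then have "y \<in> vs2.span (f ` B)" by (simp add: lf.span_image)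
    moreover have "f ` B \<subseteq> insert 0 (f ` C)" using A(1) by (auto simp: C_def)
    ultimately have "y \<in> vs2.span (insert 0 (f ` C))" using vs2.span_mono by blast
    then show "y \<in> vs2.span (f ` C)" by simp
  qed
  moreover have "f ` C \<subseteq> f ` V" using B(2) by (auto simp: C_def)
  ultimately have "vs2.dim (f ` V) = card (f ` C)"
    using ind vs2.basis_card_eq_dim by metis
  also have "\<dots> = card C"
    using inj by (intro card_image) (meson inj_on_subset vs1.span_superset)
  finally have "vs2.dim (f ` V) = card B - card A"
    using finB B(1) by (simp add: C_def card_Diff_subset finite_subset)
  moreover have "card A \<le> card B" using finB B(1) card_mono by blast
  moreover have "vs1.dim V = card B" using B(2-4) vs1.basis_card_eq_dim by metis
  ultimately show ?thesis using A(4) by simp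
qed

lemma fin_spanned_image:
  assumes f: "Vector_Spaces.linear s1 s2 f" and "vs1.fin_spanned V"
  shows "vs2.fin_spanned (f ` V)"
proof -
  interpret lf: Vector_Spaces.linear s1 s2 f by fact
  obtain B where "finite B" "V \<subseteq> vs1.span B" using assms by (auto simp: vs1.fin_spanned_def)
  then show ?thesis
    unfolding vs2.fin_spanned_def by (intro exI[of _ "f ` B"]) (auto simp: lf.span_image)
qed

lemma dim_image_inj:
  assumes f: "Vector_Spaces.linear s1 s2 f" and V: "vs1.subspace V" "vs1.fin_spanned V"
    and inj: "\<And>x. x \<in> V \<Longrightarrow> f x = 0 \<Longrightarrow> x = 0"
  shows "vs2.dim (f ` V) = vs1.dim V"
proof -
  have "{x\<in>V. f x = 0} \<subseteq> {0}" using inj by auto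
  then have "vs1.dim {x\<in>V. f x = 0} \<le> card ({} :: 'b set)"
    by (intro vs1.dim_le_card) auto
  then show ?thesis using rank_nullity[OF f V] by simp
qed

end

context vspace
begin

text \<open>\<open>g\<close> is a projection of the whole space with kernel \<open>U\<close>. It has
  the same image on the sum as on \<open>W\<close>, with kernels \<open>U\<close> and
  \<open>U \<inter> W\<close>; rank-nullity for both gives the formula.\<close>

lemma dim_sum_inter:
  assumes U: "local.subspace U" "fin_spanned U" and W: "local.subspace W" "fin_spanned W"
  shows "local.dim {x + y | x y. x \<in> U \<and> y \<in> W} + local.dim (U \<inter> W) = local.dim U + local.dim W"
proof -
  interpret p: vspace_pair scale scale ..
  let ?S = "{x + y | x y. x \<in> U \<and> y \<in> W}"
  obtain B where B: "B \<subseteq> U" "local.independent B" "U \<subseteq> local.span B" using maximal_independent_subset by blast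
  then have sB: "local.span B = U" using U(1) span_minimal by blast
  obtain D where D: "B \<subseteq> D" "D \<subseteq> UNIV" "local.independent D" "UNIV \<subseteq> local.span D"
    using maximal_independent_subset_extend[of B UNIV] B by auto
  obtain g where g: "Vector_Spaces.linear scale scale g" "\<forall>x\<in>D. g x = (if x \<in> B then 0 else x)"
    using p.linear_independent_extend[OF D(3), of "\<lambda>x. if x \<in> B then 0 else x"] by blast
  interpret lg: Vector_Spaces.linear scale scale g by fact
  have gB: "g x = 0" if "x \<in> local.span B" for x
    by (rule lg.eq_0_on_span[OF _ that]) (use g(2) D(1) in auto)
  have ker: "g x = 0 \<longleftrightarrow> x \<in> U" for x
  proof
    assume "x \<in> U"
    then show "g x = 0" using sB gB by simp
  next
    assume gx: "g x = 0"
    have "x \<in> local.span (B \<union> (D - B))" using D(1,4) by (simp add: Un_absorb1 subset_iff)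
    then obtain u v where uv: "x = u + v" "u \<in> local.span B" "v \<in> local.span (D - B)"
      unfolding span_Un by blast
    have gu: "g u = 0" using uv(2) gB by simp
    have "g v = v"
      using uv(3) p.linear_eq_on_span[OF g(1) linear_id, of "D - B" v] g(2) by auto
    then have "v = 0" using gx gu uv(1) by (simp add: lg.add)
    then show "x \<in> U" using uv sB by simp
  qed
  have fs: "fin_spanned ?S"
  proof -
    obtain B1 B2 where "finite B1" "U \<subseteq> local.span B1" "finite B2" "W \<subseteq> local.span B2"
      using U W by (auto simp: fin_spanned_def)
    then show ?thesis
      unfolding fin_spanned_def by (intro exI[of _ "B1 \<union> B2"]) (auto simp: span_Un)
  qed
  have ss: "local.subspace ?S" by (intro subspace_sums U W)
  have "0 \<in> U" "0 \<in> W" using U W subspace_0 by auto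
  then have k1: "{x\<in>?S. g x = 0} = U"
    by (force simp: ker intro: exI[of _ "0::'b"])
  have "g (x + y) = g y" if "x \<in> U" for x y using that ker by (simp add: lg.add)
  then have im: "g ` ?S = g ` W" using \<open>0 \<in> U\<close> by force
  have "{x\<in>W. g x = 0} = U \<inter> W" by (auto simp: ker)
  then show ?thesis
    using p.rank_nullity[OF g(1) ss fs] p.rank_nullity[OF g(1) W] k1 im by simp
qed

end

interpretation cpoly: vspace "\<lambda>c (f :: 'n::{finite,linorder} cpoly). Cst c * f" ..

interpretation cpoly2: vspace_pair "\<lambda>c (f :: 'n::{finite,linorder} cpoly). Cst c * f"
  "\<lambda>c (f :: 'm::{finite,linorder} cpoly). Cst c * f" ..

lemma cpoly_linearI:
  assumes "\<And>x y. f (x + y) = f x + f y" "\<And>c x. f (Cst c * x) = Cst c * f x"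
  shows "Vector_Spaces.linear (\<lambda>c x. Cst c * x) (\<lambda>c x. Cst c * x) f"
  unfolding Vector_Spaces.linear_iff
  by (intro conjI allI cpoly.vector_space_axioms assms)

section \<open>Spaces spanned by monomials and their dimensions\<close>

definition supp :: "('n \<Rightarrow>\<^sub>0 nat) set \<Rightarrow> 'n::{finite,linorder} cpoly set" where
  "supp M = {f. Poly_Mapping.keys f \<subseteq> M}"

lemma supp_0 [simp]: "0 \<in> supp M" by (simp add: supp_def)

lemma supp_add: "f \<in> supp M \<Longrightarrow> g \<in> supp M \<Longrightarrow> f + g \<in> supp M"
  using keys_add[of f g] by (auto simp: supp_def)

lemma supp_Cst_mult: "f \<in> supp M \<Longrightarrow> Cst c * f \<in> supp M"
  by (cases "c = 0") (auto simp: supp_def keys_Cst_mult)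

lemma subspace_supp: "cpoly.subspace (supp M)"
  by (auto simp: cpoly.subspace_def supp_add supp_Cst_mult)

lemma
  assumes "finite M"
  shows fin_spanned_supp: "cpoly.fin_spanned (supp M)" and dim_supp: "cpoly.dim (supp M) = card M"
proof -
  let ?b = "\<lambda>m. Poly_Mapping.single m (1::complex)"
  have inj: "inj_on ?b M"
    by (intro inj_onI) (metis keys_single one_neq_zero singleton_inject)
  have lk: "Poly_Mapping.lookup (\<Sum>m\<in>M. Cst (c m) * ?b m) n = (if n \<in> M then c n else 0)" for c n
    using assms by (simp add: lookup_sum lookup_single when_def if_distrib[of "(*) _"] cong: if_cong)
  have sp: "supp M \<subseteq> cpoly.span (?b ` M)"
  proof
    fix f assume f: "f \<in> supp M"
    have "f = (\<Sum>m\<in>M. Cst (Poly_Mapping.lookup f m) * ?b m)"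
      using f by (intro poly_mapping_eqI) (auto simp: lk supp_def in_keys_iff)
    also have "\<dots> \<in> cpoly.span (?b ` M)"
      by (intro cpoly.span_sum cpoly.span_scale cpoly.span_base) auto
    finally show "f \<in> cpoly.span (?b ` M)" .
  qed
  then show "cpoly.fin_spanned (supp M)" using assms by (auto simp: cpoly.fin_spanned_def)
  have "cpoly.independent (?b ` M)"
  proof (rule cpoly.independent_if_scalars_zero)
    fix c x assume *: "(\<Sum>x\<in>?b ` M. Cst (c x) * x) = 0" "x \<in> ?b ` M"
    then obtain n where n: "n \<in> M" "x = ?b n" by auto
    have "(\<Sum>m\<in>M. Cst (c (?b m)) * ?b m) = 0" using *(1) inj by (simp add: sum.reindex)
    then show "c x = 0" using lk[of "\<lambda>m. c (?b m)" n] n by simp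
  qed (use assms in auto)
  moreover have "?b ` M \<subseteq> supp M" by (auto simp: supp_def)
  ultimately have "cpoly.dim (supp M) = card (?b ` M)" using sp cpoly.basis_card_eq_dim by metis
  then show "cpoly.dim (supp M) = card M" using inj by (simp add: card_image)
qed

definition mons :: "nat \<Rightarrow> (4 \<Rightarrow>\<^sub>0 nat) set" where "mons k = {m. mdeg m = k}"

definition forms :: "nat \<Rightarrow> 4 cpoly set" where "forms k = supp (mons k)"

lemma mem_forms_iff: "f \<in> forms k \<longleftrightarrow> homogeneous k f"
  by (auto simp: forms_def supp_def mons_def homogeneous_iff_mdeg)

lemma mdeg_4: "mdeg (m :: 4 \<Rightarrow>\<^sub>0 nat) = Poly_Mapping.lookup m 1 + Poly_Mapping.lookup m 2 +
    Poly_Mapping.lookup m 3 + Poly_Mapping.lookup m 4"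
  by (simp add: mdeg_def sum_4)

lemma card_mons: "card (mons k) = (k + 3) choose 3" and finite_mons: "finite (mons k)"
proof -
  define g where "g m = [Poly_Mapping.lookup m 1, Poly_Mapping.lookup m 2,
    Poly_Mapping.lookup m 3, Poly_Mapping.lookup m (4::4)]" for m :: "4 \<Rightarrow>\<^sub>0 nat"
  have inj: "inj_on g (mons k)"
    by (auto simp: inj_on_def g_def poly_mapping_eq_iff fun_eq_iff forall_4)
  have "g ` mons k = {l. length l = 4 \<and> sum_list l = k}"
  proof (intro equalityI subsetI)
    fix l assume "l \<in> g ` mons k"
    then show "l \<in> {l. length l = 4 \<and> sum_list l = k}" by (auto simp: g_def mons_def mdeg_4)
  next
    fix l :: "nat list" assume "l \<in> {l. length l = 4 \<and> sum_list l = k}"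
    then obtain a b c d where l: "l = [a, b, c, d]" "a + b + c + d = k"
      by (auto simp: length_Suc_conv eval_nat_numeral)
    define m where "m = Poly_Mapping.single (1::4) a + Poly_Mapping.single 2 b
       + Poly_Mapping.single 3 c + Poly_Mapping.single 4 d"
    have "g m = l" by (simp add: g_def m_def l lookup_add lookup_single)
    moreover have "m \<in> mons k" by (simp add: mons_def m_def l)
    ultimately show "l \<in> g ` mons k" by blast
  qed
  then have im: "g ` mons k = {l. length l = 4 \<and> sum_list l = k}" .
  have c: "card {l::nat list. length l = 4 \<and> sum_list l = k} = (k + 3) choose 3"
    using card_length_sum_list[of 4 k] by (simp add: binomial_symmetric[of 3 "k + 3"] add.commute)
  then show "card (mons k) = (k + 3) choose 3" using inj im by (metis card_image)
  then have "card (mons k) \<noteq> 0" by simp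
  then show "finite (mons k)" using card.infinite by metis
qed

text \<open>Monomials of the affine chart in which the \<open>i\<close>-th coordinate is constant;
  those of degree below \<open>n\<close> span the jets modulo order \<open>n\<close>.\<close>

definition low_mons :: "4 \<Rightarrow> nat \<Rightarrow> (4 \<Rightarrow>\<^sub>0 nat) set" where
  "low_mons i n = {m. Poly_Mapping.lookup m i = 0 \<and> mdeg m < n}"

text \<open>For positive \<open>n\<close>, filling up with powers of the \<open>i\<close>-th
  variable turns these monomials into all monomials of degree \<open>n - 1\<close>.\<close>

lemma card_low_mons: "card (low_mons i n) = (n + 2) choose 3" and finite_low_mons: "finite (low_mons i n)"
proof -
  have "card (low_mons i n) = (n + 2) choose 3 \<and> finite (low_mons i n)"
  proof (cases n)
    case 0
    then have "low_mons i n = {}" by (simp add: low_mons_def)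
    with 0 show ?thesis by simp
  next
    case (Suc k)
    have "bij_betw (\<lambda>m. m + Poly_Mapping.single i (k - mdeg m)) (low_mons i n) (mons k)"
    proof (rule bij_betwI[where g = "\<lambda>m. m - Poly_Mapping.single i (Poly_Mapping.lookup m i)"])
      show "(\<lambda>m. m + Poly_Mapping.single i (k - mdeg m)) \<in> low_mons i n \<rightarrow> mons k"
        by (auto simp: low_mons_def mons_def Suc)
      have d: "(m - Poly_Mapping.single i (Poly_Mapping.lookup m i)) + Poly_Mapping.single i (Poly_Mapping.lookup m i) = m" for m
        by (intro poly_mapping_eqI) (auto simp: lookup_add lookup_minus lookup_single when_def)
      then have e: "mdeg (m - Poly_Mapping.single i (Poly_Mapping.lookup m i)) + Poly_Mapping.lookup m i = mdeg m" for m
        by (metis mdeg_add mdeg_single)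
      show "(\<lambda>m. m - Poly_Mapping.single i (Poly_Mapping.lookup m i)) \<in> mons k \<rightarrow> low_mons i n"
      proof
        fix m assume "m \<in> mons k"
        then show "m - Poly_Mapping.single i (Poly_Mapping.lookup m i) \<in> low_mons i n"
          using e[of m] by (auto simp: low_mons_def mons_def Suc lookup_minus)
      qed
      show "m + Poly_Mapping.single i (k - mdeg m) -
          Poly_Mapping.single i (Poly_Mapping.lookup (m + Poly_Mapping.single i (k - mdeg m)) i) = m"
        if "m \<in> low_mons i n" for m
        using that by (auto simp: low_mons_def lookup_add)
      show "m - Poly_Mapping.single i (Poly_Mapping.lookup m i) +
          Poly_Mapping.single i (k - mdeg (m - Poly_Mapping.single i (Poly_Mapping.lookup m i))) = m"
        if "m \<in> mons k" for m
      proof -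
        have "k - mdeg (m - Poly_Mapping.single i (Poly_Mapping.lookup m i)) = Poly_Mapping.lookup m i"
          using that e[of m] by (simp add: mons_def)
        then show ?thesis by (simp add: d)
      qed
    qed
    from bij_betw_same_card[OF this] bij_betw_finite[OF this] show ?thesis
      using card_mons[of k] finite_mons[of k] Suc by (simp add: eval_nat_numeral)
  qed
  then show "card (low_mons i n) = (n + 2) choose 3" "finite (low_mons i n)" by auto
qed

lemma dim_mult_image:
  assumes "cpoly.subspace V" "cpoly.fin_spanned V" "u \<noteq> 0"
  shows "cpoly.dim ((*) u ` V) = cpoly.dim V"
  using assms by (intro cpoly2.dim_image_inj cpoly_linearI) (auto simp: algebra_simps)

section \<open>Jets: truncation of polynomials below a given order\<close>

definition trunc :: "nat \<Rightarrow> 'n::{finite,linorder} cpoly \<Rightarrow> 'n cpoly" where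
  "trunc s f = (\<Sum>j<s. coeff (grad f) j)"

lemma lookup_trunc: "Poly_Mapping.lookup (trunc s f) m = (if mdeg m < s then Poly_Mapping.lookup f m else 0)"
  by (simp add: trunc_def lookup_sum lookup_coeff_grad if_distrib cong: if_cong)

lemma trunc_add: "trunc s (f + g) = trunc s f + trunc s g"
  by (intro poly_mapping_eqI) (simp add: lookup_trunc lookup_add)

lemma trunc_Cst_mult: "trunc s (Cst c * f) = Cst c * trunc s f"
  by (intro poly_mapping_eqI) (simp add: lookup_trunc)

lemma trunc_eq_0_iff: "trunc s f = 0 \<longleftrightarrow> ordge s f"
proof
  assume "trunc s f = 0"
  then have "Poly_Mapping.lookup f m = 0" if "mdeg m < s" for m
    using lookup_trunc[of s f m] that by simp
  then show "ordge s f" by (auto simp: ordge_def in_keys_iff not_less[symmetric])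
next
  assume "ordge s f"
  then show "trunc s f = 0"
    by (intro poly_mapping_eqI) (auto simp: lookup_trunc ordge_def in_keys_iff not_less[symmetric])
qed

lemma keys_trunc: "Poly_Mapping.keys (trunc s f) = {m\<in>Poly_Mapping.keys f. mdeg m < s}"
  by (auto simp: in_keys_iff lookup_trunc split: if_splits)

lemma ordge_minus_trunc: "ordge s (f - trunc s f)"
  by (auto simp: ordge_def in_keys_iff lookup_minus lookup_trunc split: if_splits)

text \<open>As \<open>u\<close> begins in order \<open>a\<close>, the terms of \<open>c\<close> of
  degree at least \<open>s - a\<close> affect the product only beyond the truncation.\<close>

lemma trunc_mult_trunc:
  assumes "ordge a u" "a \<le> s"
  shows "trunc s (u * trunc (s - a) c) = trunc s (u * c)"
proof -
  have "ordge s (u * (c - trunc (s - a) c))"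
    using ordge_mult[OF assms(1) ordge_minus_trunc[of "s - a" c]] assms(2) by simp
  then have "trunc s (u * (c - trunc (s - a) c)) = 0" by (simp add: trunc_eq_0_iff)
  moreover have "u * c = u * (c - trunc (s - a) c) + u * trunc (s - a) c" by (simp add: algebra_simps)
  ultimately show ?thesis by (simp only: trunc_add add_0)
qed

definition no_var :: "'n::{finite,linorder} \<Rightarrow> 'n cpoly \<Rightarrow> bool" where
  "no_var i f \<longleftrightarrow> (\<forall>m\<in>Poly_Mapping.keys f. Poly_Mapping.lookup m i = 0)"

lemma no_var_Cst: "no_var i (Cst c)" by (auto simp: no_var_def Cst_def split: if_splits)
lemma no_var_Var: "j \<noteq> i \<Longrightarrow> no_var i (Var j)" by (simp add: no_var_def Var_def lookup_single)
lemma no_var_add: "no_var i f \<Longrightarrow> no_var i g \<Longrightarrow> no_var i (f + g)"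
  using keys_add[of f g] by (auto simp: no_var_def)
lemma no_var_mult: "no_var i f \<Longrightarrow> no_var i g \<Longrightarrow> no_var i (f * g)"
  using keys_mult[of f g] by (force simp: no_var_def lookup_add)

lemma mem_low_iff: "c \<in> supp (low_mons i n) \<longleftrightarrow> no_var i c \<and> (\<forall>m\<in>Poly_Mapping.keys c. mdeg m < n)"
  by (auto simp: supp_def low_mons_def no_var_def)

lemma trunc_mem_low: "no_var i f \<Longrightarrow> trunc n f \<in> supp (low_mons i n)"
  by (auto simp: mem_low_iff keys_trunc no_var_def)

lemma vord_less_if_low: "c \<in> supp (low_mons i n) \<Longrightarrow> c \<noteq> 0 \<Longrightarrow> vord c < n"
proof (rule ccontr)
  assume c: "c \<in> supp (low_mons i n)" "c \<noteq> 0" "\<not> vord c < n"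
  then have "ordge n c" by (simp add: ordge_iff_vord)
  then have "Poly_Mapping.keys c = {}" using c by (fastforce simp: ordge_def mem_low_iff)
  then show False using c by simp
qed

text \<open>Multiplication by \<open>u\<close> raises the order by exactly \<open>vord u\<close>, so
  it is injective from chart polynomials of degree below \<open>s - vord u\<close> to jets below
  order \<open>s\<close>.\<close>

lemma
  assumes "u \<noteq> 0" "vord u \<le> s"
  shows dim_trunc_mult: "cpoly.dim ((\<lambda>c. trunc s (u * c)) ` supp (low_mons i (s - vord u))) = (s - vord u + 2) choose 3"
    and subspace_trunc_mult: "cpoly.subspace ((\<lambda>c. trunc s (u * c)) ` supp (low_mons i (s - vord u)))"
    and fin_spanned_trunc_mult: "cpoly.fin_spanned ((\<lambda>c. trunc s (u * c)) ` supp (low_mons i (s - vord u)))"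
proof -
  let ?L = "supp (low_mons i (s - vord u))"
  let ?f = "\<lambda>c. trunc s (u * c)"
  have lin: "Vector_Spaces.linear (\<lambda>c x. Cst c * x) (\<lambda>c x. Cst c * x) ?f"
    by (rule cpoly_linearI) (simp add: distrib_left trunc_add, simp only: mult.left_commute[of u] trunc_Cst_mult)
  have "c = 0" if "c \<in> ?L" "?f c = 0" for c
  proof (rule ccontr)
    assume "c \<noteq> 0"
    moreover from this have "vord c < s - vord u" using that(1) vord_less_if_low by blast
    ultimately have "\<not> ordge s (u * c)" using assms by (simp add: ordge_iff_vord vord_mult)
    then show False using that(2) by (simp add: trunc_eq_0_iff)
  qed
  then have "cpoly.dim (?f ` ?L) = cpoly.dim ?L"
    by (intro cpoly2.dim_image_inj lin subspace_supp fin_spanned_supp finite_low_mons) auto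
  then show "cpoly.dim (?f ` ?L) = (s - vord u + 2) choose 3"
    by (simp add: dim_supp finite_low_mons card_low_mons)
  show "cpoly.fin_spanned (?f ` ?L)"
    by (intro cpoly2.fin_spanned_image lin fin_spanned_supp finite_low_mons)
  interpret l: Vector_Spaces.linear "\<lambda>c x. Cst c * x" "\<lambda>c x. Cst c * x" ?f by (rule lin)
  show "cpoly.subspace (?f ` ?L)"
    by (intro l.subspace_image subspace_supp)
qed

text \<open>
  The expansion at \<open>p\<close> in the affine chart of projective space on which the \<open>i\<close>-th coordinate is
  constant. It is faithful on forms when \<open>p $ i\<close> is nonzero.
\<close>

definition slice :: "complex ^ 'n::{finite,linorder} \<Rightarrow> 'n \<Rightarrow> 'n cpoly \<Rightarrow> 'n cpoly" where
  "slice p i = subst (\<lambda>j. if j = i then Cst (p $ j) else Cst (p $ j) + Var j)"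

lemma slice_simps [simp]: "slice p i 0 = 0" "slice p i 1 = 1" "slice p i (f + g) = slice p i f + slice p i g"
  "slice p i (f * g) = slice p i f * slice p i g" "slice p i (Cst c) = Cst c"
  "slice p i (f ^ k) = slice p i f ^ k"
  by (simp_all add: slice_def)

lemma slice_Var: "slice p i (Var j) = (if j = i then Cst (p $ j) else Cst (p $ j) + Var j)"
  by (simp add: slice_def)

lemma no_var_slice: "no_var i (slice p i f)"
  by (induction f rule: cpoly_induct)
     (auto simp: slice_Var no_var_Cst intro: no_var_add no_var_mult no_var_Var no_var_Cst)

lemma slice_conv_translate: "slice p i f = subst (\<lambda>j. if j = i then 0 else Var j) (translate p f)"
  by (induction f rule: cpoly_induct) (simp_all add: slice_Var)

lemma ordge_slice: "ordge r (translate p f) \<Longrightarrow> ordge r (slice p i f)"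
  unfolding slice_conv_translate by (rule ordge_subst) (auto simp del: One_nat_def)

lemma poly_eval_slice_diff: "w $ i = p $ i \<Longrightarrow> poly_eval (slice p i f) (w - p) = poly_eval f w"
proof -
  assume *: "w $ i = p $ i"
  have "(\<chi> j. poly_eval (if j = i then Cst (p $ j) else Cst (p $ j) + Var j) (w - p)) = w"
    using * by (simp add: vec_eq_iff)
  then show ?thesis unfolding slice_def poly_eval_subst by simp
qed

lemma poly_eval_slice_0 [simp]: "poly_eval (slice p i f) 0 = poly_eval f p"
  using poly_eval_slice_diff[of p i p f] by simp

text \<open>Every vector with nonzero \<open>i\<close>-th coordinate can be rescaled into the chart,
  and the nonzero product \<open>f * Var i\<close> supplies such a vector at which \<open>f\<close>
  does not vanish.\<close>

lemma slice_nonzero: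
  fixes f :: "4 cpoly"
  assumes "homogeneous k f" "f \<noteq> 0" "p $ i \<noteq> 0"
  shows "slice p i f \<noteq> 0"
proof
  assume *: "slice p i f = 0"
  have "Var i \<noteq> (0 :: 4 cpoly)" by (metis poly_eval_0 poly_eval_Var one_index zero_neq_one)
  then have "f * Var i \<noteq> 0" using assms by simp
  then obtain v where v: "poly_eval f v \<noteq> 0" "v $ i \<noteq> 0"
    using cpoly_identity[of "f * Var i"] by auto
  define w where "w = (p $ i / v $ i) *s v"
  have "w $ i = p $ i" using v by (simp add: w_def)
  then have "poly_eval f w = 0" using poly_eval_slice_diff[of w i p f] * by simp
  moreover have "poly_eval f w \<noteq> 0"
    using v assms by (simp add: w_def poly_eval_homogeneous[OF assms(1)])
  ultimately show False by simp
qed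

lemma homogenize:
  assumes "c \<in> supp (low_mons i (Suc k))" "p $ i \<noteq> 0"
  obtains H where "homogeneous k H" "slice p i H = c"
proof -
  \<comment> \<open>\<open>slice\<close> sends \<open>l j\<close> to the local coordinate
    \<open>Var j\<close> for \<open>j \<noteq> i\<close>, and \<open>Var i\<close> divided by
    \<open>p $ i\<close> to 1. The former replace the variables of a monomial, the latter fills up
    its degree to \<open>k\<close>.\<close>
  define l where "l j = Var j - Cst (p $ j / p $ i) * Var i" for j
  define h where "h m = Poly_Mapping.single 0 (Poly_Mapping.lookup c m) * ((Cst (1 / p $ i) * Var i) ^ (k - mdeg m)
     * (\<Prod>j\<in>UNIV. l j ^ Poly_Mapping.lookup m j))" for m
  have hl: "homogeneous 1 (l j)" for j
    unfolding l_def diff_conv_add_uminus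
    by (intro homogeneous_add homogeneous_Var)
       (metis homogeneous_Cst_mult homogeneous_Var mult_minus_left coeff_hom_Cst.h_uminus)
  have sl: "slice p i (l j) = (if j = i then 0 else Var j)" for j
    using assms(2) by (auto simp: l_def slice_def Cst_mult[symmetric])
  have hh: "homogeneous k (h m)" if "m \<in> Poly_Mapping.keys c" for m
  proof -
    have "mdeg m \<le> k" using that assms(1) by (auto simp: mem_low_iff)
    have "homogeneous (1 * (k - mdeg m) + (\<Sum>j\<in>UNIV. 1 * Poly_Mapping.lookup m j))
      ((Cst (1 / p $ i) * Var i) ^ (k - mdeg m) * (\<Prod>j\<in>UNIV. l j ^ Poly_Mapping.lookup m j))"
      by (intro homogeneous_mult homogeneous_prod homogeneous_power homogeneous_Cst_mult homogeneous_Var hl)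
    then show ?thesis using \<open>mdeg m \<le> k\<close>
      unfolding h_def Cst_def[symmetric] by (intro homogeneous_Cst_mult) (simp add: mdeg_def)
  qed
  have sh: "slice p i (h m) = Poly_Mapping.single m (Poly_Mapping.lookup c m)" if "m \<in> Poly_Mapping.keys c" for m
  proof -
    have z: "Poly_Mapping.lookup m i = 0" using that assms(1) by (auto simp: mem_low_iff no_var_def)
    have "slice p i (\<Prod>j\<in>UNIV. l j ^ Poly_Mapping.lookup m j) = (\<Prod>j\<in>UNIV. slice p i (l j) ^ Poly_Mapping.lookup m j)"
      by (simp add: slice_def)
    also have "\<dots> = (\<Prod>j\<in>UNIV. Var j ^ Poly_Mapping.lookup m j)"
      using z by (intro prod.cong) (auto simp: sl)
    moreover have "slice p i (Cst (1 / p $ i) * Var i) = 1"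
      using assms(2) by (simp add: slice_Var flip: Cst_mult)
    ultimately show ?thesis
      unfolding h_def Cst_def[symmetric] single_conv_Var[of m] by simp
  qed
  have "homogeneous k (\<Sum>m\<in>Poly_Mapping.keys c. h m)" by (intro homogeneous_sum hh)
  moreover have "slice p i (\<Sum>m\<in>Poly_Mapping.keys c. h m) = (\<Sum>m\<in>Poly_Mapping.keys c. slice p i (h m))"
    by (simp add: slice_def)
  then have "slice p i (\<Sum>m\<in>Poly_Mapping.keys c. h m) = c"
    using sh by (simp add: sum_monomials)
  ultimately show ?thesis using that by blast
qed

section \<open>A Bezout inequality with multiplicities\<close>

lemma six_choose_three: "6 * int ((n + 2) choose 3) = int n * (int n + 1) * (int n + 2)"
proof (induction n)
  case (Suc n)
  have two: "2 * int ((m + 1) choose 2) = (int m + 1) * int m" for m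
    by (induction m) (auto simp: numeral_2_eq_2 algebra_simps)
  have "int ((Suc n + 2) choose 3) = int ((n + 2) choose 2) + int ((n + 2) choose 3)"
    by (simp add: numeral_3_eq_3 numeral_2_eq_2)
  then show ?case using Suc two[of "n + 1"] by (simp add: algebra_simps)
qed simp

lemma linear_trunc_slice:
  "Vector_Spaces.linear (\<lambda>c x. Cst c * x) (\<lambda>c x. Cst c * x) (\<lambda>f. trunc s (slice p i f))"
  by (rule cpoly_linearI) (simp_all add: trunc_add trunc_Cst_mult)

lemma dim_forms: "cpoly.dim (forms k) = (k + 3) choose 3"
  by (simp add: forms_def dim_supp finite_mons card_mons)

lemma subspace_forms: "cpoly.subspace (forms k)"
  by (simp add: forms_def subspace_supp)

lemma fin_spanned_forms: "cpoly.fin_spanned (forms k)"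
  by (simp add: forms_def fin_spanned_supp finite_mons)

lemma linear_mult: "Vector_Spaces.linear (\<lambda>c x. Cst c * x) (\<lambda>c x. Cst c * x) ((*) u)"
  by (rule cpoly_linearI) (simp_all add: distrib_left mult.left_commute)

lemma subspace_mult_image: "cpoly.subspace V \<Longrightarrow> cpoly.subspace ((*) u ` V)"
proof -
  interpret l: Vector_Spaces.linear "\<lambda>c x. Cst c * x" "\<lambda>c x. Cst c * x" "(*) u" by (rule linear_mult)
  show "cpoly.subspace V \<Longrightarrow> cpoly.subspace ((*) u ` V)" by (rule l.subspace_image)
qed

lemma homogeneous_cofactor:
  fixes F :: "'n::{finite,linorder} cpoly"
  assumes "homogeneous k (F * h)" "F * h \<noteq> 0" "homogeneous D F"
  shows "homogeneous (k - D) h"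
proof -
  obtain i j where ij: "homogeneous i F" "homogeneous j h" "i + j = k"
    using homogeneous_factor[OF assms(1,2)] .
  then have "i = D" using assms homogeneous_unique[of F i D] by auto
  then show ?thesis using ij by auto
qed

text \<open>Since \<open>F\<close> and \<open>E\<close> are coprime, their common multiples are
  multiples of \<open>F * E\<close>. The dimension formula for the sum of the two spaces of
  multiples then bounds the degree \<open>k\<close> part of the ideal generated by \<open>F\<close>
  and \<open>E\<close> from below.\<close>

lemma dim_complete_intersection_ge:
  fixes F E :: "4 cpoly"
  assumes FE: "homogeneous D1 F" "homogeneous D2 E" "F \<noteq> 0" "E \<noteq> 0"
    and cop: "\<And>h. F dvd h * E \<Longrightarrow> F dvd h"
    and k: "D1 + D2 \<le> k"
  defines "K \<equiv> {x + y | x y. x \<in> (*) F ` forms (k - D1) \<and> y \<in> (*) E ` forms (k - D2)}"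
  shows "((k - D1 + 3) choose 3) + ((k - D2 + 3) choose 3) \<le> cpoly.dim K + ((k - D1 - D2 + 3) choose 3)"
proof -
  let ?A = "(*) F ` forms (k - D1)" and ?B = "(*) E ` forms (k - D2)" and ?C = "(*) (F * E) ` forms (k - D1 - D2)"
  have fs: "cpoly.fin_spanned ((*) u ` forms j)" for u j
    by (intro cpoly2.fin_spanned_image linear_mult fin_spanned_forms)
  have ss: "cpoly.subspace ((*) u ` forms j)" for u j
    by (intro subspace_mult_image subspace_forms)
  have dm: "cpoly.dim ((*) u ` forms j) = (j + 3) choose 3" if "u \<noteq> 0" for u j
    using dim_mult_image[OF subspace_forms fin_spanned_forms that] by (simp add: dim_forms)
  have "?A \<inter> ?B \<subseteq> ?C"
  proof
    fix x assume "x \<in> ?A \<inter> ?B"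
    then obtain f g where fg: "x = F * f" "x = E * g" "g \<in> forms (k - D2)" by blast
    have hg: "homogeneous (k - D2) g" using fg(3) by (simp add: mem_forms_iff)
    have "F dvd g * E" using fg by (metis dvdI mult.commute)
    then have "F dvd g" by (rule cop)
    then obtain h where h: "g = F * h" by (rule dvdE)
    have "homogeneous (k - D1 - D2) h"
    proof (cases "g = 0")
      case False
      then show ?thesis using homogeneous_cofactor[of "k - D2" F h D1] hg h FE by (simp add: add.commute)
    qed (use h FE in simp)
    then show "x \<in> ?C" using fg(2) h by (auto simp: mem_forms_iff mult_ac)
  qed
  then have "cpoly.dim (?A \<inter> ?B) \<le> cpoly.dim ?C" by (rule cpoly.dim_mono_fin[OF _ fs])
  also have "cpoly.dim ?C = (k - D1 - D2 + 3) choose 3" by (rule dm) (use FE in simp)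
  finally have "cpoly.dim (?A \<inter> ?B) \<le> (k - D1 - D2 + 3) choose 3" .
  moreover have "cpoly.dim K + cpoly.dim (?A \<inter> ?B) = ((k - D1 + 3) choose 3) + ((k - D2 + 3) choose 3)"
    unfolding K_def using cpoly.dim_sum_inter[OF ss fs ss fs] dm FE by simp
  ultimately show ?thesis by linarith
qed

text \<open>The local counterpart, with the opposite inequality: jets of multiples of
  \<open>f * e\<close> are jets of multiples of \<open>f\<close> and of \<open>e\<close>, so the
  intersection of these two spaces is at least that large and their sum correspondingly
  small.\<close>

lemma dim_local_complete_intersection_le:
  fixes X :: "4 cpoly set"
  fixes f e :: "4 cpoly"
  assumes fe: "f \<noteq> 0" "e \<noteq> 0" "no_var i f" "no_var i e"
    and s: "vord f + vord e \<le> s"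
    and X: "\<And>x. x \<in> X \<Longrightarrow> \<exists>c d. no_var i c \<and> no_var i d \<and> x = trunc s (f * c) + trunc s (e * d)"
  shows "cpoly.dim X + ((s - vord f - vord e + 2) choose 3) \<le>
    ((s - vord f + 2) choose 3) + ((s - vord e + 2) choose 3)"
proof -
  define I where "I u = (\<lambda>c. trunc s (u * c)) ` supp (low_mons i (s - vord u))" for u
  have dimI: "cpoly.dim (I u) = (s - vord u + 2) choose 3" if "u \<noteq> 0" "vord u \<le> s" for u
    using dim_trunc_mult[OF that] by (simp add: I_def)
  have ssI: "cpoly.subspace (I u)" and fsI: "cpoly.fin_spanned (I u)" if "u \<noteq> 0" "vord u \<le> s" for u
    using subspace_trunc_mult[OF that] fin_spanned_trunc_mult[OF that] by (simp_all add: I_def)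
  have mem: "trunc s (u * c) \<in> I u" if "u \<noteq> 0" "vord u \<le> s" "no_var i c" for u c
  proof -
    have "trunc s (u * c) = trunc s (u * trunc (s - vord u) c)"
      by (rule trunc_mult_trunc[symmetric]) (use that in \<open>auto simp: ordge_iff_vord\<close>)
    then show ?thesis using trunc_mem_low[OF that(3)] by (auto simp: I_def)
  qed
  let ?S = "{x + y | x y. x \<in> I f \<and> y \<in> I e}"
  have vf: "vord f \<le> s" and ve: "vord e \<le> s" using s by auto
  have sum: "cpoly.dim ?S + cpoly.dim (I f \<inter> I e) = cpoly.dim (I f) + cpoly.dim (I e)"
    using fe vf ve by (intro cpoly.dim_sum_inter ssI fsI)
  have "X \<subseteq> ?S" using X mem[OF fe(1) vf] mem[OF fe(2) ve] by fast
  moreover have "cpoly.fin_spanned ?S"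
  proof -
    have "?S \<subseteq> supp (\<Union>f\<in>{..<s}. mons f)"
      by (auto simp: I_def supp_def mons_def keys_trunc dest!: subsetD[OF keys_add])
    then show ?thesis
      by (rule cpoly.fin_spanned_subset[rotated]) (intro fin_spanned_supp finite_UN_I finite_mons, simp)
  qed
  ultimately have "cpoly.dim X \<le> cpoly.dim ?S" by (intro cpoly.dim_mono_fin)
  moreover have "I (f * e) \<subseteq> I f \<inter> I e"
  proof
    fix x assume "x \<in> I (f * e)"
    then obtain c where c: "no_var i c" "x = trunc s (f * e * c)" by (auto simp: I_def mem_low_iff)
    then have "x = trunc s (f * (e * c))" "x = trunc s (e * (f * c))" by (simp_all add: mult_ac)
    then show "x \<in> I f \<inter> I e"
      using mem[OF fe(1) vf, of "e * c"] mem[OF fe(2) ve, of "f * c"] c(1) fe by (simp add: no_var_mult)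
  qed
  then have "cpoly.dim (I (f * e)) \<le> cpoly.dim (I f \<inter> I e)"
    by (intro cpoly.dim_mono_fin cpoly.fin_spanned_subset[OF fsI[OF fe(1) vf]]) auto
  moreover have "cpoly.dim (I (f * e)) = (s - vord f - vord e + 2) choose 3"
    using dimI[of "f * e"] fe s by (simp add: vord_mult)
  ultimately show ?thesis using sum dimI fe vf ve by simp
qed

text \<open>
  Every jet \<open>c\<close> of order less than \<open>s\<close> at \<open>p\<close> is, up to a unit, the jet of the form \<open>H * S p ^ s\<close>
  where \<open>H\<close> homogenizes \<open>c\<close>, and this form vanishes to order \<open>s\<close> at all other points.
\<close>

lemma points_conditions:
  fixes P :: "(complex ^ 4) set" and S :: "complex ^ 4 \<Rightarrow> 4 cpoly"
  assumes fin: "finite P" and e: "0 < e" and s: "0 < s"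
    and i: "\<And>p. p \<in> P \<Longrightarrow> p $ i p \<noteq> 0"
    and S: "\<And>p. p \<in> P \<Longrightarrow> homogeneous (e - 1) (S p)"
      "\<And>p q. p \<in> P \<Longrightarrow> q \<in> P \<Longrightarrow> poly_eval (S p) q = (if p = q then 1 else 0)"
  shows "cpoly.dim {f \<in> forms (s * e - 1). \<forall>p\<in>P. trunc s (slice p (i p) f) = 0} + card P * ((s + 2) choose 3)
    \<le> (s * e + 2) choose 3"
proof -
  define k where "k = s * e - 1"
  have k1: "k + 1 = s * e" using e s by (simp add: k_def)
  define T where "T p f = trunc s (slice p (i p) f)" for p f
  have lin: "Vector_Spaces.linear (\<lambda>c x. Cst c * x) (\<lambda>c x. Cst c * x) (T p)" for p
    unfolding T_def by (rule linear_trunc_slice)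
  define J where "J Q = {f \<in> forms k. \<forall>p\<in>Q. T p f = 0}" for Q
  have ssJ: "cpoly.subspace (J Q)" for Q
  proof -
    have "T p 0 = 0" "T p (x + y) = T p x + T p y" "T p (Cst c * x) = Cst c * T p x" for p x y c
      by (simp_all add: T_def trunc_add trunc_Cst_mult trunc_eq_0_iff)
    then show ?thesis using subspace_forms[of k] by (auto simp: J_def cpoly.subspace_def)
  qed
  have fsJ: "cpoly.fin_spanned (J Q)" for Q
    by (rule cpoly.fin_spanned_subset[OF fin_spanned_forms[of k]]) (auto simp: J_def)
  \<comment> \<open>Induction over the points: prescribing a zero jet at one more point cuts the
    space down by the rank of \<open>T p\<close>, which is at least the number of monomials in a
    jet.\<close>
  have "Q \<subseteq> P \<Longrightarrow> cpoly.dim (J Q) + card Q * ((s + 2) choose 3) \<le> (s * e + 2) choose 3" if "finite Q" for Q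
    using that
  proof (induction Q)
    case empty
    have "k + 3 = s * e + 2" using k1 by simp
    then have "cpoly.dim (forms k) = (s * e + 2) choose 3" by (simp only: dim_forms)
    then show ?case by (simp add: J_def)
  next
    case (insert p Q)
    define U where "U = slice p (i p) (S p) ^ s"
    have U0: "poly_eval U 0 = 1" using S(2)[of p p] insert.prems by (simp add: U_def)
    then have Unz: "U \<noteq> 0" by auto
    have "\<not> ordge 1 U" using U0 by (simp add: ordge_1_iff del: One_nat_def)
    then have vU: "vord U = 0" using Unz by (simp add: ordge_iff_vord)
    have "(\<lambda>c. trunc s (U * c)) ` supp (low_mons (i p) (s - vord U)) \<subseteq> T p ` J Q"
    proof
      fix x assume "x \<in> (\<lambda>c. trunc s (U * c)) ` supp (low_mons (i p) (s - vord U))"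
      then obtain c where c: "c \<in> supp (low_mons (i p) (Suc (s - 1)))" "x = trunc s (U * c)"
        using s vU by auto
      obtain H where H: "homogeneous (s - 1) H" "slice p (i p) H = c"
        using homogenize[OF c(1), of p] i insert.prems by auto
      have "homogeneous ((s - 1) + (e - 1) * s) (H * S p ^ s)"
        using H(1) S(1) insert.prems by (intro homogeneous_mult homogeneous_power) auto
      moreover have "(s - 1) + (e - 1) * s = k"
        using e s by (cases e; cases s) (simp_all add: k_def algebra_simps)
      ultimately have 1: "H * S p ^ s \<in> forms k" by (simp add: mem_forms_iff)
      have 2: "T q (H * S p ^ s) = 0" if "q \<in> Q" for q
      proof -
        have "p \<noteq> q" using that insert.hyps by auto
        then have "poly_eval (slice q (i q) (S p)) 0 = 0" using S(2)[of p q] that insert.prems by auto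
        then have "ordge 1 (slice q (i q) (S p))" by (simp add: ordge_1_iff del: One_nat_def)
        then have "ordge (1 * s) (slice q (i q) (S p) ^ s)" by (rule ordge_power)
        then show ?thesis by (simp add: T_def trunc_eq_0_iff ordge_mult_left)
      qed
      have "T p (H * S p ^ s) = x" using c(2) H(2) by (simp add: T_def U_def mult.commute)
      then show "x \<in> T p ` J Q" using 1 2 by (force simp: J_def)
    qed
    then have "cpoly.dim ((\<lambda>c. trunc s (U * c)) ` supp (low_mons (i p) (s - vord U))) \<le> cpoly.dim (T p ` J Q)"
      by (rule cpoly.dim_mono_fin[OF _ cpoly2.fin_spanned_image[OF lin fsJ]])
    then have "(s + 2) choose 3 \<le> cpoly.dim (T p ` J Q)"
      using dim_trunc_mult[OF Unz, of s "i p"] vU by simp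
    moreover have "cpoly.dim (J Q) = cpoly.dim {x\<in>J Q. T p x = 0} + cpoly.dim (T p ` J Q)"
      by (rule cpoly2.rank_nullity[OF lin ssJ fsJ])
    moreover have "{x\<in>J Q. T p x = 0} = J (insert p Q)" by (auto simp: J_def)
    ultimately show ?case using insert by simp
  qed
  from this[OF fin] show ?thesis by (simp add: J_def T_def k_def)
qed

text \<open>Rank-nullity for one point after the other; the rank on the remaining subspace is at
  most the rank on \<open>K\<close>.\<close>

lemma dim_le_sum_local:
  fixes K :: "4 cpoly set"
  assumes "finite P" "cpoly.subspace K" "cpoly.fin_spanned K"
  shows "cpoly.dim K \<le> cpoly.dim {f \<in> K. \<forall>p\<in>P. trunc s (slice p (i p) f) = 0} +
    (\<Sum>p\<in>P. cpoly.dim ((\<lambda>f. trunc s (slice p (i p) f)) ` K))"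
  using assms(1)
proof (induction P)
  case (insert p P)
  define T where "T = (\<lambda>f. trunc s (slice p (i p) f))"
  have lin: "Vector_Spaces.linear (\<lambda>c x. Cst c * x) (\<lambda>c x. Cst c * x) T"
    unfolding T_def by (rule linear_trunc_slice)
  let ?J = "{f \<in> K. \<forall>p\<in>P. trunc s (slice p (i p) f) = 0}"
  have ss: "cpoly.subspace ?J"
  proof -
    define T' where "T' p f = trunc s (slice p (i p) f)" for p f
    have "T' p 0 = 0" "T' p (x + y) = T' p x + T' p y" "T' p (Cst c * x) = Cst c * T' p x" for p x y c
      by (simp_all add: T'_def trunc_add trunc_Cst_mult trunc_eq_0_iff)
    then show ?thesis using assms(2) by (auto simp: cpoly.subspace_def simp flip: T'_def)
  qed
  have fs: "cpoly.fin_spanned ?J"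
    by (rule cpoly.fin_spanned_subset[OF assms(3)]) auto
  have "cpoly.dim ?J = cpoly.dim {x\<in>?J. T x = 0} + cpoly.dim (T ` ?J)"
    by (rule cpoly2.rank_nullity[OF lin ss fs])
  moreover have "cpoly.dim (T ` ?J) \<le> cpoly.dim (T ` K)"
    by (intro cpoly.dim_mono_fin cpoly2.fin_spanned_image[OF lin assms(3)]) auto
  moreover have "{x\<in>?J. T x = 0} = {f \<in> K. \<forall>p\<in>insert p P. trunc s (slice p (i p) f) = 0}"
    by (auto simp: T_def)
  ultimately show ?case using insert by (simp add: T_def)
qed simp

text \<open>A mixed second difference of the cubic \<open>n * (n + 1) * (n + 2)\<close> is linear in
  \<open>n\<close> with slope proportional to \<open>a * b\<close>; this is where the products of
  multiplicities and of degrees come from.\<close>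

lemma choose_three_second_difference:
  assumes "a + b \<le> n"
  shows "6 * (int ((n + 2) choose 3) - int ((n - a + 2) choose 3) - int ((n - b + 2) choose 3)
     + int ((n - a - b + 2) choose 3)) = 3 * int a * int b * (2 * int n - int a - int b + 2)"
proof -
  have "int (n - a) = int n - int a" "int (n - b) = int n - int b" "int (n - a - b) = int n - int a - int b"
    using assms by auto
  then show ?thesis
    using six_choose_three[of n] six_choose_three[of "n - a"] six_choose_three[of "n - b"]
      six_choose_three[of "n - a - b"]
    by (simp add: algebra_simps)
qed

text \<open>
  Both sides of the dimension estimate are polynomials in \<open>s\<close> whose terms of degree above one cancel;
  the claim compares their slopes.
\<close>

lemma bezout_points:
  fixes P :: "(complex ^ 4) set" and S :: "complex ^ 4 \<Rightarrow> 4 cpoly"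
  assumes fin: "finite P" and nz: "0 \<notin> P" and e: "0 < e"
    and S: "\<And>p. p \<in> P \<Longrightarrow> homogeneous (e - 1) (S p)"
      "\<And>p q. p \<in> P \<Longrightarrow> q \<in> P \<Longrightarrow> poly_eval (S p) q = (if p = q then 1 else 0)"
    and FE: "homogeneous D1 F" "homogeneous D2 E" "F \<noteq> 0" "E \<noteq> 0"
    and cop: "\<And>h. F dvd h * E \<Longrightarrow> F dvd h"
    and ord: "\<And>p. p \<in> P \<Longrightarrow> ordge (m p) (translate p F)" "\<And>p. p \<in> P \<Longrightarrow> ordge (n p) (translate p E)"
  shows "(\<Sum>p\<in>P. m p * n p) \<le> e * D1 * D2"
proof -
  define i where "i p = (SOME j. p $ j \<noteq> 0)" for p :: "complex ^ 4"
  have i: "p $ i p \<noteq> 0" if "p \<in> P" for p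
  proof -
    have "p \<noteq> 0" using nz that by auto
    then have "\<exists>j. p $ j \<noteq> 0" by (simp add: vec_eq_iff)
    then show ?thesis unfolding i_def by (rule someI_ex)
  qed
  \<comment> \<open>The exact orders in the chart determine the dimensions of the jet spaces. They
    may exceed \<open>m p\<close> and \<open>n p\<close>, which is harmless for the final
    estimate.\<close>
  define a b where "a p = vord (slice p (i p) F)" and "b p = vord (slice p (i p) E)" for p
  have nzF: "slice p (i p) F \<noteq> 0" "slice p (i p) E \<noteq> 0" if "p \<in> P" for p
    using slice_nonzero FE i[OF that] by blast+
  have ab: "m p \<le> a p" "n p \<le> b p" if "p \<in> P" for p
    using ordge_slice[OF ord(1)[OF that], of "i p"] ordge_slice[OF ord(2)[OF that], of "i p"] nzF[OF that]
    by (simp_all add: a_def b_def ordge_iff_vord)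
  have main: "(\<Sum>p\<in>P. int (a p) * int (b p) * (2 * int s - int (a p) - int (b p) + 2)) \<le>
      int D1 * int D2 * (2 * int (s * e) - int D1 - int D2 + 2)"
    if s: "D1 + D2 < s" "\<And>p. p \<in> P \<Longrightarrow> a p + b p \<le> s" for s
  proof -
    define k where "k = s * e - 1"
    have s0: "0 < s" using s by simp
    have se: "s \<le> s * e" using e by simp
    have k1: "k + 1 = s * e" using e s0 by (simp add: k_def)
    have k: "D1 + D2 \<le> k" using s se k1 by linarith
    \<comment> \<open>The degree \<open>k\<close> part of the ideal generated by \<open>F\<close>
      and \<open>E\<close>. Fact \<open>1\<close> bounds its dimension from below; \<open>2\<close>
      to \<open>4\<close> bound it from above by the forms with zero jets plus the local
      contributions.\<close>
    define K where "K = {x + y | x y. x \<in> (*) F ` forms (k - D1) \<and> y \<in> (*) E ` forms (k - D2)}"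
    have 1: "((k - D1 + 3) choose 3) + ((k - D2 + 3) choose 3) \<le> cpoly.dim K + ((k - D1 - D2 + 3) choose 3)"
      unfolding K_def by (rule dim_complete_intersection_ge[OF FE cop k])
    have Kf: "K \<subseteq> forms k"
    proof -
      have "homogeneous k (F * c)" if "homogeneous (k - D1) c" for c
        using homogeneous_mult[OF FE(1) that] k by simp
      moreover have "homogeneous k (E * c)" if "homogeneous (k - D2) c" for c
        using homogeneous_mult[OF FE(2) that] k by simp
      ultimately show ?thesis by (auto simp: K_def mem_forms_iff intro!: homogeneous_add)
    qed
    have ssK: "cpoly.subspace K"
      unfolding K_def by (intro cpoly.subspace_sums subspace_mult_image subspace_forms)
    have fsK: "cpoly.fin_spanned K"
      by (rule cpoly.fin_spanned_subset[OF fin_spanned_forms Kf])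
    define t where "t p = cpoly.dim ((\<lambda>f. trunc s (slice p (i p) f)) ` K)" for p
    define dJ where "dJ = cpoly.dim {f \<in> forms k. \<forall>p\<in>P. trunc s (slice p (i p) f) = 0}"
    have "cpoly.dim {f \<in> K. \<forall>p\<in>P. trunc s (slice p (i p) f) = 0} \<le> dJ"
      unfolding dJ_def using Kf
      by (intro cpoly.dim_mono_fin cpoly.fin_spanned_subset[OF fin_spanned_forms[of k]]) auto
    then have 2: "cpoly.dim K \<le> dJ + (\<Sum>p\<in>P. t p)"
      using dim_le_sum_local[OF fin ssK fsK, of s i] by (simp add: t_def)
    have 3: "dJ + card P * ((s + 2) choose 3) \<le> (s * e + 2) choose 3"
      unfolding dJ_def k_def using points_conditions[OF fin e s0 i S] by blast
    have 4: "t p + ((s - a p - b p + 2) choose 3) \<le> ((s - a p + 2) choose 3) + ((s - b p + 2) choose 3)"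
      if p: "p \<in> P" for p
      unfolding t_def a_def b_def
    proof (rule dim_local_complete_intersection_le)
      fix x assume "x \<in> (\<lambda>f. trunc s (slice p (i p) f)) ` K"
      then obtain c d where "x = trunc s (slice p (i p) (F * c + E * d))"
        by (auto simp: K_def)
      then have "x = trunc s (slice p (i p) F * slice p (i p) c) + trunc s (slice p (i p) E * slice p (i p) d)"
        by (simp add: trunc_add)
      then show "\<exists>c d. no_var (i p) c \<and> no_var (i p) d \<and>
          x = trunc s (slice p (i p) F * c) + trunc s (slice p (i p) E * d)"
        using no_var_slice by blast
    qed (use nzF[OF p] no_var_slice s(2)[OF p] in \<open>auto simp: a_def b_def\<close>)
    define C where "C j = int ((j + 2) choose 3)" for j
    have e1: "k - D1 + 3 = s * e - D1 + 2" "k - D2 + 3 = s * e - D2 + 2" "k - D1 - D2 + 3 = s * e - D1 - D2 + 2"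
      using k k1 by auto
    have 1: "C (s * e - D1) + C (s * e - D2) - C (s * e - D1 - D2) \<le> int (cpoly.dim K)"
      using 1 unfolding e1 C_def by linarith
    have 2: "int (cpoly.dim K) \<le> int dJ + (\<Sum>p\<in>P. int (t p))"
      using 2 by (metis of_nat_add of_nat_mono of_nat_sum)
    have "int (dJ + card P * ((s + 2) choose 3)) \<le> C (s * e)" unfolding C_def using 3 by (rule of_nat_mono)
    then have 3: "int dJ + (\<Sum>p\<in>P. C s) \<le> C (s * e)" by (simp add: C_def)
    have 4: "(\<Sum>p\<in>P. int (t p)) \<le> (\<Sum>p\<in>P. C (s - a p) + C (s - b p) - C (s - a p - b p))"
    proof (rule sum_mono)
      fix p assume "p \<in> P"
      from 4[OF this] show "int (t p) \<le> C (s - a p) + C (s - b p) - C (s - a p - b p)"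
        unfolding C_def by linarith
    qed
    have "(\<Sum>p\<in>P. C s - C (s - a p) - C (s - b p) + C (s - a p - b p)) =
       (\<Sum>p\<in>P. C s) - (\<Sum>p\<in>P. C (s - a p) + C (s - b p) - C (s - a p - b p))"
      unfolding sum_subtractf[symmetric] by (rule sum.cong) auto
    then have "(\<Sum>p\<in>P. C s - C (s - a p) - C (s - b p) + C (s - a p - b p)) \<le>
      C (s * e) - C (s * e - D1) - C (s * e - D2) + C (s * e - D1 - D2)"
      using 1 2 3 4 by linarith
    then have "(\<Sum>p\<in>P. 6 * (C s - C (s - a p) - C (s - b p) + C (s - a p - b p))) \<le>
      6 * (C (s * e) - C (s * e - D1) - C (s * e - D2) + C (s * e - D1 - D2))"
      unfolding sum_distrib_left[symmetric] by (rule mult_left_mono) simp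
    also have "(\<Sum>p\<in>P. 6 * (C s - C (s - a p) - C (s - b p) + C (s - a p - b p))) =
       (\<Sum>p\<in>P. 3 * int (a p) * int (b p) * (2 * int s - int (a p) - int (b p) + 2))"
      unfolding C_def using s(2) by (intro sum.cong choose_three_second_difference) auto
    also have "\<dots> = 3 * (\<Sum>p\<in>P. int (a p) * int (b p) * (2 * int s - int (a p) - int (b p) + 2))"
      by (simp add: sum_distrib_left mult_ac)
    also have "6 * (C (s * e) - C (s * e - D1) - C (s * e - D2) + C (s * e - D1 - D2)) =
       3 * int D1 * int D2 * (2 * int (s * e) - int D1 - int D2 + 2)"
      unfolding C_def using k k1 by (intro choose_three_second_difference) auto
    finally show ?thesis by (simp only: mult.assoc mult_le_cancel_left_pos zero_less_numeral)
  qed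
  define W where "W = (\<Sum>p\<in>P. int (a p) * int (b p))"
  define C where "C = (\<Sum>p\<in>P. int (a p) * int (b p) * (int (a p) + int (b p)))"
  \<comment> \<open>Past \<open>C + 2 * D1 * D2\<close>, the total of the terms that do not grow
    with \<open>s\<close>, a slope too large by 1 violates the inequality; the remaining summands
    meet the assumptions of \<open>main\<close>.\<close>
  define s where "s = nat C + 2 * D1 * D2 + (\<Sum>p\<in>P. a p + b p) + D1 + D2 + 1"
  have C0: "C \<ge> 0" unfolding C_def by (intro sum_nonneg) auto
  have sC: "int s > C + 2 * int D1 * int D2" proof -
    have "int (nat C + 2 * D1 * D2) < int s" unfolding of_nat_less_iff by (simp add: s_def)
    then show ?thesis using C0 by simp
  qed
  have sab: "a p + b p \<le> s" if "p \<in> P" for p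
    using member_le_sum[of p P "\<lambda>p. a p + b p"] fin that by (auto simp: s_def)
  have "2 * int s * W - C \<le> (\<Sum>p\<in>P. int (a p) * int (b p) * (2 * int s - int (a p) - int (b p) + 2))"
    unfolding W_def C_def sum_distrib_left sum_subtractf[symmetric]
    by (intro sum_mono) (simp add: algebra_simps)
  also have "\<dots> \<le> int D1 * int D2 * (2 * int (s * e) - int D1 - int D2 + 2)"
    by (rule main) (use sab in \<open>auto simp: s_def\<close>)
  also have "\<dots> \<le> int D1 * int D2 * (2 * int (s * e) + 2)"
    by (intro mult_left_mono) auto
  finally have le: "2 * int s * W - C \<le> 2 * int s * (int e * int D1 * int D2) + 2 * int D1 * int D2"
    by (simp add: algebra_simps)
  have "W \<le> int e * int D1 * int D2"
  proof (rule ccontr)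
    assume "\<not> ?thesis"
    then have "int e * int D1 * int D2 + 1 \<le> W" by linarith
    then have "2 * int s * (int e * int D1 * int D2 + 1) \<le> 2 * int s * W" by (intro mult_left_mono) auto
    then have "2 * int s \<le> C + 2 * int D1 * int D2" using le by (simp add: algebra_simps)
    then show False using sC C0 by linarith
  qed
  moreover have "int (\<Sum>p\<in>P. m p * n p) \<le> W"
    unfolding W_def of_nat_sum of_nat_mult using ab by (intro sum_mono mult_mono) auto
  ultimately have "int (\<Sum>p\<in>P. m p * n p) \<le> int (e * D1 * D2)" by simp
  then show ?thesis by linarith
qed

section \<open>Linear forms\<close>

definition linear_form :: "complex ^ 4 \<Rightarrow> 4 cpoly" where
  "linear_form a = (\<Sum>i\<in>UNIV. Cst (a $ i) * Var i)"

lemma homogeneous_linear_form: "homogeneous 1 (linear_form a)"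
  unfolding linear_form_def by (intro homogeneous_sum homogeneous_Cst_mult homogeneous_Var)

lemma poly_eval_linear_form: "poly_eval (linear_form a) v = (\<Sum>i\<in>UNIV. a $ i * v $ i)"
  by (simp add: linear_form_def)

lemma poly_eval_linear_form_add: "poly_eval (linear_form a) (v + w) = poly_eval (linear_form a) v + poly_eval (linear_form a) w"
  by (simp add: poly_eval_linear_form distrib_left sum.distrib)

lemma poly_eval_linear_form_scale: "poly_eval (linear_form a) (c *s v) = c * poly_eval (linear_form a) v"
  by (simp add: poly_eval_linear_form sum_distrib_left mult_ac)

lemma poly_eval_linear_form_sum: "poly_eval (linear_form a) (sum f A) = (\<Sum>x\<in>A. poly_eval (linear_form a) (f x))"
  by (induction A rule: infinite_finite_induct) (auto simp: poly_eval_linear_form_add, simp_all add: poly_eval_linear_form)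

lemma poly_eval_linear_form_axis: "poly_eval (linear_form a) (axis i 1) = a $ i"
proof -
  have "poly_eval (linear_form a) (axis i 1) = (\<Sum>j\<in>UNIV. if j = i then a $ j else 0)"
    unfolding poly_eval_linear_form by (intro sum.cong) (auto simp: axis_def)
  then show ?thesis by simp
qed

lemma linear_form_eq_0_iff [simp]: "linear_form a = 0 \<longleftrightarrow> a = 0"
proof
  assume "linear_form a = 0"
  then have "a $ i = 0" for i using poly_eval_linear_form_axis[of a i] by simp
  then show "a = 0" by (simp add: vec_eq_iff)
qed (simp add: linear_form_def)

lemma homogeneous_1D:
  assumes "homogeneous 1 L" obtains a where "L = linear_form a"
proof -
  have "\<exists>c. partial_deriv i L = Cst c" for i
    using homogeneous_partial_deriv[OF assms, of i] by (intro homogeneous_0D) simp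
  then obtain c where c: "partial_deriv i L = Cst (c i)" for i by metis
  have "L = (\<Sum>i\<in>UNIV. Var i * Cst (c i))"
    using euler[OF assms] by (simp add: c)
  also have "\<dots> = linear_form (\<chi> i. c i)" by (simp add: linear_form_def mult.commute)
  finally show ?thesis by (rule that)
qed

text \<open>Substituting \<open>y\<close> projects along the \<open>i\<close>-th axis onto the
  plane. Every polynomial is congruent to its substitution modulo the linear form, and that of
  \<open>f\<close> vanishes identically.\<close>

lemma linear_form_dvd_if_vanishes:
  assumes "a \<noteq> 0" "\<And>v. poly_eval (linear_form a) v = 0 \<Longrightarrow> poly_eval f v = 0"
  shows "linear_form a dvd f"
proof -
  obtain i where i: "a $ i \<noteq> 0" using assms(1) by (auto simp: vec_eq_iff)
  define y where "y j = (if j = i then Var i - Cst (1 / a $ i) * linear_form a else Var j)" for j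
  have y: "linear_form a dvd Var j - y j" for j by (auto simp: y_def)
  have "linear_form a dvd g - subst y g" for g
  proof (induction g rule: cpoly_induct)
    case (add f g)
    then have "linear_form a dvd (f - subst y f) + (g - subst y g)" by (rule dvd_add)
    then show ?case by (simp add: algebra_simps)
  next
    case (mult f g)
    have "f * g - subst y (f * g) = (f - subst y f) * g + subst y f * (g - subst y g)"
      by (simp add: algebra_simps)
    then show ?case using mult by (metis dvd_add dvd_mult dvd_mult2)
  qed (simp_all add: y)
  moreover have "subst y f = 0"
  proof (rule cpoly_identity)
    fix v
    define w where "w = (\<chi> j. poly_eval (y j) v)"
    have w: "w = v - (poly_eval (linear_form a) v / a $ i) *s axis i 1"
      by (auto simp: w_def y_def vec_eq_iff axis_def)
    have "poly_eval (linear_form a) (v + (- (poly_eval (linear_form a) v / a $ i)) *s axis i 1) = 0"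
      unfolding poly_eval_linear_form_add poly_eval_linear_form_scale poly_eval_linear_form_axis using i by simp
    moreover have "w = v + (- (poly_eval (linear_form a) v / a $ i)) *s axis i 1"
      unfolding w by (simp add: vec_eq_iff)
    ultimately have "poly_eval (linear_form a) w = 0" by simp
    then have "poly_eval f w = 0" by (rule assms(2))
    then show "poly_eval (subst y f) v = 0" by (simp add: w_def)
  qed
  ultimately show ?thesis by (metis diff_zero)
qed

interpretation vec_functional: vector_space_pair "(*s) :: complex \<Rightarrow> complex ^ 4 \<Rightarrow> complex ^ 4" "(*) :: complex \<Rightarrow> complex \<Rightarrow> complex"
  by unfold_locales (simp_all add: algebra_simps)

lemma ex_linear_form_prescribed:
  assumes "vec.independent (B :: (complex ^ 4) set)"
  obtains a where "\<And>b. b \<in> B \<Longrightarrow> poly_eval (linear_form a) b = h b"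
proof -
  obtain g where g: "Vector_Spaces.linear (*s) (*) g" "\<forall>x\<in>B. g x = h x"
    using vec_functional.linear_independent_extend[OF assms, of h] by blast
  interpret g: Vector_Spaces.linear "(*s) :: complex \<Rightarrow> complex ^ 4 \<Rightarrow> complex ^ 4" "(*)" g by fact
  have "poly_eval (linear_form (\<chi> i. g (axis i 1))) v = g v" for v
  proof -
    have "g v = g (\<Sum>i\<in>UNIV. v $ i *s axis i 1)" by (simp add: basis_expansion)
    also have "\<dots> = (\<Sum>i\<in>UNIV. v $ i * g (axis i 1))" by (simp add: g.sum g.scale)
    finally show ?thesis by (simp add: poly_eval_linear_form mult.commute)
  qed
  then show ?thesis using that g(2) by metis
qed

lemma ex_linear_form_vanishing:
  assumes "vec.span (X :: (complex ^ 4) set) \<noteq> UNIV"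
  obtains a where "a \<noteq> 0" "\<And>x. x \<in> X \<Longrightarrow> poly_eval (linear_form a) x = 0"
proof -
  obtain B where B: "B \<subseteq> X" "vec.independent B" "X \<subseteq> vec.span B"
    using vec.maximal_independent_subset by blast
  then have sp: "vec.span B = vec.span X" by (metis vec.span_eq vec.span_superset subset_trans)
  then obtain y where y: "y \<notin> vec.span B" using assms by auto
  then have "vec.independent (insert y B)" using B(2) by (simp add: vec.independent_insertI)
  then obtain a where a: "\<And>b. b \<in> insert y B \<Longrightarrow> poly_eval (linear_form a) b = (if b = y then 1 else 0)"
    using ex_linear_form_prescribed[of "insert y B" "\<lambda>b. if b = y then 1 else 0"] by blast
  have "y \<notin> B" using y vec.span_base by blast
  have z: "poly_eval (linear_form a) x = 0" if "x \<in> vec.span B" for x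
    using that
  proof (induction rule: vec.span_induct_alt)
    case base
    show ?case by (simp add: poly_eval_linear_form)
  next
    case (step c x y')
    then show ?case using a[of x] \<open>y \<notin> B\<close> by (auto simp: poly_eval_linear_form_add poly_eval_linear_form_scale)
  qed
  have "a \<noteq> 0" using a[of y] by (auto simp: linear_form_def)
  then show ?thesis using that z B(3) by blast
qed

lemma poly_eval_shift_if_dir_deriv_dir_deriv_eq_0:
  assumes "dir_deriv p (dir_deriv p f) = 0"
  shows "poly_eval f (x + c *s p) = poly_eval f x + c * poly_eval (dir_deriv p f) x"
proof -
  have "pderiv (line_poly x p (dir_deriv p f)) = 0" using assms by (simp add: pderiv_line_poly) (simp add: line_poly_def)
  then obtain k where k: "line_poly x p (dir_deriv p f) = [:k:]" by (metis degree_eq_zeroE pderiv_eq_0_iff)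
  have "pderiv (line_poly x p f - [:0, k:]) = 0"
    by (simp add: pderiv_diff pderiv_line_poly k pderiv_pCons)
  then obtain l where "line_poly x p f - [:0, k:] = [:l:]" by (metis degree_eq_zeroE pderiv_eq_0_iff)
  then have "line_poly x p f = [:l, k:]" by (simp add: diff_eq_eq)
  then have "poly_eval f (x + c *s p) = l + c * k" "poly_eval f (x + 0 *s p) = l"
    using poly_line_poly[of x p f c] poly_line_poly[of x p f 0] by simp_all
  moreover have "poly_eval (dir_deriv p f) x = k" using poly_line_poly[of x p "dir_deriv p f" 0] k by simp
  ultimately show ?thesis by simp
qed

text \<open>Partial derivatives lower both the degree and the order at \<open>p\<close> by one, and
  Euler's formula recovers the form from them; a constant vanishing at \<open>p\<close> is
  0.\<close>

lemma homogeneous_eq_0_if_ordge: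
  "homogeneous k f \<Longrightarrow> ordge (Suc k) (translate p f) \<Longrightarrow> f = 0"
proof (induction k arbitrary: f)
  case 0
  then obtain c where c: "f = Cst c" using homogeneous_0D by blast
  have "ordge 1 (translate p f)" using 0 by simp
  then have "poly_eval (translate p f) 0 = 0" unfolding ordge_1_iff .
  then show ?case by (simp add: c)
next
  case (Suc k)
  have "partial_deriv i f = 0" for i
  proof (rule Suc.IH)
    show "homogeneous k (partial_deriv i f)" using homogeneous_partial_deriv[OF Suc.prems(1), of i] by simp
    show "ordge (Suc k) (translate p (partial_deriv i f))" using ordge_partial_deriv[OF Suc.prems(2), of i] by (simp add: partial_deriv_translate)
  qed
  then have "Cst (of_nat (Suc k)) * f = 0" using euler[OF Suc.prems(1)] by simp
  then show ?case by (metis Cst_eq_0_iff mult_eq_0_iff of_nat_eq_0_iff nat.distinct(2))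
qed

lemma poly_eval_homogeneous_0: "homogeneous k f \<Longrightarrow> 0 < k \<Longrightarrow> poly_eval f 0 = 0"
  using poly_eval_homogeneous[of k f 0 0] by (simp add: zero_power)

text \<open>In the applications \<open>Z\<close> consists of nonzero representatives of projective
  points; with \<open>e = d - 3\<close> the condition carries the information on the initial degree
  of the ideal.\<close>

definition avoids :: "nat \<Rightarrow> (complex ^ 4) set \<Rightarrow> bool" where
  "avoids e Z \<longleftrightarrow> (\<forall>G. homogeneous e G \<longrightarrow> (\<forall>p\<in>Z. poly_eval G p = 0) \<longrightarrow> G = 0)"

text \<open>A list of linear forms, because repeated planes are excluded only later.\<close>

definition splits :: "4 cpoly \<Rightarrow> bool" where
  "splits F \<longleftrightarrow> (\<exists>c as. F = Cst c * (\<Prod>a\<leftarrow>as. linear_form a) \<and> 0 \<notin> set as)"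

text \<open>
  With respect to a basis consisting of four points of \<open>Z\<close>, the quartic \<open>F\<close> has degree at most one
  in each coordinate, hence is a multiple of the product of the coordinates.
\<close>

lemma splits_base:
  assumes F: "homogeneous 4 F" and ord: "\<And>p. p \<in> Z \<Longrightarrow> ordge 3 (translate p F)" and av: "avoids 1 Z"
  shows "splits F"
proof -
  have "vec.span Z = UNIV"
  proof (rule ccontr)
    assume "vec.span Z \<noteq> UNIV"
    then obtain a where "a \<noteq> 0" "\<And>x. x \<in> Z \<Longrightarrow> poly_eval (linear_form a) x = 0" using ex_linear_form_vanishing by blast
    then show False using av homogeneous_linear_form[of a] by (auto simp: avoids_def)
  qed
  moreover obtain B where B: "B \<subseteq> Z" "vec.independent B" "Z \<subseteq> vec.span B"
    using vec.maximal_independent_subset by blast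
  ultimately have spB: "vec.span B = UNIV" by (metis vec.span_eq vec.span_superset subset_trans top.extremum_uniqueI vec.span_mono vec.span_span)
  have "card B = vec.dim (UNIV :: (complex ^ 4) set)"
    using B(2) spB vec.basis_card_eq_dim[of B UNIV] by simp
  then have cB: "card B = 4" unfolding vec_dim_card by simp
  then have fB: "finite B" using card.infinite by fastforce
  obtain bs where bs: "set bs = B" "distinct bs" using finite_distinct_list[OF fB] by blast
  then have "length bs = 4" using cB distinct_card by metis
  then obtain p q r s where pqrs: "bs = [p, q, r, s]" by (auto simp: length_Suc_conv eval_nat_numeral)
  have Beq: "B = {p, q, r, s}" and dist: "distinct [p, q, r, s]" using bs pqrs by auto
  have "\<exists>a. \<forall>b\<in>B. poly_eval (linear_form a) b = (if b = x then 1 else 0)" for x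
    using ex_linear_form_prescribed[OF B(2), of "\<lambda>b. if b = x then 1 else 0"] by metis
  then obtain a where a: "\<And>x b. b \<in> B \<Longrightarrow> poly_eval (linear_form (a x)) b = (if b = x then 1 else 0)" by metis
  \<comment> \<open>Polars with respect to \<open>x\<close> keep the order 3 at \<open>x\<close>,
    while two of them bring the degree down to at most 2.\<close>
  have dd2: "dir_deriv x (dir_deriv x G) = 0" if "homogeneous k G" "k \<le> 4" "ordge 3 (translate x G)" "k - 2 < 3" for x G k
  proof -
    have "ordge 3 (translate x (dir_deriv x (dir_deriv x G)))"
      by (rule ordge_translate_dir_deriv_same[OF homogeneous_dir_deriv[OF that(1)] ordge_translate_dir_deriv_same[OF that(1,3)]])
    moreover have "homogeneous (k - 1 - 1) (dir_deriv x (dir_deriv x G))" using that by (intro homogeneous_dir_deriv)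
    ultimately show ?thesis
      using that by (intro homogeneous_eq_0_if_ordge[of "k - 2"]) (auto elim: ordge_mono simp: numeral_2_eq_2)
  qed
  \<comment> \<open>Carries the vanishing of the second polars of \<open>F\<close> over to those of
    its mixed polars.\<close>
  have comm: "dir_deriv x (dir_deriv y G) = dir_deriv y (dir_deriv x G)" for x y and G :: "4 cpoly"
  proof -
    have pc: "partial_deriv i (partial_deriv j G) = partial_deriv j (partial_deriv i G)" for i j
      by (induction G rule: cpoly_induct) (auto simp: partial_deriv_Var)
    have "dir_deriv x (dir_deriv y G) = (\<Sum>i\<in>UNIV. \<Sum>j\<in>UNIV. Cst (x $ i) * (Cst (y $ j) * partial_deriv i (partial_deriv j G)))"
      by (simp add: dir_deriv_def sum_distrib_left)
    also have "\<dots> = (\<Sum>j\<in>UNIV. \<Sum>i\<in>UNIV. Cst (y $ j) * (Cst (x $ i) * partial_deriv j (partial_deriv i G)))"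
      by (subst sum.swap) (simp add: pc mult.left_commute)
    also have "\<dots> = dir_deriv y (dir_deriv x G)" by (simp add: dir_deriv_def sum_distrib_left)
    finally show ?thesis .
  qed
  have dd0: "dir_deriv x 0 = 0" for x :: "complex ^ 4" by (simp add: dir_deriv_def)
  have z: "dir_deriv x (dir_deriv x F) = 0" if "x \<in> B" for x
    by (rule dd2[OF F]) (use that B(1) ord in auto)
  have ax: "poly_eval G (w + c *s x) = poly_eval G w + c * poly_eval (dir_deriv x G) w"
    if "dir_deriv x (dir_deriv x G) = 0" for G w c x
    using poly_eval_shift_if_dir_deriv_dir_deriv_eq_0[OF that] .
  have pB: "p \<in> B" "q \<in> B" "r \<in> B" "s \<in> B" by (auto simp: Beq)
  note zs = z[OF pB(1)] z[OF pB(2)] z[OF pB(3)] z[OF pB(4)]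
  have zz: "dir_deriv x (dir_deriv x (dir_deriv y F)) = 0" if "dir_deriv x (dir_deriv x F) = 0" for x y
    using that comm dd0 by metis
  have zzz: "dir_deriv x (dir_deriv x (dir_deriv y (dir_deriv y' F))) = 0" if "dir_deriv x (dir_deriv x F) = 0" for x y y'
    using that comm dd0 by metis
  have zzzz: "dir_deriv x (dir_deriv x (dir_deriv y (dir_deriv y' (dir_deriv y'' F)))) = 0" if "dir_deriv x (dir_deriv x F) = 0" for x y y' y''
    using that comm dd0 by metis
  have h: "homogeneous 3 (dir_deriv x F)" "homogeneous 2 (dir_deriv x (dir_deriv y F))" "homogeneous 1 (dir_deriv x (dir_deriv y (dir_deriv u F)))" for x y u
    using homogeneous_dir_deriv[OF F] homogeneous_dir_deriv[OF homogeneous_dir_deriv[OF F]] homogeneous_dir_deriv[OF homogeneous_dir_deriv[OF homogeneous_dir_deriv[OF F]]]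
    by simp_all
  have h0: "poly_eval F 0 = 0" "poly_eval (dir_deriv x F) 0 = 0" "poly_eval (dir_deriv x (dir_deriv y F)) 0 = 0" "poly_eval (dir_deriv x (dir_deriv y (dir_deriv u F))) 0 = 0" for x y u
    using poly_eval_homogeneous_0 F h by (metis zero_less_numeral zero_less_one)+
  define c where "c = poly_eval (dir_deriv p (dir_deriv q (dir_deriv r (dir_deriv s F)))) 0"
  \<comment> \<open>The expansion proceeds one coordinate at a time and is linear in each. Of the 16
    terms at the origin, those with fewer than four polars vanish because they are forms of positive
    degree.\<close>
  have e: "poly_eval F ((((0 + x1 *s p) + x2 *s q) + x3 *s r) + x4 *s s) = c * (x1 * x2 * x3 * x4)" for x1 x2 x3 x4
    using zs by (simp only: ax zz zzz zzzz h0 c_def) (simp add: mult_ac)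
  have "F - Cst c * (\<Prod>x\<leftarrow>[a p, a q, a r, a s]. linear_form x) = 0"
  proof (rule cpoly_identity)
    fix v
    have "v \<in> vec.span B" using spB by simp
    then obtain u where u: "v = (\<Sum>b\<in>B. u b *s b)" using vec.span_finite[OF fB] by auto
    have av: "poly_eval (linear_form (a x)) v = u x" if "x \<in> B" for x
    proof -
      have "poly_eval (linear_form (a x)) v = (\<Sum>b\<in>B. if b = x then u b else 0)"
        unfolding u poly_eval_linear_form_sum by (intro sum.cong) (auto simp: poly_eval_linear_form_scale a)
      then show ?thesis using that fB by simp
    qed
    have "v = (((0 + u p *s p) + u q *s q) + u r *s r) + u s *s s"
      using dist by (simp add: u Beq add_ac)
    then have "poly_eval F v = c * (u p * u q * u r * u s)" using e by metis
    then show "poly_eval (F - Cst c * (\<Prod>x\<leftarrow>[a p, a q, a r, a s]. linear_form x)) v = 0"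
      using av pB by (simp add: mult_ac)
  qed
  moreover have "a x \<noteq> 0" if "x \<in> B" for x using a[of x x] that by (auto simp: linear_form_def)
  ultimately show ?thesis unfolding splits_def
    by (intro exI[of _ c] exI[of _ "[a p, a q, a r, a s]"]) (use pB in auto)
qed

section \<open>Surfaces with many triple points\<close>

text \<open>Multiplication by a power of a coordinate raises the degree to \<open>e\<close> and
  keeps the zeros.\<close>

lemma avoids_lower:
  assumes "avoids e Z" "homogeneous j G" "j \<le> e" "\<And>p. p \<in> Z \<Longrightarrow> poly_eval G p = 0"
  shows "G = 0"
proof -
  let ?x = "Var 1 :: 4 cpoly"
  have "homogeneous (1 * (e - j) + j) (?x ^ (e - j) * G)"
    by (intro homogeneous_mult homogeneous_power homogeneous_Var assms(2))
  then have "?x ^ (e - j) * G = 0"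
    using assms by (auto simp: avoids_def)
  moreover have "?x \<noteq> 0" by (metis poly_eval_0 poly_eval_Var one_index zero_neq_one)
  ultimately show ?thesis by simp
qed

text \<open>\<open>P\<close> is a minimal subset that still satisfies \<open>avoids e\<close>.
  Dropping a point admits a nonzero form, which cannot vanish at that point. Normalized, these forms
  are dual to evaluation at \<open>P\<close> and therefore a basis of the forms of degree
  \<open>e\<close>.\<close>

lemma avoids_dual_basis:
  assumes "finite Z" "avoids e Z"
  obtains P S where "P \<subseteq> Z" "card P = (e + 3) choose 3"
    "\<And>p. p \<in> P \<Longrightarrow> homogeneous e (S p)"
    "\<And>p q. p \<in> P \<Longrightarrow> q \<in> P \<Longrightarrow> poly_eval (S p) q = (if p = q then 1 else 0)"
proof -
  have "\<exists>P. P \<subseteq> Z \<and> avoids e P \<and> (\<forall>Q. Q \<subset> P \<longrightarrow> \<not> avoids e Q)"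
    using assms
  proof (induction Z rule: finite_psubset_induct)
    case (psubset Z)
    show ?case
    proof (cases "\<exists>Q. Q \<subset> Z \<and> avoids e Q")
      case True
      then obtain Q where "Q \<subset> Z" "avoids e Q" by blast
      with psubset.IH[of Q] show ?thesis by (meson order_trans psubset_imp_subset)
    qed (use psubset in auto)
  qed
  then obtain P where P: "P \<subseteq> Z" "avoids e P" "\<And>Q. Q \<subset> P \<Longrightarrow> \<not> avoids e Q" by blast
  have fP: "finite P" using P(1) assms(1) finite_subset by blast
  have "\<exists>s. homogeneous e s \<and> (\<forall>q\<in>P. poly_eval s q = (if p = q then 1 else 0))" if p: "p \<in> P" for p
  proof -
    have "\<not> avoids e (P - {p})" using P(3) p by blast
    then obtain G where G: "homogeneous e G" "\<forall>q\<in>P - {p}. poly_eval G q = 0" "G \<noteq> 0"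
      by (auto simp: avoids_def)
    have "poly_eval G p \<noteq> 0"
    proof
      assume "poly_eval G p = 0"
      then have "\<forall>q\<in>P. poly_eval G q = 0" using G by auto
      then show False using G P(2) by (auto simp: avoids_def)
    qed
    then show ?thesis
      using G by (intro exI[of _ "Cst (1 / poly_eval G p) * G"]) (auto intro: homogeneous_Cst_mult)
  qed
  then obtain S where S: "\<And>p. p \<in> P \<Longrightarrow> homogeneous e (S p)"
    "\<And>p q. p \<in> P \<Longrightarrow> q \<in> P \<Longrightarrow> poly_eval (S p) q = (if p = q then 1 else 0)"
    by metis
  have inj: "inj_on S P"
  proof (rule inj_onI)
    fix p q assume pq: "p \<in> P" "q \<in> P" "S p = S q"
    then have "poly_eval (S p) q = 1" using S(2)[of q q] by simp
    then show "p = q" using S(2)[of p q] pq by (auto split: if_splits)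
  qed
  have ev: "poly_eval (\<Sum>p\<in>P. Cst (c p) * S p) q = c q" if "q \<in> P" for c q
  proof -
    have "poly_eval (\<Sum>p\<in>P. Cst (c p) * S p) q = (\<Sum>p\<in>P. if p = q then c p else 0)"
      using S(2) that by (auto intro!: sum.cong)
    then show ?thesis using that fP by simp
  qed
  have "cpoly.independent (S ` P)"
  proof (rule cpoly.independent_if_scalars_zero)
    fix c x assume *: "(\<Sum>x\<in>S ` P. Cst (c x) * x) = 0" "x \<in> S ` P"
    then obtain q where q: "q \<in> P" "x = S q" by auto
    have "(\<Sum>p\<in>P. Cst (c (S p)) * S p) = 0" using *(1) inj by (simp add: sum.reindex)
    then show "c x = 0" using ev[OF q(1), of "\<lambda>p. c (S p)"] q(2) by simp
  qed (use fP in auto)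
  moreover have "forms e \<subseteq> cpoly.span (S ` P)"
  proof
    fix f assume f: "f \<in> forms e"
    define g where "g = f - (\<Sum>p\<in>P. Cst (poly_eval f p) * S p)"
    have "homogeneous e g"
      unfolding g_def using f S(1)
      by (intro homogeneous_diff homogeneous_sum homogeneous_Cst_mult) (auto simp: mem_forms_iff)
    moreover have "poly_eval g q = 0" if "q \<in> P" for q
      using ev[OF that, of "poly_eval f"] by (simp add: g_def)
    ultimately have "g = 0" using P(2) by (auto simp: avoids_def)
    then have "f = (\<Sum>p\<in>P. Cst (poly_eval f p) * S p)" by (simp add: g_def)
    also have "\<dots> \<in> cpoly.span (S ` P)"
      by (intro cpoly.span_sum cpoly.span_scale cpoly.span_base) auto
    finally show "f \<in> cpoly.span (S ` P)" .
  qed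
  moreover have "S ` P \<subseteq> forms e" using S(1) by (auto simp: mem_forms_iff)
  ultimately have "card (S ` P) = cpoly.dim (forms e)" using cpoly.basis_card_eq_dim by metis
  then have "card P = (e + 3) choose 3" using inj by (simp add: card_image dim_forms)
  then show ?thesis using that P(1) S by blast
qed

text \<open>Orders add, and a factor that does not vanish at \<open>p\<close> has order 0
  there.\<close>

lemma ordge_translate_cancel:
  assumes "poly_eval A p \<noteq> 0" "ordge r (translate p (A * B))"
  shows "ordge r (translate p B)"
proof (cases "B = 0")
  case False
  have nz: "translate p A \<noteq> 0" using assms(1) by auto
  have "poly_eval (translate p A) 0 \<noteq> 0" using assms(1) by simp
  then have "\<not> ordge 1 (translate p A)" unfolding ordge_1_iff .
  then have "vord (translate p A) = 0" using nz by (simp add: ordge_iff_vord)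
  then show ?thesis using assms(2) nz False by (simp add: ordge_iff_vord vord_mult)
qed simp

lemma poly_eval_0_if_ordge: "ordge r (translate p f) \<Longrightarrow> 0 < r \<Longrightarrow> poly_eval f p = 0"
  using ordge_1_iff[of "translate p f"] ordge_mono[of r "translate p f" 1] by simp

section \<open>Prime factors of a form without linear factors: squares, cones and polars\<close>

lemma homogeneous_0_is_unit:
  fixes A :: "4 cpoly"
  assumes "homogeneous 0 A" "A \<noteq> 0" shows "A dvd 1"
proof -
  obtain c where c: "A = Cst c" using homogeneous_0D[OF assms(1)] by blast
  then have "A * Cst (1 / c) = 1" using assms(2) by (simp flip: Cst_mult)
  then show ?thesis by (metis dvd_triv_left)
qed

lemma homogeneous_dvd:
  fixes F :: "4 cpoly"
  assumes "homogeneous d F" "F \<noteq> 0" "A dvd F"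
  obtains a where "homogeneous a A" "a \<le> d"
proof -
  obtain B where "F = A * B" using assms(3) by (rule dvdE)
  then obtain a b where "homogeneous a A" "homogeneous b B" "a + b = d"
    using homogeneous_factor[of d A B] assms by metis
  then show ?thesis using that by auto
qed

lemma nonlinear_degree:
  assumes "prime_elem A" "homogeneous a A" "\<And>v. v \<noteq> 0 \<Longrightarrow> \<not> linear_form v dvd A"
  shows "2 \<le> a"
proof (rule ccontr)
  assume "\<not> 2 \<le> a"
  then consider "a = 0" | "a = 1" by linarith
  then show False
  proof cases
    case 1
    then show False using assms homogeneous_0_is_unit by (auto simp: prime_elem_def)
  next
    case 2
    then obtain v where "A = linear_form v" using assms(2) homogeneous_1D by blast
    then show False using assms(1) assms(3)[of v] by (auto simp: prime_elem_def)
  qed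
qed

text \<open>If \<open>F = A * A * B\<close>, then at each point of \<open>Z\<close> either
  \<open>A\<close> vanishes or \<open>B\<close> has a triple point, so \<open>A\<close> times a
  polar of \<open>B\<close> vanishes on \<open>Z\<close>. Its degree
  \<open>a + (b - 1) = d - a - 1\<close> is at most \<open>d - 3\<close> because \<open>A\<close> is
  not linear.\<close>

lemma squarefree_if_no_linear_factor:
  assumes F: "homogeneous d F" "F \<noteq> 0" and d: "5 \<le> d"
    and ord: "\<And>p. p \<in> Z \<Longrightarrow> ordge 3 (translate p F)" and av: "avoids (d - 3) Z"
    and nolin: "\<And>v. v \<noteq> 0 \<Longrightarrow> \<not> linear_form v dvd F"
    and A: "prime_elem A"
  shows "\<not> A * A dvd F"
proof
  assume "A * A dvd F"
  then obtain B where B: "F = A * A * B" by (rule dvdE)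
  have nz: "A \<noteq> 0" "B \<noteq> 0" using B F by auto
  obtain a2 b where b: "homogeneous a2 (A * A)" "homogeneous b B" "a2 + b = d"
    using homogeneous_factor[of d "A * A" B] F B by metis
  obtain a a' where a: "homogeneous a A" "homogeneous a' A" "a + a' = a2"
    using homogeneous_factor[of a2 A A] b nz by (metis mult_eq_0_iff)
  then have "a' = a" using homogeneous_unique nz by blast
  then have ab: "2 * a + b = d" using a b by simp
  have a2: "2 \<le> a"
    by (rule nonlinear_degree[OF A a(1)]) (metis B nolin dvd_mult2)
  have dich: "poly_eval A p = 0 \<or> ordge 3 (translate p B)" if "p \<in> Z" for p
    using ordge_translate_cancel[of "A * A" p 3 B] ord[OF that] B by auto
  show False
  proof (cases "b = 0")
    case True
    then obtain c where c: "B = Cst c" using b(2) homogeneous_0D by blast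
    \<comment> \<open>With \<open>B\<close> constant, \<open>A\<close> itself vanishes on
      \<open>Z\<close>. Here \<open>2 * a = d\<close> and \<open>5 \<le> d\<close> force
      \<open>3 \<le> a\<close>, hence \<open>a \<le> d - 3\<close>.\<close>
    have "poly_eval A p = 0" if "p \<in> Z" for p
      using dich[OF that] nz c poly_eval_0_if_ordge[of 3 p B] by auto
    then have "A = 0" by (intro avoids_lower[OF av a(1)]) (use ab True d in auto)
    then show False using nz by simp
  next
    case False
    then obtain v where v: "dir_deriv v B \<noteq> 0" using ex_dir_deriv_nonzero[OF b(2)] nz by blast
    have "homogeneous (a + (b - 1)) (A * dir_deriv v B)"
      by (intro homogeneous_mult homogeneous_dir_deriv a b)
    then have "A * dir_deriv v B = 0"
    proof (rule avoids_lower[OF av])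
      show "a + (b - 1) \<le> d - 3" using ab a2 False by linarith
      fix p assume "p \<in> Z"
      then show "poly_eval (A * dir_deriv v B) p = 0"
        using dich[of p] ordge_translate_dir_deriv[of 3 p B v] poly_eval_0_if_ordge[of 2 p "dir_deriv v B"] by auto
    qed
    then show False using nz v by simp
  qed
qed

text \<open>Two vertices leave a form in only two coordinates, and a binary form of positive degree
  over the complex numbers has a linear factor.\<close>

lemma linear_form_dvd_if_two_vertices:
  assumes A: "homogeneous a A" "0 < a" and pq: "dir_deriv p A = 0" "dir_deriv q A = 0"
    and ind: "vec.independent {p, q}" "p \<noteq> q"
  obtains v where "v \<noteq> 0" "linear_form v dvd A"
proof -
  obtain B where B: "{p, q} \<subseteq> B" "vec.independent B" "UNIV \<subseteq> vec.span B"
    using vec.maximal_independent_subset_extend[of "{p, q}" UNIV] ind by auto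
  have "card B = vec.dim (UNIV :: (complex ^ 4) set)"
    using B vec.basis_card_eq_dim[of B UNIV] by simp
  then have cB: "card B = 4" unfolding vec_dim_card by simp
  then have fB: "finite B" using card.infinite by fastforce
  have "card (B - {p, q}) = 2" using cB B(1) ind(2) fB by (simp add: card_Diff_subset)
  then obtain r s where rs: "B - {p, q} = {r, s}" "r \<noteq> s" by (auto simp: card_2_iff)
  then have Beq: "B = {p, q, r, s}" and dist: "r \<notin> {p, q}" "s \<notin> {p, q}" using B(1) by auto
  have root: "\<exists>t. poly_eval A (x + t *s y) = 0" if "\<And>c. \<not> (\<forall>t. poly_eval A (x + t *s y) = c)" for x y
  proof (rule ccontr)
    assume *: "\<nexists>t. poly_eval A (x + t *s y) = 0"
    have "\<exists>c. line_poly x y A = [:c:]"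
    proof (rule ccontr)
      assume "\<nexists>c. line_poly x y A = [:c:]"
      then have "\<not> constant (poly (line_poly x y A))"
        by (metis constant_degree degree_eq_zeroE)
      then obtain t where "poly (line_poly x y A) t = 0" using fundamental_theorem_of_algebra by blast
      then show False using * by (simp add: poly_line_poly)
    qed
    then obtain c where "line_poly x y A = [:c:]" by blast
    then have "poly_eval A (x + t *s y) = c" for t by (metis poly_line_poly poly_const_conv)
    then show False using that by blast
  qed
  \<comment> \<open>A zero on one of the two affine charts of the line through \<open>r\<close> and
    \<open>s\<close>. Otherwise \<open>A\<close> is constant on both; comparing the charts at two
    points gives \<open>c' = 2 ^ a * c\<close> and \<open>c' = c\<close>, so
    \<open>c = 0\<close>.\<close>
  have "\<exists>t. poly_eval A (r + t *s s) = 0 \<or> poly_eval A (s + t *s r) = 0"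
  proof (rule ccontr)
    assume *: "\<not> ?thesis"
    then obtain c c' where c: "\<And>t. poly_eval A (r + t *s s) = c" "\<And>t. poly_eval A (s + t *s r) = c'"
      using root[of r s] root[of s r] by metis
    have "c' = 2 ^ a * c"
    proof -
      have "s + 2 *s r = 2 *s (r + (1/2) *s s)" by (simp add: vec_eq_iff)
      then show ?thesis using poly_eval_homogeneous[OF A(1), of 2 "r + (1/2) *s s"] c by metis
    qed
    moreover have "c' = c"
    proof -
      have "s + 1 *s r = r + 1 *s s" by (simp add: add.commute)
      then show ?thesis using c by metis
    qed
    ultimately have "(2 ^ a - 1) * c = 0" by (simp add: algebra_simps)
    moreover have "(2::complex) ^ a \<noteq> 1"
    proof
      assume "(2::complex) ^ a = 1"
      then have "norm ((2::complex) ^ a) = 1" by simp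
      then have "(2::real) ^ a = 1" by (simp add: norm_power)
      then show False using A(2) by (metis one_less_power less_irrefl one_less_numeral_iff semiring_norm(76))
    qed
    ultimately have "c = 0" by simp
    then show False using * c by blast
  qed
  then obtain x t where x: "poly_eval A x = 0" "x = r + t *s s \<or> x = s + t *s r" by blast
  \<comment> \<open>The values on the basis of a functional that vanishes at \<open>p\<close>, at
    \<open>q\<close> and at the zero \<open>x\<close>.\<close>
  define w where "w b = (if x = r + t *s s then (if b = r then - t else if b = s then 1 else 0)
      else (if b = s then - t else if b = r then 1 else 0))" for b
  obtain v where v: "\<And>b. b \<in> B \<Longrightarrow> poly_eval (linear_form v) b = w b" using ex_linear_form_prescribed[OF B(2)] by blast
  have "v \<noteq> 0"
  proof
    assume "v = 0"
    then have "w b = 0" if "b \<in> B" for b using v[OF that] by (simp add: linear_form_def)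
    from this[of r] this[of s] show False using rs(2) by (auto simp: w_def Beq split: if_splits)
  qed
  moreover have "linear_form v dvd A"
  proof (rule linear_form_dvd_if_vanishes[OF \<open>v \<noteq> 0\<close>])
    fix y assume y: "poly_eval (linear_form v) y = 0"
    have "y \<in> vec.span B" using B(3) by auto
    then obtain u where u: "y = (\<Sum>b\<in>B. u b *s b)" using vec.span_finite[OF fB] by auto
    have y4: "y = u r *s r + u s *s s + u p *s p + u q *s q"
    proof -
      have "p \<noteq> r" "q \<noteq> r" "p \<noteq> s" "q \<noteq> s" using dist by auto
      then show ?thesis using rs(2) ind(2) by (simp add: u Beq add_ac)
    qed
    have "u r * w r + u s * w s + u p * w p + u q * w q = 0"
      using y v Beq unfolding y4 poly_eval_linear_form_add poly_eval_linear_form_scale by simp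
    moreover have "w p = 0" "w q = 0" using dist by (auto simp: w_def)
    ultimately have rel: "u r * w r + u s * w s = 0" by simp
    have "\<exists>k. u r *s r + u s *s s = k *s x"
    proof (cases "x = r + t *s s")
      case True
      then have "u s = u r * t" using rel rs(2) by (simp add: w_def)
      then show ?thesis using True by (intro exI[of _ "u r"]) (simp add: vec_eq_iff algebra_simps)
    next
      case False
      then have "u r = u s * t" "x = s + t *s r" using rel rs(2) x by (simp_all add: w_def)
      then show ?thesis by (intro exI[of _ "u s"]) (simp add: vec_eq_iff algebra_simps)
    qed
    then obtain k where k: "u r *s r + u s *s s = k *s x" by blast
    have "poly_eval A y = poly_eval A (k *s x)"
      unfolding y4 k poly_eval_shift_if_dir_deriv_eq_0[OF pq(1)] poly_eval_shift_if_dir_deriv_eq_0[OF pq(2)] ..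
    then show "poly_eval A y = 0" using x(1) by (simp add: poly_eval_homogeneous[OF A(1)])
  qed
  ultimately show ?thesis by (rule that)
qed

lemma prime_elem_dvd_prodD:
  fixes A :: "4 cpoly"
  assumes "prime_elem A" "finite Q" "A dvd (\<Prod>q\<in>Q. f q)" shows "\<exists>q\<in>Q. A dvd f q"
  using assms(2,3)
proof (induction Q)
  case empty
  then show ?case using assms(1) by (simp add: prime_elem_def)
next
  case (insert q Q)
  then show ?case using assms(1) by (auto simp: prime_elem_def)
qed

lemma prod_primes_dvd:
  fixes A :: "'b \<Rightarrow> 4 cpoly"
  assumes "finite P" "\<And>p. p \<in> P \<Longrightarrow> prime_elem (A p)" "\<And>p. p \<in> P \<Longrightarrow> A p dvd F"
    "\<And>p q. p \<in> P \<Longrightarrow> q \<in> P \<Longrightarrow> p \<noteq> q \<Longrightarrow> \<not> A p dvd A q"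
  shows "(\<Prod>p\<in>P. A p) dvd F"
  using assms
proof (induction P)
  case (insert p Q)
  then have "(\<Prod>q\<in>Q. A q) dvd F" by auto
  then obtain h where h: "F = (\<Prod>q\<in>Q. A q) * h" by (rule dvdE)
  have "\<not> A p dvd (\<Prod>q\<in>Q. A q)"
  proof
    assume "A p dvd (\<Prod>q\<in>Q. A q)"
    then obtain q where "q \<in> Q" "A p dvd A q"
      using prime_elem_dvd_prodD[of "A p" Q A] insert by auto
    then show False using insert by auto
  qed
  moreover have "A p dvd (\<Prod>q\<in>Q. A q) * h" using insert.prems(2)[of p] h by simp
  ultimately have "A p dvd h" using insert.prems(1)[of p] by (auto simp: prime_elem_def)
  then have "(\<Prod>q\<in>Q. A q) * A p dvd F" unfolding h by (rule mult_dvd_mono[OF dvd_refl])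
  then show ?case using insert by (simp add: mult.commute)
qed simp

text \<open>By the Leibniz rule \<open>A\<close> divides its cofactor times its own polar. It does
  not divide the cofactor, so it divides its polar, which is 0 for reasons of degree.\<close>

lemma cone_prime_factor:
  fixes F A :: "4 cpoly"
  assumes F: "homogeneous d F" "F \<noteq> 0"
    and A: "prime_elem A" "A dvd F" "A dvd dir_deriv p F" "\<not> A * A dvd F"
  shows "dir_deriv p A = 0"
proof -
  obtain B where B: "F = A * B" using A(2) by (rule dvdE)
  obtain a where a: "homogeneous a A" using homogeneous_dvd[OF F A(2)] by blast
  have nA: "A \<noteq> 0" using A(1) by (simp add: prime_elem_def)
  have "A dvd A * dir_deriv p B + B * dir_deriv p A" using A(3) by (simp add: B dir_deriv_mult)
  then have "A dvd B * dir_deriv p A" by (metis dvd_add_right_iff dvd_triv_left)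
  moreover have "\<not> A dvd B" using A(4) B by (auto intro: mult_dvd_mono)
  ultimately have "A dvd dir_deriv p A" using A(1) by (auto simp: prime_elem_def)
  show ?thesis
  proof (rule ccontr)
    assume nz: "dir_deriv p A \<noteq> 0"
    have "homogeneous (a - 1) (dir_deriv p A)" by (rule homogeneous_dir_deriv[OF a])
    then obtain a' where "homogeneous a' A" "a' \<le> a - 1"
      using homogeneous_dvd[OF _ nz \<open>A dvd dir_deriv p A\<close>] by blast
    then have "a = 0" using homogeneous_unique[OF nA a] by fastforce
    then show False using homogeneous_0_is_unit[of A] a nA A(1) by (auto simp: prime_elem_def)
  qed
qed

lemma ex_linear_factor:
  assumes Z: "finite Z" "0 \<notin> Z" and F: "homogeneous d F" "F \<noteq> 0" and d: "5 \<le> d"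
    and ord: "\<And>p. p \<in> Z \<Longrightarrow> ordge 3 (translate p F)" and av: "avoids (d - 3) Z"
  shows "\<exists>v. v \<noteq> 0 \<and> linear_form v dvd F"
proof (rule ccontr)
  assume "\<not> ?thesis"
  then have nolin: "\<And>v. v \<noteq> 0 \<Longrightarrow> \<not> linear_form v dvd F" by blast
  have sqf: "\<not> A * A dvd F" if "prime_elem A" for A
    by (rule squarefree_if_no_linear_factor[OF F d ord av nolin that])
  obtain P S where P: "P \<subseteq> Z" "card P = (d - 3 + 3) choose 3"
    and S: "\<And>p. p \<in> P \<Longrightarrow> homogeneous (d - 3) (S p)"
    "\<And>p q. p \<in> P \<Longrightarrow> q \<in> P \<Longrightarrow> poly_eval (S p) q = (if p = q then 1 else 0)"
    using avoids_dual_basis[OF Z(1) av] by blast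
  have fP: "finite P" using P(1) Z(1) finite_subset by blast
  have cP: "6 * card P = d * (d - 1) * (d - 2)"
  proof -
    define n where "n = d - 2"
    have n: "d = n + 2" using d by (simp add: n_def)
    have "card P = (n + 2) choose 3" using P(2) d n by simp
    then have "6 * int (card P) = int n * (int n + 1) * (int n + 2)" using six_choose_three[of n] by simp
    also have "\<dots> = int (d * (d - 1) * (d - 2))" using n by (simp add: algebra_simps)
    finally show ?thesis by linarith
  qed
  have "\<exists>A. prime_elem A \<and> A dvd F \<and> dir_deriv p A = 0" if p: "p \<in> P" for p
  proof (rule ccontr)
    assume no: "\<not> ?thesis"
    define E where "E = dir_deriv p F"
    have cop: "F dvd h" if "F dvd h * E" for h
    proof (rule cpoly_coprime_dvd_mult[OF F(2) _ that])
      fix A assume "prime_elem A" "A dvd F" "A dvd E"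
      then show False using cone_prime_factor[OF F, of A p] sqf no unfolding E_def by blast
    qed
    have "E \<noteq> 0"
    proof
      assume "E = 0"
      then have "F dvd 1" using cop[of 1] by simp
      then obtain j where "homogeneous j F" "j \<le> 0" using homogeneous_dvd[OF homogeneous_1 one_neq_zero] by blast
      then show False using homogeneous_unique[OF F(2) F(1)] d by force
    qed
    define n where "n q = (if q = p then 3 else 2 :: nat)" for q
    \<comment> \<open>The Bezout inequality with \<open>e = d - 2\<close>, as the separating forms
      \<open>S\<close> have degree \<open>d - 3\<close>.\<close>
    have "(\<Sum>q\<in>P. 3 * n q) \<le> (d - 2) * d * (d - 1)"
    proof (rule bezout_points[where F = F and E = E and S = S])
      show "homogeneous (d - 1) E" unfolding E_def by (rule homogeneous_dir_deriv[OF F(1)])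
      show "homogeneous (d - 2 - 1) (S p)" if "p \<in> P" for p using S(1)[OF that] by (simp add: numeral_3_eq_3)
      show "ordge 3 (translate q F)" if "q \<in> P" for q using ord that P(1) by blast
      then show "ordge (n q) (translate q E)" if "q \<in> P" for q
        using that ordge_translate_dir_deriv[of 3 q F p] ordge_translate_dir_deriv_same[OF F(1), of 3 p] p
        by (auto simp: n_def E_def)
      show "finite P" "F \<noteq> 0" "E \<noteq> 0" "homogeneous d F" by fact+
      show "0 \<notin> P" using Z(2) P(1) by blast
      show "0 < d - 2" using d by simp
      show "poly_eval (S p) q = (if p = q then 1 else 0)" if "p \<in> P" "q \<in> P" for p q
        using that by (rule S(2))
      show "F dvd h" if "F dvd h * E" for h using that by (rule cop)
    qed
    moreover have "(\<Sum>q\<in>P. 3 * n q) = 6 * card P + 3"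
    proof -
      have "(\<Sum>q\<in>P. 3 * n q) = (\<Sum>q\<in>P. 6 + (if q = p then 3 else 0))"
        by (intro sum.cong) (auto simp: n_def)
      then show ?thesis using p fP by (simp add: sum.distrib)
    qed
    ultimately show False using cP by (simp add: mult_ac)
  qed
  then obtain A where A: "\<And>p. p \<in> P \<Longrightarrow> prime_elem (A p)" "\<And>p. p \<in> P \<Longrightarrow> A p dvd F"
      "\<And>p. p \<in> P \<Longrightarrow> dir_deriv p (A p) = 0" by metis
  have "\<exists>k. homogeneous k (A p)" if "p \<in> P" for p
    using homogeneous_dvd[OF F A(2)[OF that]] by blast
  then obtain deg where deg: "\<And>p. p \<in> P \<Longrightarrow> homogeneous (deg p) (A p)" by metis
  have deg2: "2 \<le> deg p" if "p \<in> P" for p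
    by (rule nonlinear_degree[OF A(1)[OF that] deg[OF that]]) (metis A(2) nolin that dvd_trans)
  \<comment> \<open>Divisibility between two of these primes makes them associated, so
    \<open>A p\<close> would also be a cone with vertex \<open>q\<close> and contain a
    plane.\<close>
  have nd: "\<not> A p dvd A q" if pq: "p \<in> P" "q \<in> P" "p \<noteq> q" for p q
  proof
    assume "A p dvd A q"
    then obtain h where h: "A q = A p * h" by (rule dvdE)
    have "A q dvd A p * h" using h by simp
    then consider "A q dvd A p" | "A q dvd h" using A(1)[OF pq(2)] by (auto simp: prime_elem_def)
    then have "dir_deriv q (A p) = 0"
    proof cases
      case 1
      then obtain g where g: "A p = A q * g" by (rule dvdE)
      have nz: "A p \<noteq> 0" using A(1)[OF pq(1)] by (simp add: prime_elem_def)
      have "A p = (A p * h) * g" using g unfolding h .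
      then have "A p * 1 = A p * (h * g)" by (metis mult.assoc mult_1_right)
      then have "h * g = 1" using nz by (metis mult_cancel_left)
      then have "homogeneous 0 (g * h)" "g * h \<noteq> 0" by (simp_all add: mult.commute)
      then obtain i j where "homogeneous i g" "i + j = 0" using homogeneous_factor[of 0 g h] by metis
      then obtain c where "g = Cst c" using homogeneous_0D[of g] by auto
      then show ?thesis using g A(3)[OF pq(2)] by (simp add: dir_deriv_mult) (simp add: dir_deriv_def)
    next
      case 2
      then obtain g where g: "h = A q * g" by (rule dvdE)
      have nz: "A q \<noteq> 0" using A(1)[OF pq(2)] by (simp add: prime_elem_def)
      have "A q = A p * (A q * g)" using h unfolding g .
      then have "A q * 1 = A q * (A p * g)" by (metis mult.left_commute mult_1_right)
      then have "1 = A p * g" using nz by (metis mult_cancel_left)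
      then have "A p dvd 1" by (rule dvdI)
      then show ?thesis using A(1)[OF pq(1)] by (simp add: prime_elem_def)
    qed
    \<comment> \<open>If \<open>p\<close> were a multiple of \<open>q\<close>, then
      \<open>S p\<close>, which vanishes at \<open>q\<close>, would vanish at
      \<open>p\<close>.\<close>
    moreover have "vec.independent {p, q}"
    proof -
      have "p \<notin> vec.span {q}"
      proof
        assume "p \<in> vec.span {q}"
        then obtain k where k: "p = k *s q" by (auto simp: vec.span_singleton)
        have "k ^ (d - 3) * poly_eval (S p) q = 1"
          using poly_eval_homogeneous[OF S(1)[OF pq(1)], of k q] S(2)[of p p] pq k by simp
        then show False using S(2)[of p q] pq by simp
      qed
      moreover have "q \<noteq> 0" using pq P(1) Z(2) by auto
      ultimately show ?thesis by (simp add: vec.independent_insertI)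
    qed
    moreover have "0 < deg p" using deg2[OF pq(1)] by simp
    ultimately obtain v where "v \<noteq> 0" "linear_form v dvd A p"
      using linear_form_dvd_if_two_vertices[OF deg[OF pq(1)] _ A(3)[OF pq(1)] _ _ pq(3)] by blast
    then show False using nolin A(2)[OF pq(1)] by (meson dvd_trans)
  qed
  have "(\<Prod>p\<in>P. A p) dvd F"
    by (rule prod_primes_dvd[OF fP A(1,2) nd])
  then obtain k where k: "homogeneous k (\<Prod>p\<in>P. A p)" "k \<le> d" using homogeneous_dvd[OF F] by blast
  have "homogeneous (\<Sum>p\<in>P. deg p) (\<Prod>p\<in>P. A p)" by (intro homogeneous_prod deg)
  moreover have "(\<Prod>p\<in>P. A p) \<noteq> 0" using fP A(1) by (auto simp: prime_elem_def)
  ultimately have "(\<Sum>p\<in>P. deg p) \<le> d" using k homogeneous_unique by blast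
  moreover have "(\<Sum>p\<in>P. 1) \<le> (\<Sum>p\<in>P. deg p)" using deg2 by (intro sum_mono) force
  ultimately have "card P \<le> d" by simp
  \<comment> \<open>\<open>card P\<close> nonassociated prime factors of \<open>F\<close> force
    \<open>card P \<le> d\<close>, whereas \<open>6 * card P = d * (d - 1) * (d - 2)\<close> exceeds
    \<open>6 * d\<close> from \<open>d = 5\<close> on.\<close>
  then have le: "d * ((d - 1) * (d - 2)) \<le> d * 6"
    using cP unfolding mult.assoc by linarith
  have "4 * 3 \<le> (d - 1) * (d - 2)" using d by (intro mult_le_mono) auto
  then show False using le d by simp
qed

lemma homogeneous_splits:
  assumes "4 \<le> d" "finite Z" "0 \<notin> Z" "homogeneous d F" "F \<noteq> 0"
    "\<And>p. p \<in> Z \<Longrightarrow> ordge 3 (translate p F)" "avoids (d - 3) Z"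
  shows "splits F"
  using assms
proof (induction d arbitrary: F Z rule: nat_induct_at_least)
  case base
  then show ?case using splits_base[of F Z] by simp
next
  case (Suc n)
  obtain v where v: "v \<noteq> 0" "linear_form v dvd F"
    using ex_linear_factor[OF Suc.prems(1-4) _ Suc.prems(5,6)] Suc.hyps by auto
  then obtain B where B: "F = linear_form v * B" using dvdE by blast
  have nB: "B \<noteq> 0" using B Suc.prems by auto
  have hB: "homogeneous n B"
    using homogeneous_cofactor[of "Suc n" "linear_form v" B 1] homogeneous_linear_form[of v] B Suc.prems by simp
  define Y where "Y = {p\<in>Z. poly_eval (linear_form v) p \<noteq> 0}"
  have "splits B"
  proof (rule Suc.IH)
    show "finite Y" "0 \<notin> Y" using Suc.prems by (auto simp: Y_def)
    show "ordge 3 (translate p B)" if "p \<in> Y" for p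
      using that ordge_translate_cancel[of "linear_form v" p 3 B] Suc.prems B by (auto simp: Y_def)
    show "avoids (n - 3) Y"
      unfolding avoids_def
    proof (intro allI impI)
      fix G assume G: "homogeneous (n - 3) G" "\<forall>p\<in>Y. poly_eval G p = 0"
      have "homogeneous (1 + (n - 3)) (linear_form v * G)" by (intro homogeneous_mult homogeneous_linear_form G)
      moreover have "1 + (n - 3) = Suc n - 3" using Suc.hyps by simp
      ultimately have "homogeneous (Suc n - 3) (linear_form v * G)" by (simp only:)
      moreover have "\<forall>p\<in>Z. poly_eval (linear_form v * G) p = 0" using G(2) by (auto simp: Y_def)
      ultimately have "linear_form v * G = 0" using Suc.prems(6) unfolding avoids_def by blast
      then show "G = 0" using v by simp
    qed
  qed (use hB nB in auto)
  then obtain c as where "B = Cst c * (\<Prod>a\<leftarrow>as. linear_form a)" "0 \<notin> set as" by (auto simp: splits_def)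
  then show ?case
    unfolding splits_def B
    by (intro exI[of _ c] exI[of _ "v # as"]) (use v in \<open>auto simp: mult_ac\<close>)
qed

section \<open>Star configurations\<close>

lemma linear_form_kernel_mem_proj_planes:
  assumes "a \<noteq> 0" shows "{x. poly_eval (linear_form a) x = 0} \<in> proj_planes"
proof -
  let ?H = "{x. poly_eval (linear_form a) x = 0}"
  have ss: "vec.subspace ?H"
    by (auto simp: vec.subspace_def poly_eval_linear_form_add poly_eval_linear_form_scale) (simp add: poly_eval_linear_form)
  obtain i where i: "a $ i \<noteq> 0" using assms by (auto simp: vec_eq_iff)
  define y where "y = (1 / a $ i) *s axis i 1"
  have y: "poly_eval (linear_form a) y = 1" using i by (simp add: y_def poly_eval_linear_form_scale poly_eval_linear_form_axis)
  then have "y \<notin> vec.span ?H" using ss by (simp add: vec.span_eq_iff[THEN iffD2])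
  then have "vec.dim (insert y ?H) = vec.dim ?H + 1" by (simp add: vec.dim_insert)
  moreover have "UNIV \<subseteq> vec.span (insert y ?H)"
  proof
    fix x
    define h where "h = x + (- poly_eval (linear_form a) x) *s y"
    have "h \<in> ?H" by (simp only: h_def mem_Collect_eq poly_eval_linear_form_add poly_eval_linear_form_scale y) simp
    moreover have "x = h + poly_eval (linear_form a) x *s y" by (simp add: h_def vec_eq_iff)
    ultimately show "x \<in> vec.span (insert y ?H)"
      by (metis insertCI vec.span_add vec.span_base vec.span_scale)
  qed
  then have "vec.span (insert y ?H) = UNIV" by blast
  then have "vec.dim (insert y ?H) = vec.dim (UNIV :: (complex ^ 4) set)"
    by (metis vec.dim_span)
  then have "vec.dim (insert y ?H) = 4" unfolding vec_dim_card by simp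
  ultimately show ?thesis using ss by (simp add: proj_planes_def)
qed

lemma proj_point_nonzero:
  assumes "p \<in> proj_points" obtains x where "x \<in> p" "x \<noteq> 0"
proof -
  have "vec.dim p = 1" using assms by (simp add: proj_points_def)
  then have "\<not> p \<subseteq> {0}" using vec.dim_eq_0[of p] by simp
  then show ?thesis using that by blast
qed

lemma proj_point_eq_range:
  assumes "p \<in> proj_points" "x \<in> p" "x \<noteq> 0"
  shows "p = range (\<lambda>c. c *s x)"
proof -
  have p: "vec.subspace p" "vec.dim p = 1" using assms by (auto simp: proj_points_def)
  have "vec.independent {x}" using assms(3) by simp
  then have "p \<subseteq> vec.span {x}"
    using vec.card_ge_dim_independent[of "{x}" p] p assms(2) by simp
  moreover have "vec.span {x} \<subseteq> p" using p(1) assms(2) by (intro vec.span_minimal) auto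
  ultimately show ?thesis by (auto simp: vec.span_singleton)
qed

lemma vanishes_at_iff:
  assumes "p \<in> proj_points" "x \<in> p" "x \<noteq> 0" "homogeneous k f"
  shows "vanishes_at f p \<longleftrightarrow> poly_eval f x = 0"
proof
  assume "vanishes_at f p"
  then show "poly_eval f x = 0" using assms by (auto simp: vanishes_at_def)
next
  assume "poly_eval f x = 0"
  then show "vanishes_at f p"
    unfolding vanishes_at_def proj_point_eq_range[OF assms(1-3)]
    by (auto simp: poly_eval_homogeneous[OF assms(4)])
qed

lemma star_configuration_if_splits:
  fixes Z :: "(complex ^ 4) set set"
  assumes Z: "finite Z" "Z \<subseteq> proj_points" and rep: "\<And>p. p \<in> Z \<Longrightarrow> rep p \<in> p \<and> rep p \<noteq> 0"
    and F: "homogeneous d F" "F \<noteq> 0" and d: "4 \<le> d" and spl: "splits F"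
    and ord: "\<And>p. p \<in> Z \<Longrightarrow> ordge 3 (translate (rep p) F)" and av: "avoids (d - 3) (rep ` Z)"
  shows "\<exists>\<H>. star_configuration Z d \<H> \<and> surface F = {p\<in>proj_points. \<exists>H\<in>\<H>. p \<subseteq> H}"
proof -
  obtain c as where cas: "F = Cst c * (\<Prod>a\<leftarrow>as. linear_form a)" "0 \<notin> set as"
    using spl by (auto simp: splits_def)
  define L where "L i = linear_form (as ! i)" for i
  have F_eq: "F = Cst c * (\<Prod>i<length as. L i)"
    unfolding cas(1) prod.list_conv_set_nth by (simp add: L_def atLeast0LessThan)
  have hprod: "homogeneous (card T) (\<Prod>i\<in>T. L i)" for T
    using homogeneous_prod[of T "\<lambda>_. 1" L] homogeneous_linear_form by (simp add: L_def)
  have Lnz: "(\<Prod>i\<in>T. L i) \<noteq> 0" if "T \<subseteq> {..<length as}" for T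
  proof -
    have "L i \<noteq> 0" if "i \<in> T" for i
    proof -
      have "i < length as" using \<open>T \<subseteq> _\<close> that by auto
      then have "as ! i \<in> set as" by simp
      then show ?thesis using cas(2) by (auto simp: L_def)
    qed
    moreover have "finite T" using that finite_subset by blast
    ultimately show ?thesis by simp
  qed
  have c0: "c \<noteq> 0" using F(2) F_eq by auto
  have "homogeneous (length as) F"
    unfolding F_eq using hprod[of "{..<length as}"] by (intro homogeneous_Cst_mult) simp
  then have len: "length as = d" using F homogeneous_unique by blast
  define N where "N x = {i. i < d \<and> poly_eval (L i) x = 0}" for x
  have finN: "finite (N x)" for x by (simp add: N_def)
  \<comment> \<open>The order 3 comes from the linear forms that vanish at the point. Their product
    has degree \<open>card (N (rep p))\<close>, and the order of a nonzero form is at most its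
    degree.\<close>
  have N3: "3 \<le> card (N (rep p))" if "p \<in> Z" for p
  proof (rule ccontr)
    assume less: "\<not> ?thesis"
    let ?N = "N (rep p)"
    have sub: "?N \<subseteq> {..<d}" by (auto simp: N_def)
    have "(\<Prod>i<d. L i) = (\<Prod>i\<in>{..<d} - ?N. L i) * (\<Prod>i\<in>?N. L i)"
      using sub by (metis finite_lessThan prod.subset_diff)
    then have "F = (Cst c * (\<Prod>i\<in>{..<d} - ?N. L i)) * (\<Prod>i\<in>?N. L i)"
      unfolding F_eq len by (simp add: mult.assoc)
    moreover have "poly_eval (Cst c * (\<Prod>i\<in>{..<d} - ?N. L i)) (rep p) \<noteq> 0"
      using c0 by (auto simp: N_def)
    ultimately have "ordge 3 (translate (rep p) (\<Prod>i\<in>?N. L i))"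
      using ordge_translate_cancel ord[OF that] by metis
    then have "ordge (Suc (card ?N)) (translate (rep p) (\<Prod>i\<in>?N. L i))"
      by (rule ordge_mono) (use less in simp)
    then have "(\<Prod>i\<in>?N. L i) = 0" by (rule homogeneous_eq_0_if_ordge[OF hprod])
    then show False using Lnz[of ?N] sub len by simp
  qed
  \<comment> \<open>The product of the other \<open>d - 3\<close> linear forms cannot vanish on all
    of \<open>Z\<close>. A point where it is nonzero lies on no plane outside \<open>T\<close>,
    hence by \<open>N3\<close> on exactly those in \<open>T\<close>.\<close>
  have pt: "\<exists>p\<in>Z. N (rep p) = T" if T: "T \<subseteq> {..<d}" "card T = 3" for T
  proof (rule ccontr)
    assume *: "\<not> ?thesis"
    have fT: "finite T" using T(1) finite_subset by blast
    have "card ({..<d} - T) = d - 3" using T fT by (simp add: card_Diff_subset)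
    then have "homogeneous (d - 3) (\<Prod>i\<in>{..<d} - T. L i)" using hprod[of "{..<d} - T"] by simp
    moreover have "(\<Prod>i\<in>{..<d} - T. L i) \<noteq> 0" using Lnz[of "{..<d} - T"] len by auto
    ultimately obtain p where p: "p \<in> Z" "poly_eval (\<Prod>i\<in>{..<d} - T. L i) (rep p) \<noteq> 0"
      using av unfolding avoids_def by blast
    then have "N (rep p) \<subseteq> T" by (auto simp: N_def)
    then have "N (rep p) = T" using N3[OF p(1)] T fT by (metis card_seteq)
    then show False using * p(1) by blast
  qed
  then obtain pt where pt: "\<And>T. T \<subseteq> {..<d} \<Longrightarrow> card T = 3 \<Longrightarrow> pt T \<in> Z \<and> N (rep (pt T)) = T" by metis
  have lineq: "poly_eval (L i) (x + y) = poly_eval (L i) x + poly_eval (L i) y"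
      "poly_eval (L i) (k *s x) = k * poly_eval (L i) x" for i x y k
    by (simp_all add: L_def poly_eval_linear_form_add poly_eval_linear_form_scale)
  \<comment> \<open>The points of \<open>Z\<close> belonging to the four triples in \<open>Q\<close>
    form a basis that is dual, up to scalars, to the four linear forms; so these have only the zero
    vector in common.\<close>
  have gen: "x = 0" if Q: "Q \<subseteq> {..<d}" "card Q = 4" "\<And>i. i \<in> Q \<Longrightarrow> poly_eval (L i) x = 0" for Q x
  proof -
    have fQ: "finite Q" using Q(1) finite_subset by blast
    define v where "v i = rep (pt (Q - {i}))" for i
    have Nv: "N (v i) = Q - {i}" if "i \<in> Q" for i
      using pt[of "Q - {i}"] Q that fQ by (auto simp: v_def)
    have Lv: "poly_eval (L j) (v i) = 0 \<longleftrightarrow> j \<noteq> i" if "i \<in> Q" "j \<in> Q" for i j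
      using Nv[OF that(1)] that Q(1) by (auto simp: N_def)
    have inj: "inj_on v Q"
    proof (rule inj_onI)
      fix i j assume "i \<in> Q" "j \<in> Q" "v i = v j"
      then show "i = j" using Lv[of i i] Lv[of j i] by auto
    qed
    have ev: "poly_eval (L j) (\<Sum>i\<in>Q. u i *s v i) = u j * poly_eval (L j) (v j)" if "j \<in> Q" for u j
    proof -
      have "poly_eval (L j) (\<Sum>i\<in>Q. u i *s v i) = (\<Sum>i\<in>Q. if i = j then u j * poly_eval (L j) (v j) else 0)"
        unfolding L_def poly_eval_linear_form_sum using Lv that
        by (intro sum.cong) (auto simp: poly_eval_linear_form_scale L_def)
      then show ?thesis using that fQ by simp
    qed
    have ind: "vec.independent (v ` Q)"
    proof (rule vec.independent_if_scalars_zero)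
      fix f y assume *: "(\<Sum>y\<in>v ` Q. f y *s y) = 0" "y \<in> v ` Q"
      then obtain j where j: "j \<in> Q" "y = v j" by auto
      have "(\<Sum>i\<in>Q. f (v i) *s v i) = 0" using *(1) inj by (simp add: sum.reindex)
      then have "f (v j) * poly_eval (L j) (v j) = poly_eval (L j) 0" using ev[OF j(1), of "\<lambda>i. f (v i)"] by simp
      then show "f y = 0" using Lv[OF j(1) j(1)] j(2) lineq(2)[of j 0 0] by simp
    qed (use fQ in auto)
    have "card (v ` Q) = 4" using inj Q(2) by (simp add: card_image)
    then have "vec.dim (UNIV :: (complex ^ 4) set) \<le> card (v ` Q)" unfolding vec_dim_card by simp
    then have "UNIV \<subseteq> vec.span (v ` Q)" using ind by (intro vec.card_ge_dim_independent) auto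
    then have "x \<in> vec.span (v ` Q)" by blast
    then obtain f where "x = (\<Sum>y\<in>v ` Q. f y *s y)" using vec.span_finite[of "v ` Q"] fQ by auto
    then have x: "x = (\<Sum>i\<in>Q. f (v i) *s v i)" using inj by (simp add: sum.reindex)
    have "f (v j) = 0" if "j \<in> Q" for j
      using ev[OF that, of "\<lambda>i. f (v i)"] Q(3)[OF that] Lv[OF that that] unfolding x[symmetric] by simp
    then show "x = 0" unfolding x by (intro sum.neutral) auto
  qed
  define H where "H i = {x. poly_eval (L i) x = 0}" for i
  define \<H> where "\<H> = H ` {..<d}"
  have sub_iff: "p \<subseteq> H i \<longleftrightarrow> poly_eval (L i) x = 0" if "p \<in> proj_points" "x \<in> p" "x \<noteq> 0" for p x i
    unfolding proj_point_eq_range[OF that] H_def using lineq(2) by (force dest: subsetD[of _ _ "1 *s x"])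
  have injH: "inj_on H {..<d}"
  proof (rule inj_onI, rule ccontr)
    fix i j assume ij: "i \<in> {..<d}" "j \<in> {..<d}" "H i = H j" "i \<noteq> j"
    \<comment> \<open>As \<open>4 \<le> d\<close>, there are two further indices; the point of
      \<open>Z\<close> belonging to them and \<open>i\<close> lies on plane \<open>i\<close> but not
      on plane \<open>j\<close>.\<close>
    have "2 \<le> card ({..<d} - {i, j})" using ij d by (simp add: card_Diff_subset)
    then obtain R where R: "R \<subseteq> {..<d} - {i, j}" "card R = 2" by (metis obtain_subset_with_card_n)
    then have fR: "finite R" "i \<notin> R" by (auto dest: finite_subset)
    then have "insert i R \<subseteq> {..<d}" "card (insert i R) = 3" using R ij by auto
    then have "N (rep (pt (insert i R))) = insert i R" using pt by blast
    moreover have "j \<notin> insert i R" using R ij by auto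
    ultimately have "poly_eval (L i) (rep (pt (insert i R))) = 0" "poly_eval (L j) (rep (pt (insert i R))) \<noteq> 0"
      using ij by (auto simp: N_def)
    then show False using ij(3) by (auto simp: H_def)
  qed
  have cardH: "card \<H> = d" unfolding \<H>_def using injH by (simp add: card_image)
  have HL: "{K\<in>\<H>. p \<subseteq> K} = H ` N x" if "p \<in> proj_points" "x \<in> p" "x \<noteq> 0" for p x
    using sub_iff[OF that] by (auto simp: \<H>_def N_def)
  have "general_planes \<H>"
    unfolding general_planes_def
  proof (intro conjI ballI)
    show "finite \<H>" by (simp add: \<H>_def)
    have "as ! i \<noteq> 0" if "i < d" for i using that len cas(2) nth_mem by metis
    then show "\<H> \<subseteq> proj_planes"
      using linear_form_kernel_mem_proj_planes by (auto simp: \<H>_def H_def L_def)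
    fix p :: "(complex ^ 4) set" assume p: "p \<in> proj_points"
    then obtain x where x: "x \<in> p" "x \<noteq> 0" by (rule proj_point_nonzero)
    have "card (N x) \<le> 3"
    proof (rule ccontr)
      assume "\<not> ?thesis"
      then have "4 \<le> card (N x)" by simp
      then obtain Q where "Q \<subseteq> N x" "card Q = 4" by (metis obtain_subset_with_card_n)
      then have "x = 0" by (intro gen[of Q]) (auto simp: N_def)
      then show False using x by simp
    qed
    then show "card {K\<in>\<H>. p \<subseteq> K} \<le> 3"
      unfolding HL[OF p x] using card_image_le[OF finN, of H x] by linarith
  qed
  moreover have "Z = triple_points \<H>"
  proof (intro equalityI subsetI)
    fix p assume p: "p \<in> Z"
    then obtain T where T: "T \<subseteq> N (rep p)" "card T = 3" using N3 by (metis obtain_subset_with_card_n)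
    have pp: "p \<in> proj_points" using p Z by blast
    have "T \<subseteq> {..<d}" using T by (auto simp: N_def)
    then have "H ` T \<subseteq> \<H>" "card (H ` T) = 3"
      using T injH by (auto simp: \<H>_def card_image inj_on_subset)
    moreover have "\<forall>K\<in>H ` T. p \<subseteq> K"
      using sub_iff[OF pp, of "rep p"] rep[OF p] T by (auto simp: N_def)
    ultimately show "p \<in> triple_points \<H>" using pp by (auto simp: triple_points_def)
  next
    fix p assume "p \<in> triple_points \<H>"
    then obtain T where pp: "p \<in> proj_points" and T: "T \<subseteq> \<H>" "card T = 3" "\<forall>K\<in>T. p \<subseteq> K"
      by (auto simp: triple_points_def)
    obtain R where R: "R \<subseteq> {..<d}" "T = H ` R" using T(1) by (auto simp: \<H>_def subset_image_iff)
    then have cR: "card R = 3" using T(2) injH by (metis card_image inj_on_subset)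
    have fR: "finite R" using R(1) finite_subset by blast
    obtain x where x: "x \<in> p" "x \<noteq> 0" using pp by (rule proj_point_nonzero)
    have Lx: "poly_eval (L i) x = 0" if "i \<in> R" for i
      using T(3) R(2) sub_iff[OF pp x] that by auto
    define q where "q = pt R"
    define v where "v = rep q"
    have q: "q \<in> Z" "N v = R" using pt[OF R(1) cR] by (auto simp: q_def v_def)
    have "card ({..<d} - R) = d - 3" using R(1) cR fR by (simp add: card_Diff_subset)
    then have "{..<d} - R \<noteq> {}" using d by force
    then obtain l where l: "l < d" "l \<notin> R" by auto
    have Lv: "poly_eval (L l) v \<noteq> 0" using l q(2) by (auto simp: N_def)
    \<comment> \<open>Chosen so that a fourth linear form vanishes at \<open>x - k *s v\<close>
      together with the three of \<open>R\<close>; by \<open>gen\<close> the difference is 0, so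
      \<open>x\<close> and \<open>v\<close> represent the same point.\<close>
    define k where "k = poly_eval (L l) x / poly_eval (L l) v"
    have "x + (- k) *s v = 0"
    proof (rule gen[of "insert l R"])
      show "insert l R \<subseteq> {..<d}" "card (insert l R) = 4" using l R(1) cR fR by auto
      fix i assume "i \<in> insert l R"
      then consider "i = l" | "i \<in> R" by blast
      then show "poly_eval (L i) (x + (- k) *s v) = 0"
      proof cases
        case 1
        then show ?thesis unfolding lineq using Lv by (simp add: k_def)
      next
        case 2
        then have "poly_eval (L i) v = 0" using q(2) by (auto simp: N_def)
        then show ?thesis unfolding lineq using Lx[OF 2] by simp
      qed
    qed
    then have xk: "x = k *s v" by (simp add: vec_eq_iff)
    have qp: "q \<in> proj_points" using q Z by blast
    have v: "v \<in> q" "v \<noteq> 0" using rep[OF q(1)] by (auto simp: v_def)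
    have "x \<in> q" using xk proj_point_eq_range[OF qp v] by auto
    then have "p = q" using proj_point_eq_range[OF pp x] proj_point_eq_range[OF qp _ x(2)] by simp
    then show "p \<in> Z" using q by simp
  qed
  moreover have "surface F = {p\<in>proj_points. \<exists>K\<in>\<H>. p \<subseteq> K}"
  proof -
    have "vanishes_at F p \<longleftrightarrow> (\<exists>K\<in>\<H>. p \<subseteq> K)" if p: "p \<in> proj_points" for p
    proof -
      obtain x where x: "x \<in> p" "x \<noteq> 0" using p by (rule proj_point_nonzero)
      have "vanishes_at F p \<longleftrightarrow> poly_eval F x = 0" by (rule vanishes_at_iff[OF p x F(1)])
      also have "\<dots> \<longleftrightarrow> (\<exists>i<d. poly_eval (L i) x = 0)"
        unfolding F_eq len using c0 by auto
      also have "\<dots> \<longleftrightarrow> (\<exists>K\<in>\<H>. p \<subseteq> K)" using sub_iff[OF p x] by (auto simp: \<H>_def)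
      finally show ?thesis .
    qed
    then show ?thesis by (auto simp: surface_def)
  qed
  ultimately show ?thesis using cardH unfolding star_configuration_def by blast
qed

section \<open>Symbolic powers of ideals of points\<close>

lemma radical_ideal_vanishes:
  fixes f :: "4 cpoly"
  assumes "f \<in> radical_ideal Z" "p \<in> Z" "x \<in> p" "x \<noteq> 0"
  shows "poly_eval f x = 0"
  using assms(1) unfolding radical_ideal_def
proof (induction rule: ideal.span_induct_alt)
  case (step c g h)
  then show ?case using assms(2-4) by (auto simp: vanishes_at_def)
qed simp

lemma radical_ideal_memI:
  assumes "homogeneous k f" "\<And>p. p \<in> Z \<Longrightarrow> vanishes_at f p" shows "f \<in> radical_ideal Z"
  unfolding radical_ideal_def using assms by (intro ideal.span_base) blast

lemma ideal_power_ordge: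
  fixes a :: "4 cpoly"
  assumes "a \<in> ideal_power I k" "\<And>f. f \<in> I \<Longrightarrow> poly_eval f x = 0"
  shows "ordge k (translate x a)"
  using assms(1) unfolding ideal_power_def
proof (induction rule: ideal.span_induct_alt)
  case (step c g h)
  then obtain f where g: "g = (\<Prod>i<k. f i)" and f: "\<forall>i<k. f i \<in> I" by blast
  have "ordge 1 (translate x (f i))" if "i < k" for i
    unfolding ordge_1_iff using assms(2) f that by simp
  then have "ordge (\<Sum>i<k. 1) (\<Prod>i<k. translate x (f i))" by (intro ordge_prod) auto
  then have "ordge k (translate x g)" by (simp add: g)
  then show ?case using step by (simp add: ordge_add ordge_mult_left)
qed simp

lemma line_poly_simps [simp]: "line_poly x v 0 = 0" "line_poly x v 1 = 1"
  "line_poly x v (f + g) = line_poly x v f + line_poly x v g"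
  "line_poly x v (f * g) = line_poly x v f * line_poly x v g"
  by (simp_all add: line_poly_def)

lemma line_poly_homogeneous:
  assumes "homogeneous k f" shows "line_poly 0 v f = monom (poly_eval f v) k"
proof -
  have "poly (line_poly 0 v f) c = poly (monom (poly_eval f v) k) c" for c
    by (simp add: poly_line_poly poly_monom poly_eval_homogeneous[OF assms] mult.commute)
  then show ?thesis by (simp add: poly_eq_poly_eq_iff[symmetric] fun_eq_iff)
qed

lemma grad_component_homogeneous: "homogeneous j (coeff (grad f) j)"
  unfolding homogeneous_iff_mdeg by (auto simp: in_keys_iff lookup_coeff_grad split: if_splits)

lemma sum_grad_components: "f = (\<Sum>j\<le>degree (grad f). coeff (grad f) j)"
  using poly_altdef[of "grad f" 1] by simp

text \<open>On the line, the component of degree \<open>j\<close> contributes its value at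
  \<open>v\<close> times \<open>T ^ j\<close>, so different components cannot cancel.\<close>

lemma homogeneous_components_vanish_on_line:
  fixes f :: "4 cpoly"
  assumes "line_poly 0 v f = 0" shows "poly_eval (coeff (grad f) j) v = 0"
proof -
  have ls: "line_poly 0 v (sum F A) = (\<Sum>a\<in>A. line_poly 0 v (F a))" for F :: "nat \<Rightarrow> 4 cpoly" and A
    by (simp add: line_poly_def)
  have "line_poly 0 v f = (\<Sum>j\<le>degree (grad f). monom (poly_eval (coeff (grad f) j) v) j)"
    using arg_cong[OF sum_grad_components[of f], of "line_poly 0 v"]
    unfolding ls line_poly_homogeneous[OF grad_component_homogeneous] .
  then have "coeff (line_poly 0 v f) j = (if j \<le> degree (grad f) then poly_eval (coeff (grad f) j) v else 0)"
    by (simp add: coeff_sum)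
  then show ?thesis using assms by (cases "j \<le> degree (grad f)") (auto simp: coeff_eq_0)
qed

lemma ex_linear_form_separating:
  assumes "p \<in> proj_points" "q \<in> proj_points" "p \<noteq> q" "x \<in> p" "x \<noteq> 0" "y \<in> q" "y \<noteq> 0"
  obtains a where "poly_eval (linear_form a) x = 0" "poly_eval (linear_form a) y \<noteq> 0"
proof -
  have "y \<notin> vec.span {x}"
  proof
    assume "y \<in> vec.span {x}"
    then have "y \<in> p" using proj_point_eq_range[OF assms(1,4,5)] by (auto simp: vec.span_singleton)
    then show False using proj_point_eq_range[OF assms(1) _ assms(7)] proj_point_eq_range[OF assms(2,6,7)] assms(3) by simp
  qed
  then have ind: "vec.independent {y, x}" and "y \<noteq> x"
    using assms(5) vec.span_base by (auto simp: vec.independent_insertI)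
  obtain a where a: "\<And>b. b \<in> {y, x} \<Longrightarrow> poly_eval (linear_form a) b = (if b = y then 1 else 0)"
    using ex_linear_form_prescribed[OF ind, of "\<lambda>b. if b = y then 1 else 0"] by blast
  show ?thesis using that[of a] a[of x] a[of y] \<open>y \<noteq> x\<close> by simp
qed

text \<open>The ideal of the line over \<open>p\<close> is an associated prime. Localizing there
  gives \<open>s\<close> outside of it with \<open>s * F\<close> in the \<open>k\<close>-th power of
  the ideal, whose elements have order at least \<open>k\<close> at every nonzero vector of the
  line.\<close>

lemma symbolic_power_ordge:
  fixes F :: "4 cpoly"
  assumes Z: "finite Z" "Z \<subseteq> proj_points" and rep: "\<And>p. p \<in> Z \<Longrightarrow> rep p \<in> p \<and> rep p \<noteq> 0"
    and F: "F \<in> symbolic_power (radical_ideal Z) k" "homogeneous d F" and p: "p \<in> Z"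
  shows "ordge k (translate (rep p) F)"
proof -
  define v where "v = rep p"
  have v: "v \<in> p" "v \<noteq> 0" using rep[OF p] by (auto simp: v_def)
  have pp: "p \<in> proj_points" using p Z by blast
  define P where "P = {g. line_poly 0 v g = 0}"
  have prime: "prime_ideal P"
    unfolding prime_ideal_def
  proof (intro conjI allI impI)
    show "ideal.subspace P" by (auto simp: ideal.subspace_def P_def)
    have "1 \<notin> P" by (simp add: P_def)
    then show "P \<noteq> UNIV" by blast
    fix a b assume "a * b \<in> P"
    then show "a \<in> P \<or> b \<in> P" by (auto simp: P_def)
  qed
  have "\<exists>a. poly_eval (linear_form a) (rep q) = 0 \<and> poly_eval (linear_form a) v \<noteq> 0" if "q \<in> Z - {p}" for q
    using ex_linear_form_separating[of q p "rep q" v] that rep[of q] Z pp v by blast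
  then obtain a where a: "\<And>q. q \<in> Z - {p} \<Longrightarrow> poly_eval (linear_form (a q)) (rep q) = 0 \<and> poly_eval (linear_form (a q)) v \<noteq> 0"
    by metis
  \<comment> \<open>A form vanishing on \<open>Z\<close> except at \<open>p\<close>; the annihilator
    of its residue class modulo the radical ideal is \<open>P\<close>.\<close>
  define f where "f = (\<Prod>q\<in>Z - {p}. linear_form (a q))"
  have hf: "homogeneous (card (Z - {p})) f"
    unfolding f_def using homogeneous_prod[of "Z - {p}" "\<lambda>_. 1" "\<lambda>q. linear_form (a q)"] homogeneous_linear_form by simp
  have fv: "poly_eval f v \<noteq> 0" using a Z by (auto simp: f_def)
  have fq: "poly_eval f (rep q) = 0" if "q \<in> Z - {p}" for q
    using a[OF that] that Z by (auto simp: f_def)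
  have "P = {g. g * f \<in> radical_ideal Z}"
  proof (intro equalityI subsetI)
    fix g assume "g \<in> P"
    then have g0: "line_poly 0 v g = 0" by (simp add: P_def)
    have "coeff (grad g) j * f \<in> radical_ideal Z" for j
    proof (rule radical_ideal_memI)
      show h: "homogeneous (j + card (Z - {p})) (coeff (grad g) j * f)"
        by (intro homogeneous_mult grad_component_homogeneous hf)
      fix q assume q: "q \<in> Z"
      have "poly_eval (coeff (grad g) j * f) (rep q) = 0"
        using homogeneous_components_vanish_on_line[OF g0, of j] fq[of q] q by (cases "q = p") (auto simp: v_def)
      then show "vanishes_at (coeff (grad g) j * f) q"
        using vanishes_at_iff[of q "rep q", OF _ _ _ h] q Z rep by blast
    qed
    then have "(\<Sum>j\<le>degree (grad g). coeff (grad g) j * f) \<in> radical_ideal Z"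
      unfolding radical_ideal_def by (intro ideal.span_sum) auto
    moreover have "(\<Sum>j\<le>degree (grad g). coeff (grad g) j * f) = g * f"
      using sum_grad_components[of g] by (metis sum_distrib_right)
    ultimately show "g \<in> {g. g * f \<in> radical_ideal Z}" by simp
  next
    fix g assume "g \<in> {g. g * f \<in> radical_ideal Z}"
    then have gf: "g * f \<in> radical_ideal Z" by simp
    have "poly (line_poly 0 v (g * f)) t = 0" if "t \<noteq> 0" for t
    proof -
      have "t *s v \<in> p" "t *s v \<noteq> 0" using that v proj_point_eq_range[OF pp v] by auto
      then show ?thesis using radical_ideal_vanishes[OF gf p] by (simp add: poly_line_poly)
    qed
    then have "- {0} \<subseteq> {t. poly (line_poly 0 v (g * f)) t = 0}" by auto
    moreover have "infinite (- {0 :: complex})" by (simp add: infinite_UNIV_char_0 Compl_eq_Diff_UNIV)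
    ultimately have "line_poly 0 v (g * f) = 0" using poly_roots_finite finite_subset by blast
    moreover have "line_poly 0 v f \<noteq> 0" using fv by (simp add: line_poly_homogeneous[OF hf])
    ultimately show "g \<in> P" by (simp add: P_def)
  qed
  then have "P \<in> associated_primes (radical_ideal Z)"
    using prime unfolding associated_primes_def by blast
  then have "Fraction_Field.Fract F 1 \<in> localized_ideal (ideal_power (radical_ideal Z) k) P"
    using F(1) unfolding symbolic_power_def by blast
  then obtain b s where bs: "Fraction_Field.Fract F 1 = Fraction_Field.Fract b s"
    "b \<in> ideal_power (radical_ideal Z) k" "s \<notin> P" by (auto simp: localized_ideal_def)
  have s0: "line_poly 0 v s \<noteq> 0" using bs(3) by (simp add: P_def)
  then have "s \<noteq> 0" by auto
  then have Fs: "s * F = b" using bs(1) by (simp add: eq_fract mult.commute)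
  \<comment> \<open>\<open>s\<close> may vanish at \<open>v\<close> itself; being outside
    \<open>P\<close>, it has only finitely many zeros on the line through \<open>v\<close>.\<close>
  have "finite ({t. poly (line_poly 0 v s) t = 0} \<union> {0})" using s0 poly_roots_finite by blast
  then obtain t where t: "poly (line_poly 0 v s) t \<noteq> 0" "t \<noteq> 0"
    using ex_new_if_finite[OF infinite_UNIV_char_0] by blast
  have tv: "t *s v \<in> p" "t *s v \<noteq> 0" using t v proj_point_eq_range[OF pp v] by auto
  have "ordge k (translate (t *s v) (s * F))"
    unfolding Fs by (rule ideal_power_ordge[OF bs(2)]) (use radical_ideal_vanishes[OF _ p tv] in blast)
  moreover have "poly_eval s (t *s v) \<noteq> 0" using t(1) by (simp add: poly_line_poly)
  ultimately have o: "ordge k (translate (t *s v) F)" by (rule ordge_translate_cancel[rotated])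
  \<comment> \<open>Homogeneity of \<open>F\<close> carries the order at \<open>t *s v\<close> back
    to \<open>v\<close>.\<close>
  have "translate v F - Cst (1 / t ^ d) * subst (\<lambda>i. Cst t * Var i) (translate (t *s v) F) = 0"
  proof (rule cpoly_identity)
    fix w :: "complex ^ 4"
    have "(\<chi> i. poly_eval (Cst t * Var i) w) = t *s w" by (simp add: vec_eq_iff)
    moreover have "t *s v + t *s w = t *s (v + w)" by (simp add: vec_eq_iff distrib_left)
    then have "poly_eval F (t *s v + t *s w) = t ^ d * poly_eval F (v + w)"
      by (simp only: poly_eval_homogeneous[OF F(2)])
    ultimately show "poly_eval (translate v F - Cst (1 / t ^ d) * subst (\<lambda>i. Cst t * Var i) (translate (t *s v) F)) w = 0"
      using t(2) by simp
  qed
  then have "translate v F = Cst (1 / t ^ d) * subst (\<lambda>i. Cst t * Var i) (translate (t *s v) F)" by simp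
  moreover have "ordge k (subst (\<lambda>i. Cst t * Var i) (translate (t *s v) F))"
    using o by (rule ordge_subst[rotated]) (intro ordge_mult_left ordge_Var)
  ultimately show ?thesis by (simp add: ordge_mult_left v_def)
qed

lemma power_mem_symbolic_power:
  assumes "f \<in> I" shows "f ^ k \<in> symbolic_power I k"
proof -
  have "(\<Prod>i<k. f) \<in> ideal_power I k"
    unfolding ideal_power_def using assms by (intro ideal.span_base) blast
  then have pw: "f ^ k \<in> ideal_power I k" by simp
  have "1 \<notin> P" if "P \<in> associated_primes I" for P
  proof
    assume "1 \<in> P"
    moreover have "ideal.subspace P" "P \<noteq> UNIV"
      using that by (auto simp: associated_primes_def prime_ideal_def)
    ultimately have "x \<in> P" for x using ideal.subspace_scale[of P 1 x] by simp
    then show False using \<open>P \<noteq> UNIV\<close> by blast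
  qed
  then show ?thesis using pw by (auto simp: symbolic_power_def localized_ideal_def)
qed

theorem theorem1p2:
  fixes Z :: "(complex ^ 4) set set"
    and I :: "4 cpoly set"
    and d :: nat
  assumes "finite Z" and "Z \<subseteq> proj_points"
    and "I = radical_ideal Z"
    and "d = initial_degree (symbolic_power I 3)"
    and "initial_degree (symbolic_power I 3) = initial_degree I + 2"
  shows "(initial_degree I = 1 \<and> (\<exists>H\<in>proj_planes. \<forall>p\<in>Z. p \<subseteq> H)) \<or>
    ((\<exists>\<H>. star_configuration Z d \<H>) \<and>
     (\<forall>F\<in>symbolic_power I 3. F \<noteq> 0 \<and> homogeneous d F \<longrightarrow>
        (\<exists>\<H>. star_configuration Z d \<H> \<and>
             surface F = {p\<in>proj_points. \<exists>H\<in>\<H>. p \<subseteq> H})))"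
proof -
  define rep where "rep p = (SOME x. x \<in> p \<and> x \<noteq> 0)" for p :: "(complex ^ 4) set"
  have rep: "rep p \<in> p \<and> rep p \<noteq> 0" if "p \<in> Z" for p
    unfolding rep_def by (rule someI_ex) (metis assms(2) proj_point_nonzero subsetD that)
  have vanish: "vanishes_at f p \<longleftrightarrow> poly_eval f (rep p) = 0" if "p \<in> Z" "homogeneous k f" for f p k
    using vanishes_at_iff[OF _ _ _ that(2)] rep[OF that(1)] assms(2) that(1) by blast
  have memI: "f \<in> I \<longleftrightarrow> (\<forall>p\<in>Z. poly_eval f (rep p) = 0)" if "homogeneous k f" for f k
    using radical_ideal_memI[OF that, of Z] radical_ideal_vanishes[of f Z] rep vanish[OF _ that]
    unfolding assms(3) by blast
  have "\<exists>a. a \<noteq> 0 \<and> poly_eval (linear_form a) (rep p) = 0" for p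
  proof -
    have "vec.dim {rep p} \<le> card {rep p}" by (rule vec.dim_le_card') simp
    moreover have "vec.dim (UNIV :: (complex ^ 4) set) = 4" unfolding vec_dim_card by simp
    ultimately have "vec.span {rep p} \<noteq> UNIV" by (metis card.empty card_insert_le_m1 numeral_le_one_iff semiring_norm(69) is_singletonI is_singleton_altdef vec.dim_span)
    then show ?thesis using ex_linear_form_vanishing[of "{rep p}"] by blast
  qed
  then obtain a where a: "\<And>p. a p \<noteq> 0" "\<And>p. poly_eval (linear_form (a p)) (rep p) = 0" by metis
  \<comment> \<open>A nonzero form in \<open>I\<close>, made of one plane through each point.
    Together with its cube it ensures that both initial degrees are attained.\<close>
  define G where "G = (\<Prod>p\<in>Z. linear_form (a p))"
  have G: "homogeneous (card Z) G" "G \<noteq> 0"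
    unfolding G_def using homogeneous_prod[of Z "\<lambda>_. 1" "\<lambda>p. linear_form (a p)"] homogeneous_linear_form a assms(1) by auto
  have "poly_eval G (rep p) = 0" if "p \<in> Z" for p
    using a(2)[of p] that assms(1) by (auto simp: G_def)
  then have "G \<in> I" using memI[OF G(1)] by blast
  then have ex1: "\<exists>k. \<exists>f\<in>I. f \<noteq> 0 \<and> homogeneous k f" using G by blast
  have "G ^ 3 \<in> symbolic_power I 3" by (rule power_mem_symbolic_power[OF \<open>G \<in> I\<close>])
  then have ex3: "\<exists>k. \<exists>f\<in>symbolic_power I 3. f \<noteq> 0 \<and> homogeneous k f"
    using G homogeneous_power[OF G(1), of 3] by (metis power_not_zero)
  have low: "avoids j (rep ` Z)" if "j < initial_degree I" for j
    unfolding avoids_def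
  proof (intro allI impI)
    fix f assume f: "homogeneous j f" "\<forall>x\<in>rep ` Z. poly_eval f x = 0"
    then have "f \<in> I" using memI[OF f(1)] by simp
    then show "f = 0" using not_less_Least[OF that[unfolded initial_degree_def]] f(1) by blast
  qed
  obtain g where g: "g \<in> I" "g \<noteq> 0" "homogeneous (initial_degree I) g"
    using LeastI_ex[OF ex1] unfolding initial_degree_def by blast
  obtain F where F: "F \<in> symbolic_power I 3" "F \<noteq> 0" "homogeneous d F"
    using LeastI_ex[OF ex3] unfolding assms(4) initial_degree_def by blast
  consider "initial_degree I = 0" | "initial_degree I = 1" | "2 \<le> initial_degree I" by linarith
  then show ?thesis
  proof cases
    case 1
    then obtain c where c: "g = Cst c" using g(3) homogeneous_0D by metis
    \<comment> \<open>A nonzero constant vanishes at no point. Then 1 lies in the symbolic power,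
      whose initial degree is 0 and not 2.\<close>
    have "Z = {}"
    proof (rule ccontr)
      assume "Z \<noteq> {}"
      then show False using g c memI[OF g(3)] by auto
    qed
    then have "1 \<in> I" using memI[of 0 1] by simp
    then have "1 \<in> symbolic_power I 3" using power_mem_symbolic_power[of 1 I 3] by simp
    then have "initial_degree (symbolic_power I 3) \<le> 0"
      unfolding initial_degree_def by (intro Least_le bexI[of _ 1]) auto
    then show ?thesis using assms(5) by simp
  next
    case 2
    then obtain v where v: "g = linear_form v" using g(3) homogeneous_1D by metis
    have "p \<subseteq> {x. poly_eval (linear_form v) x = 0}" if "p \<in> Z" for p
    proof -
      have p: "p \<in> proj_points" using that assms(2) by blast
      have "poly_eval (linear_form v) (rep p) = 0" using memI[OF g(3)] g(1) v that by simp
      moreover have "\<exists>c. x = c *s rep p" if "x \<in> p" for x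
        using proj_point_eq_range[OF p, of "rep p"] rep[OF \<open>p \<in> Z\<close>] that by blast
      ultimately show ?thesis
        by (metis (mono_tags) mem_Collect_eq mult_zero_right poly_eval_linear_form_scale subsetI)
    qed
    moreover have "{x. poly_eval (linear_form v) x = 0} \<in> proj_planes"
      by (rule linear_form_kernel_mem_proj_planes) (use g(2) v in auto)
    ultimately show ?thesis using 2 by blast
  next
    case 3
    \<comment> \<open>\<open>d - 3\<close> is one less than the initial degree of \<open>I\<close>,
      so \<open>low\<close> provides \<open>avoids (d - 3)\<close>.\<close>
    have d: "4 \<le> d" "d - 3 < initial_degree I" using assms(4,5) 3 by auto
    have star: "\<exists>\<H>. star_configuration Z d \<H> \<and> surface F = {p\<in>proj_points. \<exists>H\<in>\<H>. p \<subseteq> H}"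
      if F: "F \<in> symbolic_power I 3" "F \<noteq> 0" "homogeneous d F" for F
    proof -
      have ord: "ordge 3 (translate (rep p) F)" if "p \<in> Z" for p
        using symbolic_power_ordge[OF assms(1,2) rep _ F(3) that] F(1) unfolding assms(3) by blast
      have "splits F"
      proof (rule homogeneous_splits[OF d(1) _ _ F(3,2) _ low[OF d(2)]])
        show "0 \<notin> rep ` Z" using rep by force
      qed (use assms(1) ord in auto)
      then show ?thesis
        using star_configuration_if_splits[OF assms(1,2) rep F(3,2) d(1) _ ord low[OF d(2)]] by blast
    qed
    show ?thesis
    proof (intro disjI2 conjI ballI impI)
      show "\<exists>\<H>. star_configuration Z d \<H>" using star[OF F] by blast
      show "\<exists>\<H>. star_configuration Z d \<H> \<and> surface F = {p\<in>proj_points. \<exists>H\<in>\<H>. p \<subseteq> H}"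
        if "F \<in> symbolic_power I 3" "F \<noteq> 0 \<and> homogeneous d F" for F
        using that by (intro star) auto
    qed
  qed
qed

end
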